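(* Let $T>0$, let $\Omega\subset\mathbb{R}^N$ be a bounded domain, $\Omega_T=(0,T)\times\Omega$, and let $(k,l)\in\mathcal{PC}$. Let $\Phi:\mathbb{R}\to\mathbb{R}$ be continuous and strictly increasing with $\Phi(0)=0$, and let $a:\Omega_T\to\mathbb{R}$ be measurable with $0<a_1\le a(t,x)\le a_2$ for a.a. $(t,x)\in\Omega_T$, for some constants $a_1,a_2>0$. Let $u_0\in L_2(\Omega)$ and $f\in L_2(\Omega_T)$. Then there is at most one weak solution $u$ of the problem $$\partial_t\big(k\ast[u-u_0]\big)-\Delta\big(a\,\Phi(u)\big)=f\ \text{in }\Omega_T,\qquad u=0\ \text{on }(0,T)\times\partial\Omega,\qquad u|_{t=0}=u_0\ \text{in }\Omega,$$ in the following sense: $u\in L_2(\Omega_T)$, $k\ast u\in C([0,T];L_2(\Omega))$ with $(k\ast u)|_{t=0}=0$, $a\Phi(u)\in L_2((0,T);\mathring{H}^1_2(\Omega))$, and for all $\psi\in\mathring{H}^1_2(\Omega)$ and all $n\in\mathbb{N}$, $$\int_\Omega\Big(\psi\,\partial_t\big(k_n\ast[u-u_0]\big)+[h_n\ast\nabla(a\Phi(u))]\cdot\nabla\psi\Big)\,dx=\int_\Omega(h_n\ast f)\,\psi\,dx\quad\text{for a.a. }t\in(0,T).$$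
   Context: Condition $\mathcal{PC}$: $(k,l)\in\mathcal{PC}$ means that $k\in L_{1,loc}([0,\infty))$ is nonnegative and nonincreasing and $l\in L_{1,loc}([0,\infty))$ satisfies $k\ast l=1$ on $(0,\infty)$ (such $l$ is automatically nonnegative). Convolution in time: $(k\ast v)(t)=\int_0^t k(t-\tau)v(\tau)\,d\tau$. In $k_n\ast[u-u_0]$ the function $u_0=u_0(x)$ is regarded as constant in time. Regularized kernels: for $n\in\mathbb{N}$, $h_n\in L_{1,loc}([0,\infty))$ is the unique solution of $h_n(t)+n(h_n\ast l)(t)=n\,l(t)$, $t>0$, and $k_n=k\ast h_n$. Known facts: $h_n\ge0$, $k_n$ is nonnegative, nonincreasing and locally absolutely continuous on $[0,\infty)$ with locally integrable derivative. Spaces: $H^1_2(\Omega)=W^{1,2}(\Omega)$ and $\mathring{H}^1_2(\Omega)$ is the closure of $C_0^\infty(\Omega)$ in $H^1_2(\Omega)$. *)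

theory Defs
  imports "HOL-Analysis.Analysis"
begin

section \<open>Kernels and convolution in time\<close>

text \<open>Elements of Lebesgue spaces are represented by Lebesgue-measurable functions, and identities
  between them are almost-everywhere identities.\<close>

definition L1_loc :: "(real \<Rightarrow> real) set" where
  "L1_loc = {k. \<forall>S>0. k absolutely_integrable_on {0..S}}"

definition conv :: "(real \<Rightarrow> real) \<Rightarrow> (real \<Rightarrow> 'b::euclidean_space) \<Rightarrow> real \<Rightarrow> 'b" where
  "conv k v t = (LINT \<tau>:{0..t}|lebesgue. k (t - \<tau>) *\<^sub>R v \<tau>)"

text \<open>Monotonicity and sign of \<open>k\<close> are imposed on the open half-line, so that kernels such as
  \<open>t powr (- \<alpha>)\<close>, singular at \<open>0\<close>, are included whatever their formal value at \<open>0\<close>.\<close>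

definition PC :: "((real \<Rightarrow> real) \<times> (real \<Rightarrow> real)) set" where
  "PC = {(k, l). k \<in> L1_loc \<and> (\<forall>t>0. 0 \<le> k t) \<and> antimono_on {0<..} k \<and>
                 l \<in> L1_loc \<and> (AE t in lebesgue_on {0<..}. conv k l t = 1)}"

text \<open>The solution \<open>h\<^sub>n\<close> of the Volterra equation is unique only as an element of \<open>L1_loc\<close>, i.e.\ up
  to null sets; \<open>SOME\<close> picks a representative. Convolutions do not depend on this choice.\<close>

definition reg_h :: "(real \<Rightarrow> real) \<Rightarrow> nat \<Rightarrow> real \<Rightarrow> real" where
  "reg_h l n = (SOME h. h \<in> L1_loc \<and>
      (AE t in lebesgue_on {0<..}. h t + real n * conv h l t = real n * l t))"

definition reg_k :: "(real \<Rightarrow> real) \<Rightarrow> (real \<Rightarrow> real) \<Rightarrow> nat \<Rightarrow> real \<Rightarrow> real" where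
  "reg_k k l n = conv k (reg_h l n)"


section \<open>Function spaces\<close>

definition L2 :: "'a::euclidean_space set \<Rightarrow> ('a \<Rightarrow> 'b::euclidean_space) set" where
  "L2 S = {w. w \<in> borel_measurable (lebesgue_on S) \<and> integrable (lebesgue_on S) (\<lambda>x. (norm (w x))\<^sup>2)}"

primrec Ck :: "nat \<Rightarrow> ('a::euclidean_space \<Rightarrow> real) \<Rightarrow> bool" where
  "Ck 0 f \<longleftrightarrow> continuous_on UNIV f"
| "Ck (Suc m) f \<longleftrightarrow> (\<forall>x. f differentiable (at x)) \<and>
                   (\<forall>i\<in>Basis. Ck m (\<lambda>x. frechet_derivative f (at x) i))"

text \<open>The space \<open>C\<^sub>0\<^sup>\<infinity>(\<Omega>)\<close>, whose elements are regarded as extended by zero to the whole space.\<close>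

definition test_functions :: "'a::euclidean_space set \<Rightarrow> ('a \<Rightarrow> real) set" where
  "test_functions \<Omega> = {\<phi>. (\<forall>m. Ck m \<phi>) \<and>
      compact (closure {x. \<phi> x \<noteq> 0}) \<and> closure {x. \<phi> x \<noteq> 0} \<subseteq> \<Omega>}"

definition grad :: "('a::euclidean_space \<Rightarrow> real) \<Rightarrow> 'a \<Rightarrow> 'a" where
  "grad \<phi> x = (\<Sum>i\<in>Basis. frechet_derivative \<phi> (at x) i *\<^sub>R i)"

definition has_weak_gradient :: "'a::euclidean_space set \<Rightarrow> ('a \<Rightarrow> real) \<Rightarrow> ('a \<Rightarrow> 'a) \<Rightarrow> bool" where
  "has_weak_gradient \<Omega> w g \<longleftrightarrow> w \<in> L2 \<Omega> \<and> g \<in> L2 \<Omega> \<and>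
     (\<forall>\<phi>\<in>test_functions \<Omega>.
        (LINT x|lebesgue_on \<Omega>. w x *\<^sub>R grad \<phi> x) = - (LINT x|lebesgue_on \<Omega>. \<phi> x *\<^sub>R g x))"

definition H12 :: "'a::euclidean_space set \<Rightarrow> ('a \<Rightarrow> real) set" where
  "H12 \<Omega> = {w. \<exists>g. has_weak_gradient \<Omega> w g}"

text \<open>The closure of the test functions in the norm of \<open>H12\<close>; the weak gradient \<open>g\<close> is unique up to
  null sets.\<close>

definition H12_0 :: "'a::euclidean_space set \<Rightarrow> ('a \<Rightarrow> real) set" where
  "H12_0 \<Omega> = {w \<in> H12 \<Omega>. \<exists>g. has_weak_gradient \<Omega> w g \<and>
     (\<forall>e>0. \<exists>\<phi>\<in>test_functions \<Omega>.
        sqrt ((LINT x|lebesgue_on \<Omega>. (w x - \<phi> x)\<^sup>2)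
            + (LINT x|lebesgue_on \<Omega>. (norm (g x - grad \<phi> x))\<^sup>2)) < e)}"

text \<open>\<open>v \<in> L\<^sub>2((0,T); H12_0 \<Omega>)\<close> with spatial gradient \<open>\<nabla>v = G\<close>. As \<open>L\<^sub>2((0,T); L\<^sub>2(\<Omega>))\<close> is
  \<open>L\<^sub>2((0,T) \<times> \<Omega>)\<close>, elements of this Bochner space and their gradients are realised as jointly
  measurable functions of time and space.\<close>

definition L2_H12_0_grad ::
  "real \<Rightarrow> 'a::euclidean_space set \<Rightarrow> (real \<Rightarrow> 'a \<Rightarrow> real) \<Rightarrow> (real \<Rightarrow> 'a \<Rightarrow> 'a) \<Rightarrow> bool" where
  "L2_H12_0_grad T \<Omega> v G \<longleftrightarrow>
     (\<lambda>(t, x). v t x) \<in> L2 ({0<..<T} \<times> \<Omega>) \<and> (\<lambda>(t, x). G t x) \<in> L2 ({0<..<T} \<times> \<Omega>) \<and>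
     (AE t in lebesgue_on {0<..<T}. v t \<in> H12_0 \<Omega> \<and> has_weak_gradient \<Omega> (v t) (G t))"

text \<open>\<open>w \<in> C([0,T]; L\<^sub>2(\<Omega>))\<close> with \<open>w|\<^sub>t\<^sub>=\<^sub>0 = 0\<close>: the class of \<open>w\<close>, which is determined for almost all
  \<open>t\<close> only, has a representative \<open>F\<close> that is continuous from \<open>[0,T]\<close> to \<open>L\<^sub>2(\<Omega>)\<close> and vanishes at
  \<open>0\<close>.\<close>

definition C_L2_zero :: "real \<Rightarrow> 'a::euclidean_space set \<Rightarrow> (real \<Rightarrow> 'a \<Rightarrow> real) \<Rightarrow> bool" where
  "C_L2_zero T \<Omega> w \<longleftrightarrow> (\<exists>F.
     (\<forall>t\<in>{0..T}. F t \<in> L2 \<Omega>) \<and>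
     (\<forall>t\<in>{0..T}. ((\<lambda>s. sqrt (LINT x|lebesgue_on \<Omega>. (F s x - F t x)\<^sup>2)) \<longlongrightarrow> 0) (at t within {0..T})) \<and>
     (AE t in lebesgue_on {0<..<T}. AE x in lebesgue_on \<Omega>. F t x = w t x) \<and>
     (AE x in lebesgue_on \<Omega>. F 0 x = 0))"

text \<open>\<open>D = \<partial>\<^sub>t w\<close> as an \<open>L\<^sub>2(\<Omega>)\<close>-valued generalised derivative on \<open>(0,T)\<close>. For \<open>w = k\<^sub>n * v\<close> with
  \<open>v \<in> L\<^sub>2((0,T) \<times> \<Omega>)\<close> it always exists, because \<open>k\<^sub>n\<close> is locally absolutely continuous, and is the
  a.e. classical derivative in \<open>t\<close>.\<close>

definition has_weak_dt ::
  "real \<Rightarrow> 'a::euclidean_space set \<Rightarrow> (real \<Rightarrow> 'a \<Rightarrow> real) \<Rightarrow> (real \<Rightarrow> 'a \<Rightarrow> real) \<Rightarrow> bool" where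
  "has_weak_dt T \<Omega> w D \<longleftrightarrow>
     (\<lambda>(t, x). w t x) \<in> L2 ({0<..<T} \<times> \<Omega>) \<and> (\<lambda>(t, x). D t x) \<in> L2 ({0<..<T} \<times> \<Omega>) \<and>
     (\<forall>\<eta>\<in>test_functions {0<..<T}. AE x in lebesgue_on \<Omega>.
        (LINT t|lebesgue_on {0<..<T}. deriv \<eta> t * w t x)
          = - (LINT t|lebesgue_on {0<..<T}. \<eta> t * D t x))"


section \<open>Weak solutions\<close>

text \<open>In the integral identity, \<open>G\<close>, \<open>D\<close> and \<open>g\<close> stand for \<open>\<nabla>(a \<Phi>(u))\<close>, \<open>\<partial>\<^sub>t (k\<^sub>n * [u - u\<^sub>0])\<close> and
  \<open>\<nabla>\<psi>\<close>; each of them is unique up to null sets.\<close>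

definition weak_solution ::
  "(real \<Rightarrow> real) \<Rightarrow> (real \<Rightarrow> real) \<Rightarrow> real \<Rightarrow> 'a::euclidean_space set \<Rightarrow> (real \<Rightarrow> real) \<Rightarrow>
   (real \<Rightarrow> 'a \<Rightarrow> real) \<Rightarrow> ('a \<Rightarrow> real) \<Rightarrow> (real \<Rightarrow> 'a \<Rightarrow> real) \<Rightarrow> (real \<Rightarrow> 'a \<Rightarrow> real) \<Rightarrow> bool" where
  "weak_solution k l T \<Omega> \<Phi> a u0 f u \<longleftrightarrow>
     (\<lambda>(t, x). u t x) \<in> L2 ({0<..<T} \<times> \<Omega>) \<and>
     C_L2_zero T \<Omega> (\<lambda>t x. conv k (\<lambda>\<tau>. u \<tau> x) t) \<and>
     (\<exists>G. L2_H12_0_grad T \<Omega> (\<lambda>t x. a t x * \<Phi> (u t x)) G \<and>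
        (\<forall>n\<ge>1. \<exists>D. has_weak_dt T \<Omega> (\<lambda>t x. conv (reg_k k l n) (\<lambda>\<tau>. u \<tau> x - u0 x) t) D \<and>
           (\<forall>\<psi>\<in>H12_0 \<Omega>. \<forall>g. has_weak_gradient \<Omega> \<psi> g \<longrightarrow>
              (AE t in lebesgue_on {0<..<T}.
                 (LINT x|lebesgue_on \<Omega>.
                    \<psi> x * D t x + conv (reg_h l n) (\<lambda>\<tau>. G \<tau> x) t \<bullet> g x)
                 = (LINT x|lebesgue_on \<Omega>. conv (reg_h l n) (\<lambda>\<tau>. f \<tau> x) t * \<psi> x)))))"

end

theory Submission
  imports Defs
begin

text \<open>
  Write \<open>v = a \<Phi>(u)\<close>, and let \<open>U\<close>, \<open>V\<close>, \<open>G\<close> be the differences of the two solutions, of the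
  functions \<open>v\<close> and of their spatial gradients.  Formally \<open>\<partial>\<^sub>t (k * U) = div G\<close> with
  \<open>(k * U)(0) = 0\<close>.  Convolution with \<open>l\<close> inverts convolution with \<open>k\<close> up to one integration
  in time, so that \<open>\<integral> U \<psi> + \<integral> (l * G) \<bullet> \<nabla>\<psi> = 0\<close> for all \<open>\<psi>\<close> in \<open>H12_0\<close>.  The choice
  \<open>\<psi> = V(t)\<close> and integration over \<open>t\<close> give \<open>\<integral>\<integral> U V = - \<integral>\<integral> (l * G) \<bullet> G\<close>.  Convolution with \<open>l\<close> is a
  positive operator, hence \<open>\<integral>\<integral> U V \<le> 0\<close>.  On the other hand \<open>U V = a (u\<^sub>1 - u\<^sub>2) (\<Phi>(u\<^sub>1) - \<Phi>(u\<^sub>2))\<close>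
  is nonnegative, and positive wherever the two solutions differ; so they agree almost everywhere.

  The positivity comes from the monotonicity of \<open>k\<close>.  If \<open>g = 1 * q\<close> and \<open>p = l * q\<close>, then
  \<open>\<integral> (l * g) g = \<integral> (1 * p) (k * p)\<close>.  A nonnegative nonincreasing \<open>k\<close> is a superposition of indicators
  of intervals \<open>(0, r)\<close>, and for such an indicator \<open>k * p\<close> is the increment \<open>w(t) - w(t - r)\<close> of
  \<open>w = 1 * p\<close>, for which \<open>w(t) (w(t) - w(t - r)) \<ge> (w(t)\<^sup>2 - w(t - r)\<^sup>2) / 2\<close>.  These are the lemmas
  \<open>nonincreasing_kernel_positive\<close> and \<open>smoothed_resolvent_positive\<close>.

  The formal steps are carried out after convolution in time with a smooth mollifier \<open>b\<close>.  The weak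
  formulation is taken at \<open>n = 1\<close>, where the kernel \<open>h\<close> with \<open>h + h * l = l\<close> is produced by a Neumann
  series.  For fixed \<open>\<psi>\<close> the scalar function \<open>h * k * (U, \<psi>) + 1 * h * (G, \<nabla>\<psi>)\<close> has vanishing
  derivative and vanishing initial value, so it is \<open>0\<close>
  (\<open>vanishing_derivative_and_initial_value\<close>); convolving with \<open>l\<close> and then with \<open>k\<close> removes \<open>h\<close> and
  leaves \<open>b * (U, \<psi>) + (l * b) * (G, \<nabla>\<psi>) = 0\<close> (\<open>smoothed_volterra_identity\<close>).  Thanks to \<open>b\<close> this holds
  at every single time \<open>t < T\<close>, so the exceptional null sets do not depend on \<open>\<psi>\<close>, and \<open>\<psi> = V(s)\<close> may
  be inserted.  A second convolution with \<open>b\<close>, in \<open>s\<close>, turns the identity for pairs \<open>(t, s)\<close> into one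
  on the diagonal (\<open>diagonal_identity\<close>):
  \<open>\<integral> (b * U)(t) (b * V)(t) + \<integral> (l * b * G)(t) \<bullet> (b * G)(t) = 0\<close>.  Its second term integrates over
  \<open>(0, T)\<close> to a nonnegative number, and \<open>b * U\<close>, \<open>b * V\<close> converge to \<open>U\<close>, \<open>V\<close> in \<open>L\<^sub>2\<close> as \<open>b\<close> shrinks to a
  point mass.

  Throughout, functions are replaced by Borel representatives that vanish outside \<open>(0, T)\<close> or
  \<open>(0, T) \<times> \<Omega>\<close>.  Convolutions then become integrals over the whole line with respect to \<open>lborel\<close>,
  whose products are again \<open>lborel\<close>, so that Fubini's theorem applies.
\<close>

section \<open>Convolution on the real line\<close>


abbreviation lborel2 :: "('a::euclidean_space \<times> 'b::euclidean_space) measure" where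
  "lborel2 \<equiv> lborel \<Otimes>\<^sub>M lborel"

definition lconv :: "(real \<Rightarrow> real) \<Rightarrow> (real \<Rightarrow> 'b::euclidean_space) \<Rightarrow> real \<Rightarrow> 'b" where
  "lconv f g t = (LBINT s. f (t - s) *\<^sub>R g s)"

lemma lconv_measurable [measurable]:
  assumes [measurable]: "f \<in> borel_measurable borel" "g \<in> borel_measurable borel"
  shows "lconv f g \<in> borel_measurable borel"
  unfolding lconv_def by measurable

text \<open>Null sets are invariant under \<open>s \<mapsto> t - s\<close>; this makes \<open>lconv\<close> depend on almost-everywhere classes
  only, at every \<open>t\<close>.\<close>

lemma AE_lborel_reflect:
  fixes P :: "real \<Rightarrow> bool"
  assumes "AE s in lborel. P s"
  shows "AE s in lborel. P (t - s)"
proof -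
  obtain N where N: "{x \<in> space lborel. \<not> P x} \<subseteq> N" "emeasure lborel N = 0" "N \<in> sets lborel"
    using assms by (rule AE_E)
  have "AE s in lborel. s \<notin> N" using N by (intro AE_not_in) (simp add: null_sets_def)
  then have "AE s in lborel. t + (-1) * s \<notin> N"
    using N by (intro AE_borel_affine) auto
  then show ?thesis using N(1) by (auto elim!: eventually_mono)
qed

lemma lconv_commute:
  fixes f g :: "real \<Rightarrow> real"
  shows "lconv f g t = lconv g f t"
  unfolding lconv_def
  by (subst lborel_integral_real_affine[where c="-1" and t=t]) (simp_all add: mult.commute)

text \<open>If \<open>g\<close> vanishes on the negative half-line, then \<open>f (t - s)\<close> matters for \<open>s > 0\<close> only, so the
  values of a convolution before time \<open>T\<close> are determined by the factors before time \<open>T\<close>.\<close>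

lemma lconv_cong_left:
  assumes "AE s in lborel. s < T \<longrightarrow> f s = f' s" "\<And>s. s \<le> 0 \<Longrightarrow> g s = 0" "t \<le> T"
    and [measurable]: "f \<in> borel_measurable borel" "f' \<in> borel_measurable borel" "g \<in> borel_measurable borel"
  shows "lconv f g t = lconv f' g t"
  unfolding lconv_def
proof (rule integral_cong_AE)
  show "AE s in lborel. f (t - s) *\<^sub>R g s = f' (t - s) *\<^sub>R g s"
    using AE_lborel_reflect[OF assms(1), of t]
  proof eventually_elim
    case (elim s)
    then show ?case using assms(2)[of s] assms(3) by (cases "s \<le> 0") auto
  qed
qed measurable

lemma lconv_cong_right:
  assumes "AE s in lborel. s < T \<longrightarrow> g s = g' s" "\<And>s. s \<le> 0 \<Longrightarrow> f s = 0" "t \<le> T"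
    and [measurable]: "f \<in> borel_measurable borel" "g \<in> borel_measurable borel" "g' \<in> borel_measurable borel"
  shows "lconv f g t = lconv f g' t"
  unfolding lconv_def
proof (rule integral_cong_AE)
  show "AE s in lborel. f (t - s) *\<^sub>R g s = f (t - s) *\<^sub>R g' s"
    using assms(1)
  proof eventually_elim
    case (elim s)
    then show ?case using assms(2)[of "t - s"] assms(3) by (cases "s < t") auto
  qed
qed measurable

lemma lconv_causal:
  assumes "\<And>s. s \<le> 0 \<Longrightarrow> f s = 0" "\<And>s. s \<le> 0 \<Longrightarrow> g s = 0" "t \<le> 0"
  shows "lconv f g t = 0"
proof -
  have "f (t - s) *\<^sub>R g s = 0" for s
    using assms by (cases "s \<le> 0") auto
  then have "(\<lambda>s. f (t - s) *\<^sub>R g s) = (\<lambda>s. 0)" by blast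
  then show ?thesis by (simp only: lconv_def) simp
qed

text \<open>The source of all integrability in products with a convolution kernel: by translation invariance
  the integral over \<open>t\<close> separates.  The index \<open>n\<close> runs over times, pairs of times or points of
  space-time, and \<open>\<phi>\<close> extracts its time component.\<close>

lemma integrable_shifted_product:
  fixes F :: "'n \<Rightarrow> 'b::euclidean_space" and f :: "real \<Rightarrow> real"
  assumes N: "sigma_finite_measure N" and [measurable]: "\<phi> \<in> borel_measurable N"
    and f: "integrable lborel f" and F: "integrable N F"
  shows "integrable (lborel \<Otimes>\<^sub>M N) (\<lambda>(t, n). f (t - \<phi> n) *\<^sub>R F n)"
proof -
  interpret N: sigma_finite_measure N by fact
  interpret P: pair_sigma_finite N "lborel :: real measure" ..
  interpret P': pair_sigma_finite "lborel :: real measure" N ..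
  note [measurable] = borel_measurable_integrable[OF f] borel_measurable_integrable[OF F]
  have i: "integrable lborel (\<lambda>t. f (t - c))" for c
    using lborel_integrable_real_affine[OF f, of 1 "-c"] by simp
  have i': "(LBINT t. \<bar>f (t - c)\<bar>) = (LBINT t. \<bar>f t\<bar>)" for c
    by (subst (2) lborel_integral_real_affine[where c=1 and t="-c"]) simp_all
  have "integrable (N \<Otimes>\<^sub>M lborel) (\<lambda>(n, t). f (t - \<phi> n) *\<^sub>R F n)"
  proof (rule P.Fubini_integrable)
    show "AE x in N. integrable lborel (\<lambda>y. case (x, y) of (n, t) \<Rightarrow> f (t - \<phi> n) *\<^sub>R F n)"
      using i by auto
    show "integrable N (\<lambda>x. \<integral>y. norm (case (x, y) of (n, t) \<Rightarrow> f (t - \<phi> n) *\<^sub>R F n) \<partial>lborel)"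
      using F by (simp add: i')
  qed measurable
  from P.integrable_product_swap[OF this] show ?thesis by (simp add: case_prod_unfold)
qed

lemma AE_integrable_shifted_product:
  fixes F :: "'n \<Rightarrow> 'b::euclidean_space" and f :: "real \<Rightarrow> real"
  assumes N: "sigma_finite_measure N" and "\<phi> \<in> borel_measurable N"
    and "integrable lborel f" and "integrable N F"
  shows "AE t in lborel. integrable N (\<lambda>n. f (t - \<phi> n) *\<^sub>R F n)"
proof -
  interpret N: sigma_finite_measure N by fact
  interpret P': pair_sigma_finite "lborel :: real measure" N ..
  show ?thesis using P'.AE_integrable_fst[OF integrable_shifted_product[OF assms]] .
qed

lemma integrable_bounded_shifted_product:
  fixes F :: "'n \<Rightarrow> 'b::euclidean_space" and f :: "real \<Rightarrow> real"
  assumes [measurable]: "\<phi> \<in> borel_measurable N" "f \<in> borel_measurable borel"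
    and b: "\<And>s. \<bar>f s\<bar> \<le> C" and F: "integrable N F"
  shows "integrable N (\<lambda>n. f (t - \<phi> n) *\<^sub>R F n)"
proof (rule Bochner_Integration.integrable_bound)
  show "integrable N (\<lambda>n. C * norm (F n))" using F by auto
  note [measurable] = borel_measurable_integrable[OF F]
  show "(\<lambda>n. f (t - \<phi> n) *\<^sub>R F n) \<in> borel_measurable N" by measurable
  show "AE x in N. norm (f (t - \<phi> x) *\<^sub>R F x) \<le> norm (C * norm (F x))"
    using b by (auto simp: abs_mult intro!: mult_right_mono order_trans[OF b])
qed

lemma lconv_integrable:
  fixes f :: "real \<Rightarrow> real" and g :: "real \<Rightarrow> 'b::euclidean_space"
  assumes "integrable lborel f" "integrable lborel g"
  shows "integrable lborel (lconv f g)"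
  using lborel_pair.integrable_fst[OF integrable_shifted_product[OF sigma_finite_lborel _ assms, of "\<lambda>x. x"]]
  by (simp add: lconv_def[abs_def])

lemma lconv_AE_integrable:
  fixes f :: "real \<Rightarrow> real" and g :: "real \<Rightarrow> 'b::euclidean_space"
  assumes "integrable lborel f" "integrable lborel g"
  shows "AE t in lborel. integrable lborel (\<lambda>s. f (t - s) *\<^sub>R g s)"
  using AE_integrable_shifted_product[OF sigma_finite_lborel _ assms, of "\<lambda>x. x"] by simp

text \<open>Associativity at one point \<open>t\<close> is Fubini's theorem there.  For integrable factors it holds at almost
  every \<open>t\<close>; if the first factor is bounded, it holds at every \<open>t\<close>.\<close>

lemma lconv_assoc_at:
  fixes f g h :: "real \<Rightarrow> real"
  assumes "integrable lborel2 (\<lambda>(s, r). f (t - s) * (g (s - r) * h r))"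
  shows "lconv f (lconv g h) t = lconv (lconv f g) h t"
proof -
  have "lconv f (lconv g h) t = (LBINT s. (LBINT r. f (t - s) * (g (s - r) * h r)))"
    by (simp add: lconv_def)
  also have "\<dots> = (LBINT r. (LBINT s. f (t - s) * (g (s - r) * h r)))"
    using lborel_pair.Fubini_integral[OF assms] by simp
  also have "\<dots> = (LBINT r. (LBINT u. f (t - r - u) * g u) * h r)"
  proof (rule Bochner_Integration.integral_cong[OF refl])
    fix r
    have "(LBINT s. f (t - s) * (g (s - r) * h r)) = (LBINT s. f (t - s) * g (s - r)) * h r"
      by (subst mult.assoc[symmetric]) simp
    also have "(LBINT s. f (t - s) * g (s - r)) = (LBINT u. f (t - r - u) * g u)"
      by (subst lborel_integral_real_affine[where c=1 and t=r]) (simp_all add: algebra_simps)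
    finally show "(LBINT s. f (t - s) * (g (s - r) * h r)) = (LBINT u. f (t - r - u) * g u) * h r" .
  qed
  also have "\<dots> = lconv (lconv f g) h t" by (simp add: lconv_def)
  finally show ?thesis .
qed

lemma lconv_assoc_AE:
  fixes f g h :: "real \<Rightarrow> real"
  assumes "integrable lborel f" "integrable lborel g" "integrable lborel h"
  shows "AE t in lborel. lconv f (lconv g h) t = lconv (lconv f g) h t"
proof -
  have "AE t in lborel. integrable lborel2
          (\<lambda>n. f (t - fst n) *\<^sub>R (case n of (s, r) \<Rightarrow> g (s - r) *\<^sub>R h r))"
  proof (rule AE_integrable_shifted_product)
    show "sigma_finite_measure (lborel2 :: (real \<times> real) measure)"
      unfolding lborel_prod by (rule sigma_finite_lborel)
    show "integrable lborel2 (\<lambda>(s, r). g (s - r) *\<^sub>R h r)"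
      using integrable_shifted_product[OF sigma_finite_lborel _ assms(2,3), of "\<lambda>x. x"] by simp
  qed (use assms in auto)
  then show ?thesis
    by eventually_elim (auto intro!: lconv_assoc_at simp: case_prod_unfold)
qed

lemma lconv_assoc_bounded:
  fixes f g h :: "real \<Rightarrow> real"
  assumes "f \<in> borel_measurable borel" "\<And>s. \<bar>f s\<bar> \<le> C" "integrable lborel g" "integrable lborel h"
  shows "lconv f (lconv g h) t = lconv (lconv f g) h t"
proof -
  have "integrable lborel2
          (\<lambda>n. f (t - fst n) *\<^sub>R (case n of (s, r) \<Rightarrow> g (s - r) *\<^sub>R h r))"
  proof (rule integrable_bounded_shifted_product)
    show "integrable lborel2 (\<lambda>(s, r). g (s - r) *\<^sub>R h r)"
      using integrable_shifted_product[OF sigma_finite_lborel _ assms(3,4), of "\<lambda>x. x"] by simp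
  qed (use assms in auto)
  then show ?thesis by (auto intro!: lconv_assoc_at simp: case_prod_unfold)
qed

lemma lconv_bounded_integrable:
  fixes f :: "real \<Rightarrow> real" and g :: "real \<Rightarrow> 'b::euclidean_space"
  assumes "f \<in> borel_measurable borel" "\<And>s. \<bar>f s\<bar> \<le> C" "integrable lborel g"
  shows "integrable lborel (\<lambda>s. f (t - s) *\<^sub>R g s)"
  using integrable_bounded_shifted_product[of "\<lambda>x. x" lborel f C g t] assms by simp

lemma lconv_bounded:
  fixes f :: "real \<Rightarrow> real" and g :: "real \<Rightarrow> 'b::euclidean_space"
  assumes "f \<in> borel_measurable borel" "\<And>s. \<bar>f s\<bar> \<le> C" "integrable lborel g"
  shows "norm (lconv f g t) \<le> C * (LBINT s. norm (g s))"
proof -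
  have "norm (lconv f g t) \<le> (LBINT s. norm (f (t - s) *\<^sub>R g s))"
    unfolding lconv_def by (rule integral_norm_bound)
  also have "\<dots> \<le> (LBINT s. C * norm (g s))"
    using assms by (intro integral_mono integrable_norm lconv_bounded_integrable)
      (auto intro!: mult_right_mono)
  finally show ?thesis by simp
qed

lemma lconv_add_right:
  assumes "integrable lborel (\<lambda>s. f (t - s) *\<^sub>R g s)" "integrable lborel (\<lambda>s. f (t - s) *\<^sub>R g' s)"
  shows "lconv f (\<lambda>s. g s + g' s) t = lconv f g t + lconv f g' t"
  using assms by (simp add: lconv_def scaleR_add_right)

lemma lconv_diff_right:
  assumes "integrable lborel (\<lambda>s. f (t - s) *\<^sub>R g s)" "integrable lborel (\<lambda>s. f (t - s) *\<^sub>R g' s)"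
  shows "lconv f (\<lambda>s. g s - g' s) t = lconv f g t - lconv f g' t"
  using assms by (simp add: lconv_def scaleR_diff_right)

text \<open>Pairing in space commutes with convolution in time.  This reduces the equations in \<open>\<Omega>\<close> to scalar
  equations in time.\<close>

lemma lconv_pairing_at:
  fixes H :: "real \<Rightarrow> 'a::euclidean_space \<Rightarrow> 'b::euclidean_space" and g :: "'a \<Rightarrow> 'b"
  assumes i: "integrable lborel2 (\<lambda>n. \<kappa> (t - fst n) *\<^sub>R (case n of (s, x) \<Rightarrow> H s x))"
    and j: "integrable lborel2 (\<lambda>n. \<kappa> (t - fst n) *\<^sub>R (case n of (s, x) \<Rightarrow> H s x \<bullet> g x))"
    and [measurable]: "\<kappa> \<in> borel_measurable borel" "g \<in> borel_measurable borel"
      "(\<lambda>(s, x). H s x) \<in> borel_measurable lborel2"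
  shows "integrable lborel (\<lambda>x. lconv \<kappa> (\<lambda>s. H s x) t \<bullet> g x)" (is ?int)
    and "(LBINT x. lconv \<kappa> (\<lambda>s. H s x) t \<bullet> g x) = lconv \<kappa> (\<lambda>s. \<integral>x. H s x \<bullet> g x \<partial>lborel) t" (is ?eq)
proof -
  have i1: "integrable lborel2 (\<lambda>(s, x). \<kappa> (t - s) *\<^sub>R H s x)"
    and i2: "integrable lborel2 (\<lambda>(s, x). \<kappa> (t - s) * (H s x \<bullet> g x))"
    using i j by (simp_all add: case_prod_unfold)
  have "AE x in lborel. integrable lborel (\<lambda>s. \<kappa> (t - s) *\<^sub>R H s x)"
    by (rule lborel_pair.AE_integrable_snd[OF i1])
  then have eq: "AE x in lborel. (LBINT s. \<kappa> (t - s) * (H s x \<bullet> g x)) = lconv \<kappa> (\<lambda>s. H s x) t \<bullet> g x"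
  proof eventually_elim
    case (elim x)
    then have "lconv \<kappa> (\<lambda>s. H s x) t \<bullet> g x = (LBINT s. (\<kappa> (t - s) *\<^sub>R H s x) \<bullet> g x)"
      unfolding lconv_def by (rule integral_inner_left[symmetric])
    then show ?case by (simp only: inner_scaleR_left)
  qed
  have m: "(\<lambda>x. lconv \<kappa> (\<lambda>s. H s x) t \<bullet> g x) \<in> borel_measurable lborel"
    unfolding lconv_def by measurable
  have m': "(\<lambda>x. \<integral>s. \<kappa> (t - s) * (H s x \<bullet> g x) \<partial>lborel) \<in> borel_measurable lborel"
    by measurable
  show ?int
    using lborel_pair.integrable_snd[OF i2] integrable_cong_AE[OF m' m eq] by simp
  have "(LBINT x. lconv \<kappa> (\<lambda>s. H s x) t \<bullet> g x) = (LBINT x. (LBINT s. \<kappa> (t - s) * (H s x \<bullet> g x)))"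
    using integral_cong_AE[OF m' m eq] by simp
  also have "\<dots> = (LBINT s. (LBINT x. \<kappa> (t - s) * (H s x \<bullet> g x)))"
    using lborel_pair.Fubini_integral[OF i2] by simp
  finally show ?eq by (simp add: lconv_def)
qed

lemma sigma_finite_lborel_prod:
  "sigma_finite_measure (lborel2 :: ('a::euclidean_space \<times> 'b::euclidean_space) measure)"
  unfolding lborel_prod by (rule sigma_finite_lborel)

lemma measurable_fst_lborel: "fst \<in> borel_measurable lborel2"
  by measurable

lemma lconv_pairing_AE:
  fixes H :: "real \<Rightarrow> 'a::euclidean_space \<Rightarrow> 'b::euclidean_space" and g :: "'a \<Rightarrow> 'b"
  assumes "integrable lborel \<kappa>" "g \<in> borel_measurable borel"
    and "integrable lborel2 (\<lambda>(s, x). H s x)"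
    and "integrable lborel2 (\<lambda>(s, x). H s x \<bullet> g x)"
  shows "AE t in lborel. integrable lborel (\<lambda>x. lconv \<kappa> (\<lambda>s. H s x) t \<bullet> g x) \<and>
    (LBINT x. lconv \<kappa> (\<lambda>s. H s x) t \<bullet> g x) = lconv \<kappa> (\<lambda>s. \<integral>x. H s x \<bullet> g x \<partial>lborel) t"
  using AE_integrable_shifted_product[OF sigma_finite_lborel_prod measurable_fst_lborel assms(1,3)]
    AE_integrable_shifted_product[OF sigma_finite_lborel_prod measurable_fst_lborel assms(1,4)]
proof eventually_elim
  case (elim t)
  then show ?case
    using lconv_pairing_at[of \<kappa> t H g] assms by (auto dest: borel_measurable_integrable)
qed

lemma lconv_pairing_bounded:
  fixes H :: "real \<Rightarrow> 'a::euclidean_space \<Rightarrow> 'b::euclidean_space" and g :: "'a \<Rightarrow> 'b"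
  assumes "\<kappa> \<in> borel_measurable borel" "\<And>s. \<bar>\<kappa> s\<bar> \<le> C" "g \<in> borel_measurable borel"
    and "integrable lborel2 (\<lambda>(s, x). H s x)"
    and "integrable lborel2 (\<lambda>(s, x). H s x \<bullet> g x)"
  shows "integrable lborel (\<lambda>x. lconv \<kappa> (\<lambda>s. H s x) t \<bullet> g x)"
    and "(LBINT x. lconv \<kappa> (\<lambda>s. H s x) t \<bullet> g x) = lconv \<kappa> (\<lambda>s. \<integral>x. H s x \<bullet> g x \<partial>lborel) t"
  using lconv_pairing_at[of \<kappa> t H g] assms
    integrable_bounded_shifted_product[OF _ assms(1,2) assms(4), of fst]
    integrable_bounded_shifted_product[OF _ assms(1,2) assms(5), of fst]
  by (auto dest: borel_measurable_integrable)


section \<open>Causal functions and equality up to a time\<close>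

text \<open>Modulo equality before time \<open>T\<close> these functions form a commutative ring under convolution (without
  unit); identities between kernels are derived by computing in this ring.\<close>

definition causal_L1 :: "(real \<Rightarrow> real) \<Rightarrow> bool" where
  "causal_L1 f \<longleftrightarrow> integrable lborel f \<and> (\<forall>t\<le>0. f t = 0)"

definition eq_upto :: "real \<Rightarrow> (real \<Rightarrow> real) \<Rightarrow> (real \<Rightarrow> real) \<Rightarrow> bool" where
  "eq_upto T f g \<longleftrightarrow> (AE t in lborel. t < T \<longrightarrow> f t = g t)"

lemma causal_L1D:
  assumes "causal_L1 f"
  shows "integrable lborel f" "f \<in> borel_measurable borel" "t \<le> 0 \<Longrightarrow> f t = 0"
  using assms by (auto simp: causal_L1_def dest: borel_measurable_integrable)

lemma causal_L1_lconv:
  assumes "causal_L1 f" "causal_L1 g" shows "causal_L1 (lconv f g)"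
  unfolding causal_L1_def
  using lconv_integrable[of f g] lconv_causal[of f g] assms by (auto dest: causal_L1D)

lemma causal_L1_add: "causal_L1 f \<Longrightarrow> causal_L1 g \<Longrightarrow> causal_L1 (\<lambda>t. f t + g t)"
  by (auto simp: causal_L1_def)

lemma causal_L1_diff: "causal_L1 f \<Longrightarrow> causal_L1 g \<Longrightarrow> causal_L1 (\<lambda>t. f t - g t)"
  by (auto simp: causal_L1_def)

lemma causal_L1_indicator: "causal_L1 (indicator {0<..<T})"
proof -
  have "integrable lborel (indicator {0<..<T} :: real \<Rightarrow> real)"
    by (cases "0 \<le> T") (auto simp: integrable_indicator_iff)
  then show ?thesis by (auto simp: causal_L1_def)
qed

lemma eq_upto_refl: "eq_upto T f f" by (simp add: eq_upto_def)
lemma eq_upto_sym: "eq_upto T f g \<Longrightarrow> eq_upto T g f"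
  unfolding eq_upto_def by (auto elim: eventually_mono)
lemma eq_upto_trans [trans]: "eq_upto T f g \<Longrightarrow> eq_upto T g h \<Longrightarrow> eq_upto T f h"
  unfolding eq_upto_def by (rule eventually_elim2) auto

lemma lconv_eq_upto_pointwise:
  assumes "eq_upto T f f'" "eq_upto T g g'" "causal_L1 f" "causal_L1 f'" "causal_L1 g" "causal_L1 g'" "t \<le> T"
  shows "lconv f g t = lconv f' g' t"
proof -
  have "lconv f g t = lconv f' g t"
    using assms by (intro lconv_cong_left[of T]) (auto simp: eq_upto_def causal_L1D)
  also have "\<dots> = lconv f' g' t"
    using assms by (intro lconv_cong_right[of T]) (auto simp: eq_upto_def causal_L1D)
  finally show ?thesis .
qed

lemma lconv_eq_upto:
  assumes "eq_upto T f f'" "eq_upto T g g'" "causal_L1 f" "causal_L1 f'" "causal_L1 g" "causal_L1 g'"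
  shows "eq_upto T (lconv f g) (lconv f' g')"
  using lconv_eq_upto_pointwise[OF assms] by (auto simp: eq_upto_def)

lemma lconv_assoc_eq_upto:
  assumes "causal_L1 f" "causal_L1 g" "causal_L1 h"
  shows "eq_upto T (lconv f (lconv g h)) (lconv (lconv f g) h)"
  using lconv_assoc_AE[OF assms[THEN causal_L1D(1)]] unfolding eq_upto_def by (rule eventually_mono) simp

lemma lconv_left_commute_eq_upto:
  assumes f: "causal_L1 f" and g: "causal_L1 g" and h: "causal_L1 h"
  shows "eq_upto T (lconv f (lconv g h)) (lconv g (lconv f h))"
proof -
  note c = causal_L1_lconv
  have "eq_upto T (lconv f (lconv g h)) (lconv (lconv f g) h)"
    using assms by (rule lconv_assoc_eq_upto)
  also have "lconv f g = lconv g f" by (rule ext) (rule lconv_commute)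
  also have "eq_upto T (lconv (lconv g f) h) (lconv g (lconv f h))"
    by (intro eq_upto_sym[OF lconv_assoc_eq_upto] assms)
  finally show ?thesis .
qed

text \<open>Truncated at \<open>T\<close>, the kernel \<open>1\<close> is integrable, and convolution with it is still integration from
  \<open>0\<close> as long as \<open>t \<le> T\<close>.\<close>

lemma lconv_indicator:
  assumes "causal_L1 p" "t \<le> T"
  shows "lconv (indicator {0<..<T}) p t = (LBINT s. indicator {..<t} s * p s)"
proof -
  have "indicator {0<..<T} (t - s) *\<^sub>R p s = indicator {..<t} s * p s" for s
    using assms causal_L1D(3)[OF assms(1), of s]
    by (cases "s \<le> 0") (auto simp: indicator_def)
  then show ?thesis unfolding lconv_def by presburger
qed

lemma integrable_indicator_times [simp]:
  fixes p :: "'c::euclidean_space \<Rightarrow> real"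
  assumes "integrable lborel p" "A \<in> sets borel"
  shows "integrable lborel (\<lambda>s. indicator A s * p s)"
  using integrable_mult_indicator[of A lborel p] assms by simp

section \<open>Positivity of convolution with a nonincreasing kernel\<close>

text \<open>From \<open>2 x (x - y) \<ge> x\<^sup>2 - y\<^sup>2\<close>: the integral of \<open>w\<^sup>2\<close> over times before \<open>T\<close> is at least
  that over times before \<open>T - r\<close>.\<close>

lemma primitive_shift_positive:
  fixes w :: "real \<Rightarrow> real"
  assumes [measurable]: "w \<in> borel_measurable borel" and b: "\<And>t. \<bar>w t\<bar> \<le> C"
    and z: "\<And>t. t \<le> 0 \<Longrightarrow> w t = 0" and r: "0 \<le> r"
  shows "0 \<le> (LBINT t. indicator {..<T} t * (w t * (w t - w (t - r))))"
proof -
  have bnd: "integrable lborel (\<lambda>t. indicator {..<S} t * (w t)\<^sup>2)" for S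
  proof (rule Bochner_Integration.integrable_bound)
    show "integrable lborel (\<lambda>t. C\<^sup>2 * indicator {0<..<S} t)"
      using causal_L1_indicator[of S] by (auto simp: causal_L1_def)
    show "AE t in lborel. norm (indicator {..<S} t * (w t)\<^sup>2) \<le> norm (C\<^sup>2 * indicator {0<..<S} t)"
    proof (rule AE_I2)
      fix t
      have "(w t)\<^sup>2 \<le> C\<^sup>2" using b[of t] by (metis abs_ge_zero power2_abs power_mono)
      then show "norm (indicator {..<S} t * (w t)\<^sup>2) \<le> norm (C\<^sup>2 * indicator {0<..<S} t)"
        using z[of t] by (cases "t \<le> 0") (auto simp: indicator_def)
    qed
  qed measurable
  have sh: "integrable lborel (\<lambda>t. indicator {..<T - r} (t - r) * (w (t - r))\<^sup>2)"
    using lborel_integrable_real_affine[OF bnd[of "T-r"], of 1 "-r"] by simp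
  have sh_eq: "(LBINT t. indicator {..<T - r} (t - r) * (w (t - r))\<^sup>2) = (LBINT t. indicator {..<T - r} t * (w t)\<^sup>2)"
    by (subst (2) lborel_integral_real_affine[where c=1 and t="-r"]) simp_all
  have ind: "indicator {..<T - r} (t - r) = (indicator {..<T} t :: real)" for t
    by (auto simp: indicator_def)
  have "(LBINT t. indicator {..<T - r} t * (w t)\<^sup>2) \<le> (LBINT t. indicator {..<T} t * (w t)\<^sup>2)"
    using r by (intro integral_mono bnd) (auto simp: indicator_def)
  then have "0 \<le> (LBINT t. indicator {..<T} t * (w t)\<^sup>2) - (LBINT t. indicator {..<T} t * (w (t - r))\<^sup>2)"
    using sh_eq unfolding ind by simp
  also have "\<dots> = (LBINT t. indicator {..<T} t * (w t)\<^sup>2 - indicator {..<T} t * (w (t - r))\<^sup>2)"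
    using bnd[of T] sh unfolding ind by simp
  also have "\<dots> \<le> (LBINT t. 2 * (indicator {..<T} t * (w t * (w t - w (t - r)))))"
  proof (rule integral_mono)
    show "integrable lborel (\<lambda>t. indicator {..<T} t * (w t)\<^sup>2 - indicator {..<T} t * (w (t - r))\<^sup>2)"
      using bnd[of T] sh unfolding ind by simp
    show "integrable lborel (\<lambda>t. 2 * (indicator {..<T} t * (w t * (w t - w (t - r)))))"
    proof (rule Bochner_Integration.integrable_bound)
      show "integrable lborel (\<lambda>t. 3 * (indicator {..<T} t * (w t)\<^sup>2) + indicator {..<T} t * (w (t - r))\<^sup>2)"
        using bnd[of T] sh unfolding ind by simp
      have e: "2 * \<bar>x * (x - y)\<bar> \<le> 3 * x\<^sup>2 + y\<^sup>2" for x y :: real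
      proof -
        have "2 * (x * (x - y)) \<le> 3 * x\<^sup>2 + y\<^sup>2"
          using zero_le_power2[of "x + y"] by (simp add: power2_eq_square algebra_simps)
        moreover have "- (2 * (x * (x - y))) \<le> 3 * x\<^sup>2 + y\<^sup>2"
        proof -
          have "3 * x\<^sup>2 + y\<^sup>2 + 2 * (x * (x - y)) = (x - y)\<^sup>2 + 4 * x\<^sup>2"
            by (simp add: power2_eq_square algebra_simps)
          moreover have "0 \<le> (x - y)\<^sup>2 + 4 * x\<^sup>2" by simp
          ultimately show ?thesis by linarith
        qed
        ultimately show ?thesis by (simp add: abs_le_iff)
      qed
      show "AE t in lborel. norm (2 * (indicator {..<T} t * (w t * (w t - w (t - r)))))
          \<le> norm (3 * (indicator {..<T} t * (w t)\<^sup>2) + indicator {..<T} t * (w (t - r))\<^sup>2)"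
        using e by (auto simp: indicator_def abs_mult)
    qed measurable
    have e: "x\<^sup>2 - y\<^sup>2 \<le> 2 * (x * (x - y))" for x y :: real
      using zero_le_power2[of "x - y"] by (simp add: power2_eq_square algebra_simps)
    show "indicator {..<T} t * (w t)\<^sup>2 - indicator {..<T} t * (w (t - r))\<^sup>2 \<le> 2 * (indicator {..<T} t * (w t * (w t - w (t - r))))" for t
      using e[of "w t" "w (t - r)"] by (auto simp: indicator_def)
  qed
  finally show ?thesis by simp
qed

text \<open>The superlevel set \<open>{s. y < k s}\<close> is an initial interval; whether it contains its right end point is
  left open, which costs a null set.\<close>

lemma nonincreasing_level_set:
  fixes k :: "real \<Rightarrow> real"
  assumes supp: "\<And>s. s \<le> 0 \<or> T \<le> s \<Longrightarrow> k s = 0"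
    and mono: "\<And>s s'. 0 < s \<Longrightarrow> s \<le> s' \<Longrightarrow> s' < T \<Longrightarrow> k s' \<le> k s" and y: "0 < y"
  shows "\<exists>r\<ge>0. \<forall>s. s \<noteq> r \<longrightarrow> indicator {0<..<k s} y = (indicator {0<..<r} s :: real)"
proof (cases "\<exists>s. y < k s")
  case False
  then show ?thesis by (intro exI[of _ 0]) (auto simp: indicator_def)
next
  case True
  define S where "S = {s. y < k s}"
  define r where "r = Sup S"
  have S: "0 < s \<and> s < T" if "s \<in> S" for s
    using that supp[of s] y unfolding S_def by force
  have bdd: "bdd_above S" using S by (intro bdd_aboveI[of _ T]) force
  have ne: "S \<noteq> {}" using True by (auto simp: S_def)
  have up: "s \<le> r" if "s \<in> S" for s unfolding r_def by (rule cSup_upper[OF that bdd])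
  have low: "s \<in> S" if s: "0 < s" "s < r" for s
  proof -
    obtain s' where "s' \<in> S" "s < s'" using s(2) ne unfolding r_def by (meson less_cSupD)
    with S[of s'] mono[of s s'] s show ?thesis by (force simp: S_def)
  qed
  have "0 \<le> r" using ne up S by force
  moreover have "indicator {0<..<k s} y = (indicator {0<..<r} s :: real)" if "s \<noteq> r" for s
    using low[of s] up[of s] S[of s] that y by (auto simp: S_def indicator_def)
  ultimately show ?thesis by blast
qed

text \<open>Layer cake: \<open>k s\<close> is the integral over \<open>y\<close> of the indicator of \<open>{s. y < k s}\<close>, an interval
  \<open>(0, r)\<close>, and for the kernel \<open>indicator {0<..<r}\<close> the claim is \<open>primitive_shift_positive\<close>.\<close>

proposition nonincreasing_kernel_positive:
  fixes k p :: "real \<Rightarrow> real"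
  assumes k: "causal_L1 k" and k0: "\<And>s. 0 \<le> k s" and supp: "\<And>s. T \<le> s \<Longrightarrow> k s = 0"
    and mono: "\<And>s s'. 0 < s \<Longrightarrow> s \<le> s' \<Longrightarrow> s' < T \<Longrightarrow> k s' \<le> k s"
    and p: "causal_L1 p"
  shows "0 \<le> (LBINT t. indicator {..<T} t * (lconv (indicator {0<..<T}) p t * lconv k p t))"
proof -
  note [measurable] = causal_L1D(2)[OF k] causal_L1D(2)[OF p]
  note [simp] = causal_L1D(1)[OF k] causal_L1D(1)[OF p]
  define w where "w t = (LBINT s. indicator {..<t} s * p s)" for t
  define C where "C = (LBINT s. \<bar>p s\<bar>)"
  have m1: "(\<lambda>(t, s). indicator {..<t} s * p s) \<in> borel_measurable lborel2"
  proof -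
    have "(\<lambda>(t, s). (if s < t then 1 else 0) * p s) \<in> borel_measurable lborel2"
      by measurable
    then show ?thesis by (simp add: indicator_def of_bool_def case_prod_unfold)
  qed
  have [measurable]: "w \<in> borel_measurable borel"
    using lborel.borel_measurable_lebesgue_integral[OF m1] by (simp add: w_def[abs_def])
  have wC: "\<bar>w t\<bar> \<le> C" for t
  proof -
    have "\<bar>w t\<bar> \<le> (LBINT s. \<bar>indicator {..<t} s * p s\<bar>)"
      unfolding w_def by (rule integral_abs_bound)
    also have "\<dots> \<le> C" unfolding C_def
      by (intro integral_mono integrable_abs integrable_indicator_times) (auto simp: indicator_def)
    finally show ?thesis .
  qed
  have C0: "0 \<le> C" using wC[of 0] by linarith
  have w0: "w t = 0" if "t \<le> 0" for t
  proof -
    have "(\<lambda>s. indicator {..<t} s * p s) = (\<lambda>s. 0)"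
      using causal_L1D(3)[OF p] that by (auto simp: indicator_def)
    then show ?thesis unfolding w_def by simp
  qed
  define v where "v t = indicator {..<T} t * w t" for t
  have [measurable]: "v \<in> borel_measurable borel" unfolding v_def by measurable
  have vC: "\<bar>v t\<bar> \<le> C" for t using wC[of t] C0 by (auto simp: v_def indicator_def)
  \<comment> \<open>Used for the kernel \<open>k\<close> itself and for the indicators of its level sets.\<close>
  have exchange: "(LBINT t. v t * lconv \<kappa> p t) = (LBINT s. \<kappa> s * (LBINT t. v t * p (t - s)))"
    if \<kappa>: "integrable lborel \<kappa>" for \<kappa>
  proof -
    note [measurable] = borel_measurable_integrable[OF \<kappa>]
    have i: "integrable lborel2 (\<lambda>(t, s). v t * (p (t - s) * \<kappa> s))"
    proof (rule Bochner_Integration.integrable_bound)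
      show "integrable lborel2 (\<lambda>z. C * norm ((\<lambda>(t, s). p (t - s) *\<^sub>R \<kappa> s) z))"
        by (intro integrable_mult_right integrable_norm
            integrable_shifted_product[OF sigma_finite_lborel _ causal_L1D(1)[OF p] \<kappa>, of "\<lambda>x. x"]) simp
      show "AE z in lborel2. norm (case z of (t, s) \<Rightarrow> v t * (p (t - s) * \<kappa> s))
          \<le> norm (C * norm (case z of (t, s) \<Rightarrow> p (t - s) *\<^sub>R \<kappa> s))"
        using vC C0 by (intro AE_I2) (auto simp: abs_mult intro!: mult_right_mono)
    qed measurable
    have "(LBINT t. v t * lconv \<kappa> p t) = (LBINT t. (LBINT s. v t * (p (t - s) * \<kappa> s)))"
      by (subst lconv_commute) (simp add: lconv_def)
    also have "\<dots> = (LBINT s. (LBINT t. v t * (p (t - s) * \<kappa> s)))"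
      using lborel_pair.Fubini_integral[OF i] by simp
    also have "\<dots> = (LBINT s. \<kappa> s * (LBINT t. v t * p (t - s)))"
      by (subst mult.assoc[symmetric]) (simp add: mult.commute)
    finally show ?thesis .
  qed
  define A where "A s = (LBINT t. v t * p (t - s))" for s
  have [measurable]: "A \<in> borel_measurable borel" unfolding A_def by measurable
  have AC: "\<bar>A s\<bar> \<le> C * C" for s
  proof -
    have i: "integrable lborel (\<lambda>t. p (t - s))"
      using lborel_integrable_real_affine[OF causal_L1D(1)[OF p], of 1 "-s"] by simp
    have iv: "integrable lborel (\<lambda>t. v t * p (t - s))"
      by (rule Bochner_Integration.integrable_bound[of _ "\<lambda>t. C * p (t - s)"])
        (use i vC in \<open>auto simp: abs_mult intro!: mult_right_mono order_trans[OF vC]\<close>)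
    have "\<bar>A s\<bar> \<le> (LBINT t. \<bar>v t * p (t - s)\<bar>)"
      unfolding A_def by (rule integral_abs_bound)
    also have "\<dots> \<le> (LBINT t. C * \<bar>p (t - s)\<bar>)"
      using i iv vC by (intro integral_mono integrable_abs) (auto simp: abs_mult intro!: mult_right_mono)
    also have "(LBINT t. C * \<bar>p (t - s)\<bar>) = C * C"
      unfolding C_def by (subst (3) lborel_integral_real_affine[where c=1 and t="-s"]) simp_all
    finally show ?thesis .
  qed
  have level: "0 \<le> (LBINT s. indicator {0<..<k s} y * A s)" for y
  proof (cases "0 < y")
    case False
    then have "(\<lambda>s. indicator {0<..<k s} y * A s) = (\<lambda>s. 0)" by (auto simp: indicator_def)
    then show ?thesis by simp
  next
    case True
    obtain r where r: "0 \<le> r" "\<And>s. s \<noteq> r \<Longrightarrow> indicator {0<..<k s} y = (indicator {0<..<r} s :: real)"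
      using nonincreasing_level_set[of T k y] mono True supp causal_L1D(3)[OF k] by blast
    have "(LBINT s. indicator {0<..<k s} y * A s) = (LBINT s. indicator {0<..<r} s * A s)"
    proof (rule integral_cong_AE)
      show "AE s in lborel. indicator {0<..<k s} y * A s = indicator {0<..<r} s * A s"
        using AE_lborel_singleton[of r] by eventually_elim (simp add: r)
      have "(\<lambda>s. (if 0 < y \<and> y < k s then 1 else 0) * A s) \<in> borel_measurable lborel" by measurable
      then show "(\<lambda>s. indicator {0<..<k s} y * A s) \<in> borel_measurable lborel"
        by (simp add: indicator_def of_bool_def)
    qed measurable
    also have "\<dots> = (LBINT t. v t * lconv (indicator {0<..<r}) p t)"
      using exchange[of "indicator {0<..<r}"] causal_L1_indicator[of r] by (simp add: A_def causal_L1_def)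
    also have "\<dots> = (LBINT t. indicator {..<T} t * (w t * (w t - w (t - r))))"
    proof (rule integral_cong_AE)
      show "AE t in lborel. v t * lconv (indicator {0<..<r}) p t = indicator {..<T} t * (w t * (w t - w (t - r)))"
      proof (rule AE_I2)
        fix t
        have "lconv (indicator {0<..<r}) p t = (LBINT s. indicator {..<t} s * p s - indicator {..<t - r} s * p s)"
          unfolding lconv_def
        proof (rule integral_cong_AE)
          show "AE s in lborel. indicator {0<..<r} (t - s) *\<^sub>R p s = indicator {..<t} s * p s - indicator {..<t - r} s * p s"
            using AE_lborel_singleton[of "t - r"] by eventually_elim (use r(1) in \<open>auto simp: indicator_def\<close>)
        qed measurable
        also have "\<dots> = w t - w (t - r)" unfolding w_def by (intro Bochner_Integration.integral_diff) auto
        finally show "v t * lconv (indicator {0<..<r}) p t = indicator {..<T} t * (w t * (w t - w (t - r)))"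
          by (simp add: v_def)
      qed
    qed measurable
    also have "0 \<le> \<dots>" by (rule primitive_shift_positive[of w C r T]) (use wC w0 r in auto)
    finally show ?thesis .
  qed
  have i: "integrable lborel2 (\<lambda>(s, y). indicator {0<..<k s} y * A s)"
  proof (rule lborel_pair.Fubini_integrable)
    have "(\<lambda>(s, y). (if 0 < y \<and> y < k s then 1 else 0) * A s) \<in> borel_measurable lborel2" by measurable
    then show "(\<lambda>(s, y). indicator {0<..<k s} y * A s) \<in> borel_measurable lborel2"
      by (simp add: indicator_def of_bool_def case_prod_unfold)
    have "(LBINT y. norm (indicator {0<..<k s} y * A s)) = k s * \<bar>A s\<bar>" for s
      using k0[of s] by (simp add: abs_mult)
    moreover have "integrable lborel (\<lambda>s. k s * \<bar>A s\<bar>)"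
      by (rule Bochner_Integration.integrable_bound[of _ "\<lambda>s. k s * (C * C)"])
        (use AC k0 C0 in \<open>auto simp: abs_mult intro!: mult_left_mono\<close>)
    ultimately show "integrable lborel (\<lambda>s. \<integral>y. norm (case (s, y) of (s, y) \<Rightarrow> indicator {0<..<k s} y * A s) \<partial>lborel)"
      by simp
    show "AE s in lborel. integrable lborel (\<lambda>y. case (s, y) of (s, y) \<Rightarrow> indicator {0<..<k s} y * A s)"
      using k0 by (auto intro!: integrable_mult_left simp: integrable_indicator_iff)
  qed
  have "(LBINT t. indicator {..<T} t * (lconv (indicator {0<..<T}) p t * lconv k p t)) = (LBINT t. v t * lconv k p t)"
    using lconv_indicator[OF p, of _ T]
    by (intro Bochner_Integration.integral_cong) (auto simp: v_def w_def indicator_def)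
  also have "\<dots> = (LBINT s. k s * A s)" using exchange[of k] by (simp add: A_def)
  also have "\<dots> = (LBINT s. (LBINT y. indicator {0<..<k s} y * A s))"
    using k0 by (intro Bochner_Integration.integral_cong) auto
  also have "\<dots> = (LBINT y. (LBINT s. indicator {0<..<k s} y * A s))"
    using lborel_pair.Fubini_integral[OF i] by simp
  also have "0 \<le> \<dots>" by (rule Bochner_Integration.integral_nonneg) (rule level)
  finally show ?thesis .
qed

text \<open>Positivity of convolution with \<open>l\<close>, on functions of the form \<open>b * g\<close>.  As \<open>b = 1 * b'\<close>, the
  function \<open>p = l * b' * g\<close> has \<open>1 * p = l * b * g\<close> and \<open>k * p = 1 * b' * g = b * g\<close>.\<close>

lemma smoothed_resolvent_positive:
  assumes k: "causal_L1 k" and k0: "\<And>s. 0 \<le> k s" and supp: "\<And>s. T \<le> s \<Longrightarrow> k s = 0"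
    and mono: "\<And>s s'. 0 < s \<Longrightarrow> s \<le> s' \<Longrightarrow> s' < T \<Longrightarrow> k s' \<le> k s"
    and l: "causal_L1 l" and kl: "eq_upto T (lconv k l) (indicator {0<..<T})"
    and b: "causal_L1 b" and b': "causal_L1 b'" and prim: "eq_upto T (lconv (indicator {0<..<T}) b') b"
    and g: "causal_L1 g"
  shows "0 \<le> (LBINT t. indicator {..<T} t * (lconv (lconv l b) g t * lconv b g t))"
proof -
  note c = causal_L1_lconv causal_L1_indicator assms
  define p where "p = lconv l (lconv b' g)"
  have p: "causal_L1 p" unfolding p_def by (intro c)
  have bg: "eq_upto T (lconv (indicator {0<..<T}) (lconv b' g)) (lconv b g)"
  proof -
    have "eq_upto T (lconv (indicator {0<..<T}) (lconv b' g)) (lconv (lconv (indicator {0<..<T}) b') g)"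
      by (intro lconv_assoc_eq_upto c)
    also have "eq_upto T \<dots> (lconv b g)"
      by (intro lconv_eq_upto c eq_upto_refl)
    finally show ?thesis .
  qed
  have "eq_upto T (lconv (indicator {0<..<T}) p) (lconv l (lconv (indicator {0<..<T}) (lconv b' g)))"
    unfolding p_def by (intro lconv_left_commute_eq_upto c)
  also have "eq_upto T \<dots> (lconv l (lconv b g))"
    by (intro lconv_eq_upto c eq_upto_refl bg)
  also have "eq_upto T \<dots> (lconv (lconv l b) g)"
    by (intro lconv_assoc_eq_upto c)
  finally have 1: "eq_upto T (lconv (indicator {0<..<T}) p) (lconv (lconv l b) g)" .
  have "eq_upto T (lconv k p) (lconv (lconv k l) (lconv b' g))"
    unfolding p_def by (intro lconv_assoc_eq_upto c)
  also have "eq_upto T \<dots> (lconv (indicator {0<..<T}) (lconv b' g))"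
    by (intro lconv_eq_upto c eq_upto_refl)
  also note bg
  finally have 2: "eq_upto T (lconv k p) (lconv b g)" .
  have [measurable]: "causal_L1 f \<Longrightarrow> f \<in> borel_measurable borel" for f by (rule causal_L1D)
  have "0 \<le> (LBINT t. indicator {..<T} t * (lconv (indicator {0<..<T}) p t * lconv k p t))"
    by (intro nonincreasing_kernel_positive assms p) auto
  also have "\<dots> = (LBINT t. indicator {..<T} t * (lconv (lconv l b) g t * lconv b g t))"
  proof (rule integral_cong_AE)
    show "AE t in lborel. indicator {..<T} t * (lconv (indicator {0<..<T}) p t * lconv k p t) =
        indicator {..<T} t * (lconv (lconv l b) g t * lconv b g t)"
      using 1 2 unfolding eq_upto_def by eventually_elim (auto simp: indicator_def)
  qed (auto intro!: borel_measurable_times borel_measurable_indicator lconv_measurable causal_L1D(2)[OF p] assms(1,5,7,8,10)[THEN causal_L1D(2)])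
  finally show ?thesis .
qed


section \<open>Smooth bump functions\<close>

text \<open>Functions of this form are closed under differentiation and vanish to infinite order at \<open>0\<close>.\<close>

definition flat :: "real poly \<Rightarrow> real \<Rightarrow> real" where
  "flat p x = (if 0 < x then poly p (1 / x) * exp (- (1 / x)) else 0)"

lemma tendsto_poly_exp_neg: "((\<lambda>y. poly p y * exp (- y)) \<longlongrightarrow> (0::real)) at_top"
proof -
  have "((\<lambda>y. \<Sum>i\<le>degree p. coeff p i * (y ^ i / exp y)) \<longlongrightarrow> (\<Sum>i\<le>degree p. coeff p i * 0)) at_top"
    by (intro tendsto_intros tendsto_power_div_exp_0)
  then show ?thesis
    by (simp add: poly_altdef sum_distrib_right exp_minus divide_inverse mult.assoc)
qed

text \<open>In terms of \<open>y = 1 / h\<close> the difference quotient at \<open>0\<close> is \<open>y\<close> times a polynomial in \<open>y\<close> times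
  \<open>exp (- y)\<close>, which tends to \<open>0\<close>.\<close>

lemma flat_derivative: "(flat p has_real_derivative flat ([:0, 0, 1:] * (p - pderiv p)) x) (at x)"
proof (cases "0 < x")
  case True
  have ev: "\<forall>\<^sub>F y in nhds x. flat p y = poly p (1 / y) * exp (- (1 / y))"
    using eventually_nhds_in_open[of "{0<..}" x] True by (auto simp: flat_def elim: eventually_mono)
  have inv: "((\<lambda>x. 1 / x) has_real_derivative - ((1 / x) * (1 / x))) (at x)"
    using True by (auto intro!: derivative_eq_intros simp: power2_eq_square)
  have "((\<lambda>x. poly p (1 / x) * exp (- (1 / x))) has_real_derivative
      poly p (1 / x) * (exp (- (1 / x)) * - (- ((1 / x) * (1 / x)))) +
      poly (pderiv p) (1 / x) * (- ((1 / x) * (1 / x))) * exp (- (1 / x))) (at x)"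
    by (intro DERIV_mult' DERIV_chain2[OF poly_DERIV inv] DERIV_chain2[OF DERIV_exp DERIV_minus[OF inv]])
  also have "poly p (1 / x) * (exp (- (1 / x)) * - (- ((1 / x) * (1 / x)))) +
      poly (pderiv p) (1 / x) * (- ((1 / x) * (1 / x))) * exp (- (1 / x)) =
      flat ([:0, 0, 1:] * (p - pderiv p)) x"
    using True by (simp add: flat_def algebra_simps)
  finally show ?thesis
    using DERIV_cong_ev[OF refl ev refl] by blast
next
  case False
  then consider "x < 0" | "x = 0" by linarith
  then show ?thesis
  proof cases
    case 1
    have "\<forall>\<^sub>F y in nhds x. flat p y = 0"
      using eventually_nhds_in_open[of "{..<0}" x] 1 by (auto simp: flat_def elim: eventually_mono)
    then have "(flat p has_real_derivative 0) (at x) \<longleftrightarrow> ((\<lambda>_. 0) has_real_derivative (0::real)) (at x)"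
      by (intro DERIV_cong_ev) auto
    then show ?thesis using 1 by (simp add: flat_def)
  next
    case 2
    have "((\<lambda>h. (flat p h - flat p 0) / (h - 0)) \<longlongrightarrow> 0) (at 0)"
      unfolding filterlim_at_split
    proof
      show "((\<lambda>h. (flat p h - flat p 0) / (h - 0)) \<longlongrightarrow> 0) (at_left 0)"
        by (rule tendsto_eventually) (auto simp: eventually_at_filter flat_def)
      have "((\<lambda>h. poly (pCons 0 p) (inverse h) * exp (- inverse h)) \<longlongrightarrow> 0) (at_right (0::real))"
        by (rule filterlim_compose[OF tendsto_poly_exp_neg filterlim_inverse_at_top_right])
      moreover have "\<forall>\<^sub>F h in at_right 0. poly (pCons 0 p) (inverse h) * exp (- inverse h) = (flat p h - flat p 0) / (h - 0)"
        by (auto simp: eventually_at_filter flat_def field_simps)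
      ultimately show "((\<lambda>h. (flat p h - flat p 0) / (h - 0)) \<longlongrightarrow> 0) (at_right 0)"
        by (rule Lim_transform_eventually)
    qed
    then show ?thesis using 2 by (simp add: has_field_derivative_iff flat_def)
  qed
qed

text \<open>Smooth functions supported in \<open>[0, 1]\<close>.  The set is closed under differentiation and each of its
  members manifestly vanishes outside \<open>(0, 1)\<close>, so smoothness and the support of all derivatives come
  by induction.\<close>

inductive_set bumps :: "(real \<Rightarrow> real) set" where
  prod: "(\<lambda>x. flat p x * flat q (1 - x)) \<in> bumps"
| add: "f \<in> bumps \<Longrightarrow> g \<in> bumps \<Longrightarrow> (\<lambda>x. f x + g x) \<in> bumps"
| scale: "f \<in> bumps \<Longrightarrow> (\<lambda>x. c * f x) \<in> bumps"

lemma bumps_support: "f \<in> bumps \<Longrightarrow> x \<le> 0 \<or> 1 \<le> x \<Longrightarrow> f x = 0"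
  by (induction rule: bumps.induct) (auto simp: flat_def)

lemma bumps_derivative:
  "f \<in> bumps \<Longrightarrow> \<exists>f'\<in>bumps. \<forall>x. (f has_real_derivative f' x) (at x)"
proof (induction rule: bumps.induct)
  case (prod p q)
  define D where "D p = [:0, 0, 1:] * (p - pderiv p)" for p :: "real poly"
  have "((\<lambda>x. flat p x * flat q (1 - x)) has_real_derivative
      flat (D p) x * flat q (1 - x) + (- 1) * (flat p x * flat (D q) (1 - x))) (at x)" for x
  proof -
    have "((\<lambda>x. flat q (1 - x)) has_real_derivative flat (D q) (1 - x) * (- 1)) (at x)"
      unfolding D_def by (rule DERIV_chain2[OF flat_derivative]) (auto intro!: derivative_eq_intros)
    from DERIV_mult[OF flat_derivative[of p x] this] show ?thesis
      by (simp only: D_def) (simp add: algebra_simps)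
  qed
  moreover have "(\<lambda>x. flat (D p) x * flat q (1 - x) + (- 1) * (flat p x * flat (D q) (1 - x))) \<in> bumps"
    by (intro bumps.intros)
  ultimately show ?case by (intro bexI allI)
next
  case (add f g)
  then obtain f' g' where "f' \<in> bumps" "g' \<in> bumps" "\<And>x. (f has_real_derivative f' x) (at x)" "\<And>x. (g has_real_derivative g' x) (at x)"
    by auto
  then show ?case by (intro bexI[of _ "\<lambda>x. f' x + g' x"]) (auto intro!: bumps.intros DERIV_add)
next
  case (scale f c)
  then obtain f' where "f' \<in> bumps" "\<And>x. (f has_real_derivative f' x) (at x)"
    by auto
  then show ?case by (intro bexI[of _ "\<lambda>x. c * f' x"]) (auto intro!: bumps.intros DERIV_cmult)
qed

lemma bumps_continuous: "f \<in> bumps \<Longrightarrow> continuous_on UNIV f"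
  using bumps_derivative[of f] by (meson DERIV_isCont continuous_at_imp_continuous_on)

lemma bumps_bounded: assumes "f \<in> bumps" obtains C where "\<And>x. \<bar>f x\<bar> \<le> C" "0 \<le> C"
proof -
  have "compact (f ` {0..1})"
    using bumps_continuous[OF assms] by (intro compact_continuous_image) (auto intro: continuous_on_subset)
  then have "bounded (f ` {0..1})" by (rule compact_imp_bounded)
  then obtain B where B: "\<And>x. x \<in> {0..1} \<Longrightarrow> \<bar>f x\<bar> \<le> B"
    unfolding bounded_iff by (metis imageI real_norm_def)
  have "\<bar>f x\<bar> \<le> \<bar>B\<bar>" for x
    using B[of x] bumps_support[OF assms, of x] by (cases "x \<in> {0..1}") auto
  then show thesis using that by fastforce
qed

text \<open>The affine change of variables is part of the induction because test functions are used in the form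
  \<open>s \<mapsto> f ((t - s) / \<epsilon>)\<close>.\<close>

lemma bumps_Ck: "f \<in> bumps \<Longrightarrow> Ck m (\<lambda>s. f (\<alpha> * s + \<beta>))"
proof (induction m arbitrary: f)
  case 0
  then show ?case
    using continuous_on_compose2[OF bumps_continuous, of f UNIV "\<lambda>s. \<alpha> * s + \<beta>"]
    by (simp add: continuous_on_add continuous_on_mult)
next
  case (Suc m)
  then obtain f' where f': "f' \<in> bumps" "\<And>x. (f has_real_derivative f' x) (at x)"
    using bumps_derivative by blast
  have d: "((\<lambda>s. f (\<alpha> * s + \<beta>)) has_real_derivative \<alpha> * f' (\<alpha> * s + \<beta>)) (at s)" for s
  proof -
    have "((\<lambda>s. f (\<alpha> * s + \<beta>)) has_real_derivative f' (\<alpha> * s + \<beta>) * \<alpha>) (at s)"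
      by (rule DERIV_chain2[OF f'(2)]) (auto intro!: derivative_eq_intros)
    then show ?thesis by (simp add: mult.commute)
  qed
  have "frechet_derivative (\<lambda>s. f (\<alpha> * s + \<beta>)) (at s) = (*) (\<alpha> * f' (\<alpha> * s + \<beta>))" for s
    using frechet_derivative_at[OF d[of s, unfolded has_field_derivative_def]] by simp
  moreover have "Ck m (\<lambda>s. \<alpha> * f' (\<alpha> * s + \<beta>))"
    using Suc.IH[OF bumps.scale[OF f'(1), of \<alpha>]] by simp
  moreover have "(\<lambda>s. f (\<alpha> * s + \<beta>)) differentiable (at s)" for s
    using d[of s] unfolding has_field_derivative_def differentiable_def by blast
  ultimately show ?case by simp
qed

lemma unit_mollifier:
  obtains \<rho> where "\<rho> \<in> bumps" "\<And>x. 0 \<le> \<rho> x" "(LBINT x. \<rho> x) = 1" "integrable lborel \<rho>"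
proof -
  define f where "f = (\<lambda>x. flat 1 x * flat 1 (1 - x))"
  have f: "f \<in> bumps" unfolding f_def by (rule bumps.prod)
  have f0: "0 \<le> f x" for x by (auto simp: f_def flat_def)
  obtain C where C: "\<And>x. \<bar>f x\<bar> \<le> C" "0 \<le> C" using bumps_bounded[OF f] by metis
  have [measurable]: "f \<in> borel_measurable borel"
    using bumps_continuous[OF f] by (simp add: borel_measurable_continuous_onI)
  have i: "integrable lborel f"
  proof (rule Bochner_Integration.integrable_bound)
    show "integrable lborel (\<lambda>x. C * indicator {0..1::real} x)" by auto
    show "AE x in lborel. norm (f x) \<le> norm (C * indicator {0..1} x)"
      using C bumps_support[OF f] by (auto simp: indicator_def)
  qed simp
  have "(LBINT x. f x) \<noteq> 0"
  proof
    assume "(LBINT x. f x) = 0"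
    then have "AE x in lborel. f x = 0"
      using integral_nonneg_eq_0_iff_AE[OF i] f0 by auto
    then have "AE x in lborel. x \<notin> {0<..<1::real}"
      by eventually_elim (auto simp: f_def flat_def)
    then have "emeasure lborel {0<..<1::real} = 0"
      by (simp add: AE_iff_measurable[OF _ refl] greaterThanLessThan_def greaterThan_def lessThan_def Int_def)
    moreover have "emeasure lborel {0<..<1::real} = 1" by simp
    ultimately show False by (simp only:) simp
  qed
  moreover have "0 \<le> (LBINT x. f x)" by (rule Bochner_Integration.integral_nonneg) (rule f0)
  ultimately have pos: "0 < (LBINT x. f x)" by linarith
  define c where "c = 1 / (LBINT x. f x)"
  show thesis
  proof (rule that[of "\<lambda>x. c * f x"])
    show "(\<lambda>x. c * f x) \<in> bumps" by (rule bumps.scale[OF f])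
  qed (use pos f0 i in \<open>auto simp: c_def\<close>)
qed


section \<open>Continuity of translations and convergence of mollifications\<close>

lemma lborel_translate:
  fixes f :: "'c::euclidean_space \<Rightarrow> real"
  assumes f: "integrable lborel f"
  shows "integrable lborel (\<lambda>z. f (z + v))" and "(LBINT z. f (z + v)) = (LBINT z. f z)"
proof -
  have d: "distr lborel borel (\<lambda>z. z + v) = lborel"
    using lborel_distr_plus[of v] by (metis (no_types, lifting) add.commute distr_cong)
  show "integrable lborel (\<lambda>z. f (z + v))"
    using f integrable_distr_eq[of "\<lambda>z. z + v" lborel borel f] by (simp add: d)
  show "(LBINT z. f (z + v)) = (LBINT z. f z)"
    using f integral_distr[of "\<lambda>z. z + v" lborel borel f] by (simp add: d)
qed

text \<open>Continuity at \<open>0\<close> of translation in \<open>L\<^sub>1\<close>, in sequential form so that dominated convergence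
  applies.\<close>

definition translation_continuous :: "('c::euclidean_space \<Rightarrow> real) \<Rightarrow> bool" where
  "translation_continuous f \<longleftrightarrow>
     (\<forall>v. v \<longlonglongrightarrow> 0 \<longrightarrow> (\<lambda>i::nat. \<integral>z. \<bar>f (z + v i) - f z\<bar> \<partial>lborel) \<longlonglongrightarrow> 0)"

lemma translation_continuous_approx:
  fixes f :: "'c::euclidean_space \<Rightarrow> real"
  assumes f: "integrable lborel f"
    and approx: "\<And>e. 0 < e \<Longrightarrow> \<exists>g. integrable lborel g \<and> translation_continuous g \<and> (LBINT z. \<bar>f z - g z\<bar>) < e"
  shows "translation_continuous f"
  unfolding translation_continuous_def
proof (intro allI impI)
  fix v :: "nat \<Rightarrow> 'c" assume v: "v \<longlonglongrightarrow> 0"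
  show "(\<lambda>i. \<integral>z. \<bar>f (z + v i) - f z\<bar> \<partial>lborel) \<longlonglongrightarrow> 0"
  proof (rule LIMSEQ_I)
    fix e :: real assume e: "0 < e"
    obtain g where g: "integrable lborel g" "translation_continuous g" "(LBINT z. \<bar>f z - g z\<bar>) < e / 4"
      using approx[of "e / 4"] e by auto
    obtain N where N: "\<And>i. i \<ge> N \<Longrightarrow> (LBINT z. \<bar>g (z + v i) - g z\<bar>) < e / 2"
      using LIMSEQ_D[of "\<lambda>i. \<integral>z. \<bar>g (z + v i) - g z\<bar> \<partial>lborel" 0 "e / 2"] g(2) v e
      unfolding translation_continuous_def by fastforce
    have "(LBINT z. \<bar>f (z + v i) - f z\<bar>) < e" if "i \<ge> N" for i
    proof -
      have fg: "integrable lborel (\<lambda>z. \<bar>f z - g z\<bar>)" using f g by auto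
      note t = lborel_translate[OF fg, of "v i"] lborel_translate(1)[OF g(1), of "v i"] lborel_translate(1)[OF f, of "v i"]
      have "(LBINT z. \<bar>f (z + v i) - f z\<bar>)
          \<le> (LBINT z. \<bar>f (z + v i) - g (z + v i)\<bar> + (\<bar>g (z + v i) - g z\<bar> + \<bar>f z - g z\<bar>))"
        using f g fg t by (intro integral_mono Bochner_Integration.integrable_add integrable_abs Bochner_Integration.integrable_diff) auto
      also have "\<dots> = (LBINT z. \<bar>f z - g z\<bar>) + ((LBINT z. \<bar>g (z + v i) - g z\<bar>) + (LBINT z. \<bar>f z - g z\<bar>))"
        using f g fg t by simp
      finally show ?thesis using N[OF that] g(3) by linarith
    qed
    then show "\<exists>N. \<forall>i\<ge>N. norm ((LBINT z. \<bar>f (z + v i) - f z\<bar>) - 0) < e"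
      by (intro exI[of _ N]) auto
  qed
qed

text \<open>For an open set the indicators of its translates converge to \<open>1\<close> at each of its points; as the
  translates have equal measure, convergence of the positive parts of the differences suffices.\<close>

lemma translation_continuous_open:
  fixes U :: "'c::euclidean_space set"
  assumes U: "open U" "emeasure lborel U < \<infinity>"
  shows "translation_continuous (indicator U)"
  unfolding translation_continuous_def
proof (intro allI impI)
  fix v :: "nat \<Rightarrow> 'c" assume v: "v \<longlonglongrightarrow> 0"
  have [measurable]: "U \<in> sets borel" using U by auto
  have i: "integrable lborel (indicator U :: 'c \<Rightarrow> real)" using U by (simp add: integrable_indicator_iff)
  have i': "integrable lborel (\<lambda>z. indicator U z * (1 - indicator U (z + w)) :: real)" for w
    by (rule Bochner_Integration.integrable_bound[OF i]) (auto simp: indicator_def)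
  have eq: "(LBINT z. \<bar>indicator U (z + v j) - indicator U z\<bar>)
      = 2 * (\<integral>z. indicator U z * (1 - indicator U (z + v j)) \<partial>lborel :: real)" for j
  proof -
    have "(LBINT z. \<bar>indicator U (z + v j) - indicator U z\<bar>) =
      (\<integral>z. (indicator U (z + v j) - indicator U z) + 2 * (indicator U z * (1 - indicator U (z + v j))) \<partial>lborel :: real)"
      by (intro Bochner_Integration.integral_cong) (auto simp: indicator_def)
    also have "\<dots> = 2 * (LBINT z. indicator U z * (1 - indicator U (z + v j)))"
      using i i'[of "v j"] lborel_translate[OF i, of "v j"] by simp
    finally show ?thesis .
  qed
  have "(\<lambda>j. \<integral>z. indicator U z * (1 - indicator U (z + v j)) \<partial>lborel :: real) \<longlonglongrightarrow> (\<integral>z. (0::real) \<partial>(lborel :: 'c measure))"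
  proof (rule integral_dominated_convergence[where w="indicator U"])
    show "AE z in lborel. (\<lambda>j. indicator U z * (1 - indicator U (z + v j)) :: real) \<longlonglongrightarrow> 0"
    proof (rule AE_I2)
      fix z
      show "(\<lambda>j. indicator U z * (1 - indicator U (z + v j)) :: real) \<longlonglongrightarrow> 0"
      proof (cases "z \<in> U")
        case True
        have "(\<lambda>j. z + v j) \<longlonglongrightarrow> z" using tendsto_add[OF tendsto_const v, of z] by simp
        then have "eventually (\<lambda>j. z + v j \<in> U) sequentially"
          using U(1) True by (rule topological_tendstoD)
        then have "eventually (\<lambda>j. indicator U z * (1 - indicator U (z + v j)) = (0::real)) sequentially"
          by (rule eventually_mono) simp
        then show ?thesis by (rule tendsto_eventually)
      qed simp
    qed
  qed (auto simp: i indicator_def)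
  then show "(\<lambda>j. \<integral>z. \<bar>indicator U (z + v j) - indicator U z\<bar> \<partial>lborel :: real) \<longlonglongrightarrow> 0"
    unfolding eq using tendsto_mult_left[of _ 0 sequentially 2] by simp
qed

lemma translation_continuous_scale:
  "translation_continuous f \<Longrightarrow> translation_continuous (\<lambda>z. f z * c)"
  unfolding translation_continuous_def
proof (intro allI impI)
  fix v :: "nat \<Rightarrow> 'a" assume *: "\<forall>v. v \<longlonglongrightarrow> 0 \<longrightarrow> (\<lambda>i. \<integral>z. \<bar>f (z + v i) - f z\<bar> \<partial>lborel) \<longlonglongrightarrow> 0" "v \<longlonglongrightarrow> 0"
  have "\<bar>f (z + v i) * c - f z * c\<bar> = \<bar>f (z + v i) - f z\<bar> * \<bar>c\<bar>" for z i
    by (simp add: abs_mult flip: left_diff_distrib)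
  then show "(\<lambda>i. \<integral>z. \<bar>f (z + v i) * c - f z * c\<bar> \<partial>lborel) \<longlonglongrightarrow> 0"
    using tendsto_mult_right[OF *(1)[rule_format, OF *(2)], of "\<bar>c\<bar>"] by simp
qed

text \<open>Sets of finite measure are approximated by open sets from outside, and integrable functions by
  simple ones.\<close>

proposition integrable_translation_continuous:
  fixes f :: "'c::euclidean_space \<Rightarrow> real"
  assumes "integrable lborel f"
  shows "translation_continuous f"
  using assms
proof (induction rule: integrable_induct)
  case (base A c)
  have A: "A \<in> sets borel" and Af: "emeasure lborel A < \<infinity>" using base by auto
  have "translation_continuous (indicator A)"
  proof (rule translation_continuous_approx)
    show "integrable lborel (indicator A :: 'c \<Rightarrow> real)" using A Af by (simp add: integrable_indicator_iff)
    fix e :: real assume e: "0 < e"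
    obtain U where U: "open U" "A \<subseteq> U" "emeasure lborel (U - A) < ennreal e"
      using outer_regular_lborel[OF A, of e] e by auto
    have "emeasure lborel U \<le> emeasure lborel A + emeasure lborel (U - A)"
      using U A emeasure_subadditive[of A lborel "U - A"] by (auto simp: Un_absorb1)
    also have "\<dots> < \<infinity>" using U(3) Af by (auto intro: order_less_trans)
    finally have Uf: "emeasure lborel U < \<infinity>" .
    have "(LBINT z. \<bar>indicator A z - indicator U z\<bar>) = (\<integral>z. indicator (U - A) z \<partial>lborel :: real)"
      using U by (intro Bochner_Integration.integral_cong) (auto simp: indicator_def)
    also have "\<dots> = measure lborel (U - A)" by simp
    also have "\<dots> < e" using U(3) e unfolding measure_def by (metis enn2real_less_iff ennreal_less_top less_trans top.not_eq_extremum order_le_less)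
    finally show "\<exists>g. integrable lborel g \<and> translation_continuous g \<and> (LBINT z. \<bar>indicator A z - g z\<bar>) < e"
      using U Uf translation_continuous_open[OF U(1) Uf]
      by (intro exI[of _ "indicator U"]) (auto simp: integrable_indicator_iff)
  qed
  then show ?case using translation_continuous_scale by simp
next
  case (add f g)
  show ?case unfolding translation_continuous_def
  proof (intro allI impI)
    fix v :: "nat \<Rightarrow> 'c" assume v: "v \<longlonglongrightarrow> 0"
    show "(\<lambda>i. \<integral>z. \<bar>f (z + v i) + g (z + v i) - (f z + g z)\<bar> \<partial>lborel) \<longlonglongrightarrow> 0"
    proof (rule tendsto_sandwich[OF _ _ tendsto_const])
      show "(\<lambda>i. (LBINT z. \<bar>f (z + v i) - f z\<bar>) + (LBINT z. \<bar>g (z + v i) - g z\<bar>)) \<longlonglongrightarrow> 0"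
        using add.IH v tendsto_add[of "\<lambda>i. \<integral>z. \<bar>f (z + v i) - f z\<bar> \<partial>lborel" 0 sequentially
          "\<lambda>i. \<integral>z. \<bar>g (z + v i) - g z\<bar> \<partial>lborel" 0] unfolding translation_continuous_def by simp
      have "(LBINT z. \<bar>f (z + v i) + g (z + v i) - (f z + g z)\<bar>)
          \<le> (LBINT z. \<bar>f (z + v i) - f z\<bar> + \<bar>g (z + v i) - g z\<bar>)" for i
        using add.hyps lborel_translate(1)[OF add.hyps(1), of "v i"] lborel_translate(1)[OF add.hyps(2), of "v i"]
        by (intro integral_mono Bochner_Integration.integrable_add integrable_abs Bochner_Integration.integrable_diff) auto
      also have "\<dots> i = (LBINT z. \<bar>f (z + v i) - f z\<bar>) + (LBINT z. \<bar>g (z + v i) - g z\<bar>)" for i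
        using add.hyps lborel_translate(1)[OF add.hyps(1), of "v i"] lborel_translate(1)[OF add.hyps(2), of "v i"] by simp
      finally show "\<forall>\<^sub>F i in sequentially. (LBINT z. \<bar>f (z + v i) + g (z + v i) - (f z + g z)\<bar>)
          \<le> (LBINT z. \<bar>f (z + v i) - f z\<bar>) + (LBINT z. \<bar>g (z + v i) - g z\<bar>)" by simp
    qed (auto intro!: always_eventually Bochner_Integration.integral_nonneg)
  qed
next
  case (lim f s)
  show ?case
  proof (rule translation_continuous_approx[OF lim.hyps(4)])
    fix e :: real assume e: "0 < e"
    have "(\<lambda>i. \<integral>z. \<bar>f z - s i z\<bar> \<partial>lborel) \<longlonglongrightarrow> (\<integral>z. (0::real) \<partial>(lborel :: 'c measure))"
    proof (rule integral_dominated_convergence[where w="\<lambda>z. 3 * \<bar>f z\<bar>"])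
      show "AE z in lborel. (\<lambda>i. \<bar>f z - s i z\<bar>) \<longlonglongrightarrow> 0"
      proof (rule AE_I2)
        fix z
        have "(\<lambda>i. \<bar>f z - s i z\<bar>) \<longlonglongrightarrow> \<bar>f z - f z\<bar>"
          using lim.hyps(2)[of z] by (intro tendsto_intros) simp
        then show "(\<lambda>i. \<bar>f z - s i z\<bar>) \<longlonglongrightarrow> 0" by simp
      qed
      show "AE z in lborel. norm \<bar>f z - s i z\<bar> \<le> 3 * \<bar>f z\<bar>" for i
        using lim.hyps(3)[of _ i] by (intro AE_I2) (smt (verit, best) real_norm_def space_lborel UNIV_I)
    qed (use lim.hyps(1,4) in \<open>auto dest: borel_measurable_integrable\<close>)
    then have "(\<lambda>i. \<integral>z. \<bar>f z - s i z\<bar> \<partial>lborel) \<longlonglongrightarrow> 0" by simp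
    from LIMSEQ_D[OF this e] obtain i where "(LBINT z. \<bar>f z - s i z\<bar>) < e" by fastforce
    then show "\<exists>g. integrable lborel g \<and> translation_continuous g \<and> (LBINT z. \<bar>f z - g z\<bar>) < e"
      using lim.hyps(1) lim.IH by blast
  qed
qed

text \<open>For nonnegative \<open>x\<close>, \<open>y\<close> one has \<open>(x - y)\<^sup>2 \<le> \<bar>x\<^sup>2 - y\<^sup>2\<bar>\<close>; applied to positive and negative
  parts this reduces the claim to the translation of integrable functions.\<close>

lemma L2_translation_continuous:
  fixes f :: "'c::euclidean_space \<Rightarrow> real"
  assumes f [measurable]: "f \<in> borel_measurable borel" and f2: "integrable lborel (\<lambda>z. (f z)\<^sup>2)" and v: "v \<longlonglongrightarrow> 0"
  shows "(\<lambda>i::nat. \<integral>z. (f (z + v i) - f z)\<^sup>2 \<partial>lborel) \<longlonglongrightarrow> 0"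
proof (rule tendsto_sandwich[OF _ _ tendsto_const])
  define p where "p z = max 0 (f z)" for z
  define m where "m z = max 0 (- f z)" for z
  have [measurable]: "p \<in> borel_measurable borel" "m \<in> borel_measurable borel"
    unfolding p_def m_def by measurable
  have p2: "integrable lborel (\<lambda>z. (p z)\<^sup>2)" and m2: "integrable lborel (\<lambda>z. (m z)\<^sup>2)"
    by (rule Bochner_Integration.integrable_bound[OF f2]; auto simp: p_def m_def max_def)+
  have pf: "\<bar>f z\<bar> = p z + m z" "f z = p z - m z" "0 \<le> p z" "0 \<le> m z" for z by (auto simp: p_def m_def)
  have sq: "(a - b)\<^sup>2 \<le> \<bar>a\<^sup>2 - b\<^sup>2\<bar>" if "0 \<le> a" "0 \<le> b" for a b :: real
  proof -
    have "\<bar>a - b\<bar> * \<bar>a - b\<bar> \<le> \<bar>a - b\<bar> * \<bar>a + b\<bar>" using that by (intro mult_left_mono) auto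
    also have "\<dots> = \<bar>a\<^sup>2 - b\<^sup>2\<bar>" by (simp add: power2_eq_square square_diff_square_factored abs_mult mult.commute)
    finally show ?thesis by (simp add: power2_eq_square)
  qed
  have bound: "(f (z + w) - f z)\<^sup>2 \<le> 2 * \<bar>(p (z + w))\<^sup>2 - (p z)\<^sup>2\<bar> + 2 * \<bar>(m (z + w))\<^sup>2 - (m z)\<^sup>2\<bar>" for z w
  proof -
    have "(f (z + w) - f z)\<^sup>2 = ((p (z + w) - p z) - (m (z + w) - m z))\<^sup>2" by (simp add: pf(2) algebra_simps)
    also have "\<dots> \<le> 2 * (p (z + w) - p z)\<^sup>2 + 2 * (m (z + w) - m z)\<^sup>2"
      using zero_le_power2[of "(p (z + w) - p z) + (m (z + w) - m z)"] by (simp add: power2_eq_square algebra_simps)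
    also have "\<dots> \<le> 2 * \<bar>(p (z + w))\<^sup>2 - (p z)\<^sup>2\<bar> + 2 * \<bar>(m (z + w))\<^sup>2 - (m z)\<^sup>2\<bar>"
      using sq[OF pf(3,3), of "z + w" z] sq[OF pf(4,4), of "z + w" z] by (intro add_mono mult_left_mono) auto
    finally show ?thesis .
  qed
  let ?r = "\<lambda>i. 2 * (LBINT z. \<bar>(p (z + v i))\<^sup>2 - (p z)\<^sup>2\<bar>) + 2 * (LBINT z. \<bar>(m (z + v i))\<^sup>2 - (m z)\<^sup>2\<bar>)"
  have "?r \<longlonglongrightarrow> 2 * 0 + 2 * 0"
    using integrable_translation_continuous[OF p2] integrable_translation_continuous[OF m2] v
    unfolding translation_continuous_def by (intro tendsto_intros) auto
  then show "?r \<longlonglongrightarrow> 0" by simp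
  have i: "integrable lborel (\<lambda>z. 2 * \<bar>(p (z + w))\<^sup>2 - (p z)\<^sup>2\<bar> + 2 * \<bar>(m (z + w))\<^sup>2 - (m z)\<^sup>2\<bar>)"
      "integrable lborel (\<lambda>z. \<bar>(p (z + w))\<^sup>2 - (p z)\<^sup>2\<bar>)" "integrable lborel (\<lambda>z. \<bar>(m (z + w))\<^sup>2 - (m z)\<^sup>2\<bar>)" for w
    using p2 m2 lborel_translate(1)[OF p2, of w] lborel_translate(1)[OF m2, of w] by auto
  have "(LBINT z. (f (z + w) - f z)\<^sup>2) \<le>
      2 * (LBINT z. \<bar>(p (z + w))\<^sup>2 - (p z)\<^sup>2\<bar>) + 2 * (LBINT z. \<bar>(m (z + w))\<^sup>2 - (m z)\<^sup>2\<bar>)" for w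
  proof -
    have "(LBINT z. (f (z + w) - f z)\<^sup>2) \<le> (LBINT z. 2 * \<bar>(p (z + w))\<^sup>2 - (p z)\<^sup>2\<bar> + 2 * \<bar>(m (z + w))\<^sup>2 - (m z)\<^sup>2\<bar>)"
    proof (rule integral_mono[OF _ i(1) bound])
      show "integrable lborel (\<lambda>z. (f (z + w) - f z)\<^sup>2)"
        by (rule Bochner_Integration.integrable_bound[OF i(1)[of w]]) (use bound[of _ w] in auto)
    qed
    then show ?thesis using i[of w] by simp
  qed
  then show "\<forall>\<^sub>F i in sequentially. (LBINT z. (f (z + v i) - f z)\<^sup>2) \<le> ?r i" by simp
qed (auto intro!: always_eventually Bochner_Integration.integral_nonneg)

text \<open>Jensen's inequality for the exponents \<open>1\<close> and \<open>2\<close>.  If the integral on the left diverges, its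
  value is \<open>0\<close> and the inequality is trivial.\<close>

lemma jensen_nn:
  fixes \<rho> y :: "'n \<Rightarrow> real"
  assumes [measurable]: "\<rho> \<in> borel_measurable M" "y \<in> borel_measurable M" and \<rho>: "\<And>a. 0 \<le> \<rho> a" "(\<integral>\<^sup>+a. \<rho> a \<partial>M) = 1"
    and q: "q = 1 \<or> q = (2::nat)"
  shows "ennreal (\<bar>\<integral>a. \<rho> a * y a \<partial>M\<bar> ^ q) \<le> (\<integral>\<^sup>+a. ennreal (\<rho> a * \<bar>y a\<bar> ^ q) \<partial>M)"
proof -
  have 1: "ennreal \<bar>\<integral>a. \<rho> a * y a \<partial>M\<bar> \<le> (\<integral>\<^sup>+a. ennreal (\<rho> a * \<bar>y a\<bar>) \<partial>M)"
  proof (cases "integrable M (\<lambda>a. \<rho> a * y a)")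
    case True
    then show ?thesis using integral_norm_bound_ennreal[OF True] \<rho> by (simp add: abs_mult)
  qed (simp add: not_integrable_integral_eq)
  show ?thesis
  proof (cases "q = 1")
    case False
    then have q: "q = 2" using q by simp
    have "ennreal (\<bar>\<integral>a. \<rho> a * y a \<partial>M\<bar> ^ 2) = (ennreal \<bar>\<integral>a. \<rho> a * y a \<partial>M\<bar>)\<^sup>2"
      by (simp add: ennreal_power)
    also have "\<dots> \<le> (\<integral>\<^sup>+a. ennreal (\<rho> a * \<bar>y a\<bar>) \<partial>M)\<^sup>2" using 1 by (rule power_mono) simp
    also have "\<dots> = (\<integral>\<^sup>+a. ennreal (sqrt (\<rho> a)) * ennreal (sqrt (\<rho> a) * \<bar>y a\<bar>) \<partial>M)\<^sup>2"
      using \<rho> by (simp add: ennreal_mult'[symmetric] mult.assoc[symmetric])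
    also have "\<dots> \<le> (\<integral>\<^sup>+a. (ennreal (sqrt (\<rho> a)))\<^sup>2 \<partial>M) * (\<integral>\<^sup>+a. (ennreal (sqrt (\<rho> a) * \<bar>y a\<bar>))\<^sup>2 \<partial>M)"
      by (rule Cauchy_Schwarz_nn_integral) measurable
    also have "(\<integral>\<^sup>+a. (ennreal (sqrt (\<rho> a)))\<^sup>2 \<partial>M) = 1"
      using \<rho> by (simp add: ennreal_power)
    also have "(\<integral>\<^sup>+a. (ennreal (sqrt (\<rho> a) * \<bar>y a\<bar>))\<^sup>2 \<partial>M) = (\<integral>\<^sup>+a. ennreal (\<rho> a * \<bar>y a\<bar> ^ 2) \<partial>M)"
      using \<rho> by (simp add: ennreal_power power_mult_distrib)
    finally show ?thesis using q by simp
  qed (use 1 in simp)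
qed

lemma abs_diff_power_le:
  fixes a b :: real
  assumes "q = 1 \<or> q = (2::nat)"
  shows "\<bar>a - b\<bar> ^ q \<le> 2 * \<bar>a\<bar> ^ q + 2 * \<bar>b\<bar> ^ q"
  using assms
proof
  assume "q = 1" then show ?thesis by simp
next
  assume q: "q = 2"
  have "(a - b)\<^sup>2 + (a + b)\<^sup>2 = 2 * a\<^sup>2 + 2 * b\<^sup>2" by (simp add: power2_eq_square algebra_simps)
  moreover have "0 \<le> (a + b)\<^sup>2" by simp
  ultimately have "(a - b)\<^sup>2 \<le> 2 * a\<^sup>2 + 2 * b\<^sup>2" by linarith
  then show ?thesis unfolding q by simp
qed

text \<open>By Jensen's inequality the error is at most a \<open>\<rho>\<close>-average of the errors made by translations,
  which tend to \<open>0\<close> boundedly.  The exponent \<open>q = 1\<close> serves functions of time, \<open>q = 2\<close> functions of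
  time and space, translated in the direction \<open>v = (1, 0)\<close>.\<close>

proposition mollification_converges:
  fixes f :: "'c::euclidean_space \<Rightarrow> real" and \<rho> :: "real \<Rightarrow> real"
  assumes [measurable]: "\<rho> \<in> borel_measurable borel" "f \<in> borel_measurable borel"
    and \<rho>: "\<And>a. 0 \<le> \<rho> a" "integrable lborel \<rho>" "(LBINT a. \<rho> a) = 1"
    and q: "q = 1 \<or> q = (2::nat)" and f: "integrable lborel (\<lambda>z. \<bar>f z\<bar> ^ q)" and \<epsilon>: "\<epsilon> \<longlonglongrightarrow> 0"
  shows "(\<lambda>i::nat. \<integral>\<^sup>+z. ennreal (\<bar>\<integral>a. \<rho> a * (f (z - (\<epsilon> i * a) *\<^sub>R v) - f z) \<partial>lborel\<bar> ^ q) \<partial>lborel) \<longlonglongrightarrow> 0"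
proof -
  have \<rho>1: "(\<integral>\<^sup>+a. ennreal (\<rho> a) \<partial>lborel) = 1"
    using nn_integral_eq_integral[OF \<rho>(2)] \<rho>(1,3) by simp
  define D where "D w = (\<integral>\<^sup>+z. ennreal (\<bar>f (z - w) - f z\<bar> ^ q) \<partial>lborel)" for w
  have "(\<lambda>w. \<integral>\<^sup>+z. ennreal (\<bar>f (z - w) - f z\<bar> ^ q) \<partial>lborel) \<in> borel_measurable borel"
    by measurable
  then have [measurable]: "D \<in> borel_measurable borel" unfolding D_def[abs_def] .
  have trans: "integrable lborel (\<lambda>z. \<bar>f (z - w)\<bar> ^ q)" "(LBINT z. \<bar>f (z - w)\<bar> ^ q) = (LBINT z. \<bar>f z\<bar> ^ q)" for w
    using lborel_translate[OF f, of "- w"] by simp_all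
  have pw: "\<bar>a - b\<bar> ^ q \<le> 2 * \<bar>a\<bar> ^ q + 2 * \<bar>b\<bar> ^ q" for a b :: real
    using abs_diff_power_le q by blast
  have int: "integrable lborel (\<lambda>z. \<bar>f (z - w) - f z\<bar> ^ q)" for w
  proof (rule Bochner_Integration.integrable_bound)
    show "integrable lborel (\<lambda>z. 2 * \<bar>f (z - w)\<bar> ^ q + 2 * \<bar>f z\<bar> ^ q)"
      by (intro Bochner_Integration.integrable_add integrable_mult_right trans(1) f)
    show "(\<lambda>z. \<bar>f (z - w) - f z\<bar> ^ q) \<in> borel_measurable lborel"
      by measurable
    show "AE z in lborel. norm (\<bar>f (z - w) - f z\<bar> ^ q) \<le> norm (2 * \<bar>f (z - w)\<bar> ^ q + 2 * \<bar>f z\<bar> ^ q)"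
    proof (rule AE_I2)
      fix z
      have "norm (\<bar>f (z - w) - f z\<bar> ^ q) = \<bar>f (z - w) - f z\<bar> ^ q" by simp
      also have "\<dots> \<le> 2 * \<bar>f (z - w)\<bar> ^ q + 2 * \<bar>f z\<bar> ^ q" by (rule pw)
      also have "\<dots> \<le> norm (2 * \<bar>f (z - w)\<bar> ^ q + 2 * \<bar>f z\<bar> ^ q)"
        unfolding real_norm_def by (rule abs_ge_self)
      finally show "norm (\<bar>f (z - w) - f z\<bar> ^ q) \<le> norm (2 * \<bar>f (z - w)\<bar> ^ q + 2 * \<bar>f z\<bar> ^ q)" .
    qed
  qed
  have D_eq: "D w = ennreal (LBINT z. \<bar>f (z - w) - f z\<bar> ^ q)" for w
    unfolding D_def by (rule nn_integral_eq_integral[OF int]) simp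
  have D_le: "D w \<le> ennreal (4 * (LBINT z. \<bar>f z\<bar> ^ q))" for w
  proof -
    have "(LBINT z. \<bar>f (z - w) - f z\<bar> ^ q) \<le> (LBINT z. 2 * \<bar>f (z - w)\<bar> ^ q + 2 * \<bar>f z\<bar> ^ q)"
      using trans f pw by (intro integral_mono int) auto
    then show ?thesis unfolding D_eq using trans f by (intro ennreal_leI) simp
  qed
  have D_lim: "(\<lambda>i. D (w i)) \<longlonglongrightarrow> 0" if w: "w \<longlonglongrightarrow> 0" for w :: "nat \<Rightarrow> 'c"
  proof -
    have w': "(\<lambda>i. - w i) \<longlonglongrightarrow> 0" using tendsto_minus[OF w] by simp
    have "(\<lambda>i. \<integral>z. \<bar>f (z - w i) - f z\<bar> ^ q \<partial>lborel) \<longlonglongrightarrow> 0"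
    proof (cases "q = 1")
      case True
      then have "integrable lborel (\<lambda>z. \<bar>f z\<bar>)" using f by simp
      then have "integrable lborel f" by (rule integrable_abs_cancel) simp
      from integrable_translation_continuous[OF this, unfolded translation_continuous_def, rule_format, OF w']
      show ?thesis using True by simp
    next
      case False
      then have q2: "q = 2" using q by simp
      have "integrable lborel (\<lambda>z. (f z)\<^sup>2)" using f q2 by simp
      from L2_translation_continuous[OF _ this w'] show ?thesis using q2 by simp
    qed
    from tendsto_ennrealI[OF this] show ?thesis by (simp add: D_eq)
  qed
  have upper: "(\<integral>\<^sup>+z. ennreal (\<bar>\<integral>a. \<rho> a * (f (z - (\<epsilon> i * a) *\<^sub>R v) - f z) \<partial>lborel\<bar> ^ q) \<partial>lborel)
      \<le> (\<integral>\<^sup>+a. ennreal (\<rho> a) * D ((\<epsilon> i * a) *\<^sub>R v) \<partial>lborel)" for i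
  proof -
    have "(\<integral>\<^sup>+z. ennreal (\<bar>\<integral>a. \<rho> a * (f (z - (\<epsilon> i * a) *\<^sub>R v) - f z) \<partial>lborel\<bar> ^ q) \<partial>lborel)
      \<le> (\<integral>\<^sup>+z. (\<integral>\<^sup>+a. ennreal (\<rho> a * \<bar>f (z - (\<epsilon> i * a) *\<^sub>R v) - f z\<bar> ^ q) \<partial>lborel) \<partial>lborel)"
      using \<rho> \<rho>1 by (intro nn_integral_mono jensen_nn q) auto
    also have "\<dots> = (\<integral>\<^sup>+a. (\<integral>\<^sup>+z. ennreal (\<rho> a * \<bar>f (z - (\<epsilon> i * a) *\<^sub>R v) - f z\<bar> ^ q) \<partial>lborel) \<partial>lborel)"
      by (rule lborel_pair.Fubini') measurable
    also have "\<dots> = (\<integral>\<^sup>+a. ennreal (\<rho> a) * D ((\<epsilon> i * a) *\<^sub>R v) \<partial>lborel)"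
      using \<rho> by (simp add: ennreal_mult' D_def nn_integral_cmult)
    finally show ?thesis .
  qed
  have "(\<lambda>i. \<integral>\<^sup>+a. ennreal (\<rho> a) * D ((\<epsilon> i * a) *\<^sub>R v) \<partial>lborel) \<longlonglongrightarrow> (\<integral>\<^sup>+a. 0 \<partial>(lborel :: real measure))"
  proof (rule nn_integral_dominated_convergence[where w="\<lambda>a. ennreal (\<rho> a) * ennreal (4 * (LBINT z. \<bar>f z\<bar> ^ q))"])
    show "(\<integral>\<^sup>+a. ennreal (\<rho> a) * ennreal (4 * (LBINT z. \<bar>f z\<bar> ^ q)) \<partial>lborel) < \<infinity>"
      by (simp add: nn_integral_multc \<rho>1)
    show "AE a in lborel. (\<lambda>i. ennreal (\<rho> a) * D ((\<epsilon> i * a) *\<^sub>R v)) \<longlonglongrightarrow> 0"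
    proof (rule AE_I2)
      fix a
      have "(\<lambda>i. (\<epsilon> i * a) *\<^sub>R v) \<longlonglongrightarrow> (0 * a) *\<^sub>R v" by (intro tendsto_intros \<epsilon>)
      then have "(\<lambda>i. ennreal (\<rho> a) * D ((\<epsilon> i * a) *\<^sub>R v)) \<longlonglongrightarrow> ennreal (\<rho> a) * 0"
        by (intro ennreal_tendsto_cmult D_lim) auto
      then show "(\<lambda>i. ennreal (\<rho> a) * D ((\<epsilon> i * a) *\<^sub>R v)) \<longlonglongrightarrow> 0" by simp
    qed
    show "AE a in lborel. ennreal (\<rho> a) * D ((\<epsilon> i * a) *\<^sub>R v) \<le> ennreal (\<rho> a) * ennreal (4 * (LBINT z. \<bar>f z\<bar> ^ q))" for i
      by (intro AE_I2 mult_left_mono D_le) simp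
  qed measurable
  then have lim: "(\<lambda>i. \<integral>\<^sup>+a. ennreal (\<rho> a) * D ((\<epsilon> i * a) *\<^sub>R v) \<partial>lborel) \<longlonglongrightarrow> 0" by simp
  show ?thesis
    by (rule tendsto_sandwich[OF _ _ tendsto_const lim]) (auto intro!: always_eventually upper)
qed


section \<open>Borel representatives\<close>

lemma AE_lebesgue_on_iff:
  assumes "S \<in> sets borel"
  shows "(AE z in lebesgue_on S. P z) \<longleftrightarrow> (AE z in lborel. z \<in> S \<longrightarrow> P z)"
  using assms by (simp add: AE_restrict_space_iff AE_completion_iff)

lemma lebesgue_integral_eq_lborel:
  fixes f g :: "'c::euclidean_space \<Rightarrow> 'b::euclidean_space"
  assumes [measurable]: "g \<in> borel_measurable borel" and ae: "AE z in lborel. f z = g z"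
  shows "(\<integral>z. f z \<partial>lebesgue) = (LBINT z. g z)"
    and "integrable lebesgue f \<longleftrightarrow> integrable lborel g"
proof -
  have ae': "AE z in lebesgue. g z = f z" using AE_completion[OF ae] by eventually_elim simp
  have g: "g \<in> borel_measurable lebesgue" by (simp add: measurable_completion)
  have f: "f \<in> borel_measurable lebesgue" by (rule borel_measurable_AE[OF g ae'])
  show "(\<integral>z. f z \<partial>lebesgue) = (LBINT z. g z)"
    using integral_cong_AE[OF g f ae'] integral_completion[of g lborel] by simp
  show "integrable lebesgue f \<longleftrightarrow> integrable lborel g"
    using integrable_cong_AE[OF g f ae'] integrable_completion[of g lborel] by simp
qed

lemma lebesgue_on_integral_eq_lborel:
  fixes f g :: "'c::euclidean_space \<Rightarrow> 'b::euclidean_space"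
  assumes g: "g \<in> borel_measurable borel" and S: "S \<in> sets borel"
    and ae: "AE z in lborel. z \<in> S \<longrightarrow> f z = g z" and 0: "\<And>z. z \<notin> S \<Longrightarrow> g z = 0"
  shows "(\<integral>z. f z \<partial>lebesgue_on S) = (LBINT z. g z)"
    and "integrable (lebesgue_on S) f \<longleftrightarrow> integrable lborel g"
proof -
  have ae: "AE z in lborel. indicator S z *\<^sub>R f z = g z"
    using ae by eventually_elim (auto simp: indicator_def 0)
  note * = lebesgue_integral_eq_lborel[OF g ae]
  show "(\<integral>z. f z \<partial>lebesgue_on S) = (LBINT z. g z)"
    using S *(1) by (simp add: integral_restrict_space)
  show "integrable (lebesgue_on S) f \<longleftrightarrow> integrable lborel g"
    using S *(2) by (simp add: integrable_restrict_space)
qed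

lemma borel_representative:
  fixes f :: "'c::euclidean_space \<Rightarrow> 'b::euclidean_space"
  assumes f: "f \<in> borel_measurable (lebesgue_on S)" and S: "S \<in> sets borel"
  obtains g where "g \<in> borel_measurable borel" "AE z in lborel. z \<in> S \<longrightarrow> f z = g z" "\<And>z. z \<notin> S \<Longrightarrow> g z = 0"
proof -
  have ex: "\<exists>g\<in>borel_measurable lborel. AE z in lborel. indicator S z * (f z \<bullet> i) = g z" for i
  proof (rule completion_ex_borel_measurable_real)
    have "(\<lambda>z. f z \<bullet> i) \<in> borel_measurable (lebesgue_on S)" using f by simp
    then show "(\<lambda>z. indicator S z * (f z \<bullet> i)) \<in> borel_measurable lebesgue"
      using S by (simp add: borel_measurable_restrict_space_iff mult.commute)
  qed
  have "\<forall>i\<in>UNIV. \<exists>g. g \<in> borel_measurable borel \<and> (AE z in lborel. indicator S z * (f z \<bullet> i) = g z)"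
  proof
    fix i
    obtain g where "g \<in> borel_measurable lborel" "AE z in lborel. indicator S z * (f z \<bullet> i) = g z"
      using ex[of i] by blast
    then show "\<exists>g. g \<in> borel_measurable borel \<and> (AE z in lborel. indicator S z * (f z \<bullet> i) = g z)"
      by (intro exI[of _ g] conjI) simp_all
  qed
  from bchoice[OF this] obtain G where G: "\<And>i. G i \<in> borel_measurable borel" "\<And>i. AE z in lborel. indicator S z * (f z \<bullet> i) = G i z"
    by blast
  note [measurable] = G(1) S
  have "AE z in lborel. \<forall>i\<in>Basis. indicator S z * (f z \<bullet> i) = G i z"
    using G(2) by (intro AE_finite_allI) auto
  then have "AE z in lborel. z \<in> S \<longrightarrow> f z = indicator S z *\<^sub>R (\<Sum>i\<in>Basis. G i z *\<^sub>R i)"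
  proof eventually_elim
    case (elim z)
    have "(\<Sum>i\<in>Basis. G i z *\<^sub>R i) = (\<Sum>i\<in>Basis. (f z \<bullet> i) *\<^sub>R i)" if "z \<in> S"
      using elim that by (intro sum.cong) force+
    then show ?case by (simp add: euclidean_representation)
  qed
  then show thesis
    by (intro that[of "\<lambda>z. indicator S z *\<^sub>R (\<Sum>i\<in>Basis. G i z *\<^sub>R i)"]) auto
qed

text \<open>Before time \<open>S\<close> the convolution on \<open>{0..t}\<close> is the convolution on the line of Borel representatives
  that vanish on the negative half-line.  The two integrands agree almost everywhere, for every single
  \<open>t\<close>.\<close>

lemma conv_eq_lconv:
  fixes v v' :: "real \<Rightarrow> 'b::euclidean_space"
  assumes k: "AE s in lborel. 0 < s \<and> s < S \<longrightarrow> k s = k' s" and v: "AE s in lborel. 0 < s \<and> s < S \<longrightarrow> v s = v' s"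
    and 0: "\<And>s. s \<le> 0 \<Longrightarrow> k' s = 0" "\<And>s. s \<le> 0 \<Longrightarrow> v' s = 0" and t: "t \<le> S"
    and [measurable]: "k' \<in> borel_measurable borel" "v' \<in> borel_measurable borel"
  shows "conv k v t = lconv k' v' t"
  unfolding conv_def lconv_def set_lebesgue_integral_def
proof (rule lebesgue_integral_eq_lborel(1))
  show "AE s in lborel. indicator {0..t} s *\<^sub>R k (t - s) *\<^sub>R v s = k' (t - s) *\<^sub>R v' s"
    using AE_lborel_reflect[OF k, of t] v AE_lborel_singleton[of 0] AE_lborel_singleton[of t]
  proof eventually_elim
    case (elim s)
    then show ?case using t 0(1)[of "t - s"] 0(2)[of s] by (cases "0 < s \<and> s < t") (auto simp: indicator_def)
  qed
qed measurable

text \<open>Local integrability on the half-line is turned into a single Borel function, integrable on each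
  bounded interval.\<close>

lemma L1_loc_representative:
  assumes k: "k \<in> L1_loc"
  obtains k' where "k' \<in> borel_measurable borel" "AE t in lborel. 0 < t \<longrightarrow> k t = k' t" "\<And>t. t \<le> 0 \<Longrightarrow> k' t = 0"
    "\<And>S. integrable lborel (\<lambda>t. indicator {0<..<S} t * k' t)"
proof -
  have k_int: "integrable lebesgue (\<lambda>t. indicator {0..S} t * k t)" if "S > 0" for S
    using k that by (simp add: L1_loc_def set_integrable_def)
  have m: "(\<lambda>t. indicator {0..} t * k t) \<in> borel_measurable lebesgue"
  proof (rule borel_measurable_LIMSEQ_real)
    fix t :: real
    have "\<forall>\<^sub>F n in sequentially. indicator {0..real (Suc n)} t * k t = indicator {0..} t * k t"
      using eventually_ge_at_top[of "nat \<lceil>t\<rceil>"]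
    proof eventually_elim
      case (elim n)
      then have "t \<le> real (Suc n)" by linarith
      then show ?case by (auto simp: indicator_def)
    qed
    then show "(\<lambda>n. indicator {0..real (Suc n)} t * k t) \<longlonglongrightarrow> indicator {0..} t * k t"
      by (rule tendsto_eventually)
  next
    show "(\<lambda>t. indicator {0..real (Suc n)} t * k t) \<in> borel_measurable lebesgue" for n
      using borel_measurable_integrable[OF k_int[of "real (Suc n)"]] by simp
  qed
  obtain g where g: "g \<in> borel_measurable lborel" "AE t in lborel. indicator {0..} t * k t = g t"
    using completion_ex_borel_measurable_real[OF m] by blast
  define k' where "k' t = indicator {0<..} t * g t" for t
  have k'm: "k' \<in> borel_measurable borel" using g(1) unfolding k'_def by measurable
  have ae: "AE t in lborel. 0 < t \<longrightarrow> k t = k' t"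
    using g(2) by eventually_elim (auto simp: k'_def indicator_def)
  have int: "integrable lborel (\<lambda>t. indicator {0<..<S} t * k' t)" for S
  proof (cases "0 < S")
    case True
    have ae': "AE t in lborel. indicator {0..S} t * k t = indicator {0..S} t * k' t"
      using ae AE_lborel_singleton[of 0] by eventually_elim (auto simp: indicator_def)
    have "integrable lborel (\<lambda>t. indicator {0..S} t * k' t)"
      using lebesgue_integral_eq_lborel(2)[OF _ ae'] k'm k_int[OF True] by simp
    then have "integrable lborel (\<lambda>t. indicator {0<..<S} t * (indicator {0..S} t * k' t))" by (rule integrable_indicator_times) simp
    moreover have "indicator {0<..<S} t * (indicator {0..S} t * k' t) = indicator {0<..<S} t * k' t" for t
      by (auto simp: indicator_def)
    ultimately show ?thesis by simp
  qed simp
  show thesis using that[OF k'm ae _ int] by (simp add: k'_def)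
qed

lemma L1_locI:
  assumes "h \<in> borel_measurable borel" "\<And>S. integrable lborel (\<lambda>t. indicator {0<..<S} t * h t)"
  shows "h \<in> L1_loc"
proof -
  have "set_integrable lebesgue {0..S} h" for S
  proof -
    have "AE t in lborel. indicator {0..S} t *\<^sub>R h t = indicator {0<..<S} t * h t"
      using AE_lborel_singleton[of 0] AE_lborel_singleton[of S]
      by eventually_elim (auto simp: indicator_def)
    from lebesgue_integral_eq_lborel(2)[OF _ this] show ?thesis
      using assms unfolding set_integrable_def by simp
  qed
  then show ?thesis by (simp add: L1_loc_def)
qed


section \<open>The resolvent kernel\<close>

text \<open>The convolution powers of \<open>\<bar>l\<bar>\<close>, with values in \<open>[0, \<infinity>]\<close>: they majorise the signed powers and
  control the convergence of their alternating series.\<close>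

fun conv_power_nn :: "(real \<Rightarrow> real) \<Rightarrow> nat \<Rightarrow> real \<Rightarrow> ennreal" where
  "conv_power_nn l 0 t = ennreal \<bar>l t\<bar>"
| "conv_power_nn l (Suc j) t = (\<integral>\<^sup>+s. ennreal \<bar>l (t - s)\<bar> * conv_power_nn l j s \<partial>lborel)"

fun conv_power :: "(real \<Rightarrow> real) \<Rightarrow> nat \<Rightarrow> real \<Rightarrow> real" where
  "conv_power l 0 t = l t"
| "conv_power l (Suc j) t = lconv l (conv_power l j) t"

context
  fixes l :: "real \<Rightarrow> real"
  assumes l_meas [measurable]: "l \<in> borel_measurable borel"
    and l_zero: "\<And>t. t \<le> 0 \<Longrightarrow> l t = 0"
    and l_int: "\<And>S. integrable lborel (\<lambda>t. indicator {0<..<S} t * l t)"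
begin

lemma conv_power_nn_measurable [measurable]: "conv_power_nn l j \<in> borel_measurable borel"
proof (induction j)
  case (Suc j)
  note [measurable] = Suc
  have "(\<lambda>t. \<integral>\<^sup>+s. ennreal \<bar>l (t - s)\<bar> * conv_power_nn l j s \<partial>lborel) \<in> borel_measurable borel"
    by measurable
  then show ?case by simp
qed simp

lemma conv_power_measurable [measurable]: "conv_power l j \<in> borel_measurable borel"
proof (induction j)
  case (Suc j)
  then have "lconv l (conv_power l j) \<in> borel_measurable borel" by measurable
  then show ?case by simp
qed simp

lemma conv_power_nn_zero: "t \<le> 0 \<Longrightarrow> conv_power_nn l j t = 0"
proof (induction j arbitrary: t)
  case (Suc j)
  have "ennreal \<bar>l (t - s)\<bar> * conv_power_nn l j s = 0" for s
    using Suc l_zero[of "t - s"] by (cases "s \<le> 0") auto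
  then have "(\<lambda>s. ennreal \<bar>l (t - s)\<bar> * conv_power_nn l j s) = (\<lambda>s. 0)" by (rule ext)
  then show ?case unfolding conv_power_nn.simps by (simp only:) simp
qed (simp add: l_zero)

lemma conv_power_le: "ennreal \<bar>conv_power l j t\<bar> \<le> conv_power_nn l j t"
proof (induction j arbitrary: t)
  case (Suc j)
  show ?case
  proof (cases "integrable lborel (\<lambda>s. l (t - s) * conv_power l j s)")
    case True
    have "ennreal \<bar>conv_power l (Suc j) t\<bar> \<le> (\<integral>\<^sup>+s. ennreal \<bar>l (t - s) * conv_power l j s\<bar> \<partial>lborel)"
      using integral_norm_bound_ennreal[OF True] by (simp add: lconv_def)
    also have "\<dots> \<le> conv_power_nn l (Suc j) t"
      using Suc by (auto simp: abs_mult ennreal_mult intro!: nn_integral_mono mult_left_mono)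
    finally show ?thesis .
  qed (simp add: lconv_def not_integrable_integral_eq)
qed simp

text \<open>The weight \<open>exp (- c t)\<close> is multiplicative, so the weighted norm of a convolution power is at most
  the power of the weighted norm of \<open>l\<close>, and the latter is small for large \<open>c\<close> (\<open>small_weight\<close>).\<close>

lemma conv_power_weighted:
  "(\<integral>\<^sup>+t. ennreal (indicator {..<S} t * exp (- c * t)) * conv_power_nn l j t \<partial>lborel)
    \<le> (\<integral>\<^sup>+t. ennreal (indicator {..<S} t * exp (- c * t) * \<bar>l t\<bar>) \<partial>lborel) ^ Suc j"
proof (induction j)
  case 0
  show ?case by (simp add: ennreal_mult)
next
  case (Suc j)
  define e where "e t = indicator {..<S} t * exp (- c * t)" for t
  define K where "K = (\<integral>\<^sup>+t. ennreal (e t * \<bar>l t\<bar>) \<partial>lborel)"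
  have [measurable]: "e \<in> borel_measurable borel" unfolding e_def by measurable
  have e0: "0 \<le> e t" for t by (simp add: e_def)
  \<comment> \<open>For \<open>s\<close> and \<open>t - s\<close> positive, \<open>t < S\<close> bounds both of them by \<open>S\<close>, so the cut-off splits like the exponential.\<close>
  have split: "ennreal (e t) * (ennreal \<bar>l (t - s)\<bar> * conv_power_nn l j s)
      \<le> ennreal (e (t - s) * \<bar>l (t - s)\<bar>) * (ennreal (e s) * conv_power_nn l j s)" for t s
  proof (cases "s \<le> 0 \<or> t - s \<le> 0 \<or> S \<le> t")
    case True
    then show ?thesis using l_zero[of "t - s"] conv_power_nn_zero[of s j] by (auto simp: e_def)
  next
    case False
    then have "e t = e (t - s) * e s"
      by (auto simp: e_def exp_add[symmetric] algebra_simps)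
    then show ?thesis using e0 by (simp add: ennreal_mult mult_ac)
  qed
  have "(\<integral>\<^sup>+t. ennreal (e t) * conv_power_nn l (Suc j) t \<partial>lborel)
      = (\<integral>\<^sup>+t. (\<integral>\<^sup>+s. ennreal (e t) * (ennreal \<bar>l (t - s)\<bar> * conv_power_nn l j s) \<partial>lborel) \<partial>lborel)"
    by (simp add: nn_integral_cmult)
  also have "\<dots> \<le> (\<integral>\<^sup>+t. (\<integral>\<^sup>+s. ennreal (e (t - s) * \<bar>l (t - s)\<bar>) * (ennreal (e s) * conv_power_nn l j s) \<partial>lborel) \<partial>lborel)"
    by (intro nn_integral_mono split)
  also have "\<dots> = (\<integral>\<^sup>+s. (\<integral>\<^sup>+t. ennreal (e (t - s) * \<bar>l (t - s)\<bar>) * (ennreal (e s) * conv_power_nn l j s) \<partial>lborel) \<partial>lborel)"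
    by (rule lborel_pair.Fubini') measurable
  also have "\<dots> = (\<integral>\<^sup>+s. K * (ennreal (e s) * conv_power_nn l j s) \<partial>lborel)"
  proof (rule nn_integral_cong)
    fix s
    have "(\<integral>\<^sup>+t. ennreal (e (t - s) * \<bar>l (t - s)\<bar>) \<partial>lborel) = K"
      unfolding K_def by (subst (2) nn_integral_real_affine[where c=1 and t="-s"]) simp_all
    then show "(\<integral>\<^sup>+t. ennreal (e (t - s) * \<bar>l (t - s)\<bar>) * (ennreal (e s) * conv_power_nn l j s) \<partial>lborel)
        = K * (ennreal (e s) * conv_power_nn l j s)"
      by (simp add: nn_integral_multc)
  qed
  also have "\<dots> = K * (\<integral>\<^sup>+s. ennreal (e s) * conv_power_nn l j s \<partial>lborel)"
    by (simp add: nn_integral_cmult)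
  also have "\<dots> \<le> K * K ^ Suc j"
    using Suc unfolding K_def e_def by (intro mult_left_mono) auto
  finally show ?case unfolding K_def e_def by simp
qed

lemma small_weight:
  obtains n :: nat where "(\<integral>\<^sup>+t. ennreal (indicator {..<S} t * exp (- real n * t) * \<bar>l t\<bar>) \<partial>lborel) \<le> ennreal (1 / 2)"
proof -
  have "(\<lambda>n. \<integral>\<^sup>+t. ennreal (indicator {..<S} t * exp (- real n * t) * \<bar>l t\<bar>) \<partial>lborel) \<longlonglongrightarrow> (\<integral>\<^sup>+t. 0 \<partial>(lborel :: real measure))"
  proof (rule nn_integral_dominated_convergence[where w="\<lambda>t. ennreal \<bar>indicator {0<..<S} t * l t\<bar>"])
    show "(\<integral>\<^sup>+t. ennreal \<bar>indicator {0<..<S} t * l t\<bar> \<partial>lborel) < \<infinity>"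
      using l_int[of S] by (simp add: integrable_iff_bounded)
    show "AE t in lborel. ennreal (indicator {..<S} t * exp (- real n * t) * \<bar>l t\<bar>) \<le> ennreal \<bar>indicator {0<..<S} t * l t\<bar>" for n
    proof (rule AE_I2)
      fix t
      show "ennreal (indicator {..<S} t * exp (- real n * t) * \<bar>l t\<bar>) \<le> ennreal \<bar>indicator {0<..<S} t * l t\<bar>"
      proof (cases "t \<le> 0")
        case False
        then have "exp (- real n * t) \<le> 1" by simp
        then have "exp (- real n * t) * \<bar>l t\<bar> \<le> 1 * \<bar>l t\<bar>" by (rule mult_right_mono) simp
        then show ?thesis using False by (intro ennreal_leI) (auto simp: indicator_def)
      qed (simp add: l_zero)
    qed
    show "AE t in lborel. (\<lambda>n. ennreal (indicator {..<S} t * exp (- real n * t) * \<bar>l t\<bar>)) \<longlonglongrightarrow> 0"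
    proof (rule AE_I2)
      fix t
      show "(\<lambda>n. ennreal (indicator {..<S} t * exp (- real n * t) * \<bar>l t\<bar>)) \<longlonglongrightarrow> 0"
      proof (cases "t \<le> 0")
        case False
        have "(\<lambda>n. exp (- t) ^ n) \<longlonglongrightarrow> 0" using False by (intro LIMSEQ_realpow_zero) auto
        then have "(\<lambda>n. exp (- real n * t)) \<longlonglongrightarrow> 0" by (simp add: exp_of_nat_mult[symmetric])
        then have "(\<lambda>n. indicator {..<S} t * exp (- real n * t) * \<bar>l t\<bar>) \<longlonglongrightarrow> indicator {..<S} t * 0 * \<bar>l t\<bar>"
          by (intro tendsto_intros)
        from tendsto_ennrealI[OF this] show ?thesis by simp
      qed (simp add: l_zero)
    qed
  qed measurable
  then have "eventually (\<lambda>n. (\<integral>\<^sup>+t. ennreal (indicator {..<S} t * exp (- real n * t) * \<bar>l t\<bar>) \<partial>lborel) < ennreal (1 / 2)) sequentially"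
  proof (rule order_tendstoD(2))
    have "ennreal 0 < ennreal (1 / 2)" by (subst ennreal_less_iff) auto
    then show "(\<integral>\<^sup>+t. 0 \<partial>(lborel :: real measure)) < ennreal (1 / 2)" by simp
  qed
  then obtain n where "(\<integral>\<^sup>+t. ennreal (indicator {..<S} t * exp (- real n * t) * \<bar>l t\<bar>) \<partial>lborel) < ennreal (1 / 2)"
    by (auto simp: eventually_sequentially)
  then show thesis by (intro that[of n]) auto
qed

lemma conv_power_sum_finite:
  assumes S: "0 < S"
  shows "(\<integral>\<^sup>+t. indicator {..<S} t * (\<Sum>j. conv_power_nn l j t) \<partial>lborel) < \<infinity>"
proof -
  obtain n where n: "(\<integral>\<^sup>+t. ennreal (indicator {..<S} t * exp (- real n * t) * \<bar>l t\<bar>) \<partial>lborel) \<le> ennreal (1 / 2)"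
    using small_weight[of S] by blast
  have "(\<integral>\<^sup>+t. indicator {..<S} t * (\<Sum>j. conv_power_nn l j t) \<partial>lborel)
      \<le> (\<integral>\<^sup>+t. ennreal (exp (real n * S)) * (\<Sum>j. ennreal (indicator {..<S} t * exp (- real n * t)) * conv_power_nn l j t) \<partial>lborel)"
  proof (rule nn_integral_mono)
    fix t :: real
    have "ennreal (exp (real n * S)) * (\<Sum>j. ennreal (indicator {..<S} t * exp (- real n * t)) * conv_power_nn l j t)
        = ennreal (exp (real n * S) * (indicator {..<S} t * exp (- real n * t))) * (\<Sum>j. conv_power_nn l j t)"
      by (simp add: ennreal_suminf_cmult ennreal_mult mult.assoc)
    moreover have "indicator {..<S} t \<le> ennreal (exp (real n * S) * (indicator {..<S} t * exp (- real n * t)))"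
    proof (cases "t < S")
      case True
      then have "1 \<le> exp (real n * (S - t))" by (simp add: mult_nonneg_nonneg)
      then show ?thesis using True by (simp add: exp_add[symmetric] algebra_simps flip: ennreal_1 del: ennreal_1)
    qed simp
    ultimately show "indicator {..<S} t * (\<Sum>j. conv_power_nn l j t)
        \<le> ennreal (exp (real n * S)) * (\<Sum>j. ennreal (indicator {..<S} t * exp (- real n * t)) * conv_power_nn l j t)"
      by (simp add: mult_right_mono)
  qed
  also have "\<dots> = ennreal (exp (real n * S)) * (\<Sum>j. \<integral>\<^sup>+t. ennreal (indicator {..<S} t * exp (- real n * t)) * conv_power_nn l j t \<partial>lborel)"
    by (subst nn_integral_suminf[symmetric]) (simp_all add: nn_integral_cmult del: ennreal_suminf_cmult)
  also have "\<dots> \<le> ennreal (exp (real n * S)) * (\<Sum>j. ennreal ((1 / 2) ^ Suc j))"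
  proof (intro mult_left_mono suminf_le)
    fix j
    have "(\<integral>\<^sup>+t. ennreal (indicator {..<S} t * exp (- real n * t)) * conv_power_nn l j t \<partial>lborel) \<le> ennreal (1 / 2) ^ Suc j"
      by (rule order_trans[OF conv_power_weighted power_mono[OF n]]) simp
    then show "(\<integral>\<^sup>+t. ennreal (indicator {..<S} t * exp (- real n * t)) * conv_power_nn l j t \<partial>lborel) \<le> ennreal ((1 / 2) ^ Suc j)"
      by (simp only: ennreal_power) 
  qed auto
  also have "(\<Sum>j. ennreal ((1 / 2) ^ Suc j)) = ennreal 1"
    using power_half_series by (intro suminf_ennreal_eq) auto
  finally show ?thesis by (auto simp: ennreal_mult_less_top intro: order_le_less_trans)
qed

definition neumann_nn :: "real \<Rightarrow> ennreal" where
  "neumann_nn t = (\<Sum>j. conv_power_nn l j t)"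

text \<open>The resolvent \<open>l - l * l + l * l * l - \<dots>\<close>.\<close>

definition neumann :: "real \<Rightarrow> real" where
  "neumann t = (\<Sum>j. (- 1) ^ j * conv_power l j t)"

lemma neumann_nn_measurable [measurable]: "neumann_nn \<in> borel_measurable borel"
  unfolding neumann_nn_def[abs_def] by measurable

lemma neumann_measurable [measurable]: "neumann \<in> borel_measurable borel"
  unfolding neumann_def[abs_def] by measurable

lemma neumann_nn_finite: "AE t in lborel. neumann_nn t < \<infinity>"
proof -
  have "AE t in lborel. indicator {..<real (Suc n)} t * neumann_nn t \<noteq> \<infinity>" for n
    using conv_power_sum_finite[of "real (Suc n)"]
    by (intro nn_integral_PInf_AE) (auto simp: neumann_nn_def[symmetric])
  then have "AE t in lborel. \<forall>n. indicator {..<real (Suc n)} t * neumann_nn t \<noteq> \<infinity>"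
    by (simp add: AE_all_countable)
  then show ?thesis
  proof eventually_elim
    case (elim t)
    obtain n where "t < real n" using reals_Archimedean2 by blast
    then have "t < real (Suc n)" by simp
    then show ?case using elim[rule_format, of n] by (simp add: less_top)
  qed
qed

lemma neumann_summable:
  assumes "neumann_nn t < \<infinity>"
  shows "summable (\<lambda>j. \<bar>conv_power l j t\<bar>)" "ennreal \<bar>neumann t\<bar> \<le> neumann_nn t"
proof -
  have le: "(\<Sum>j. ennreal \<bar>conv_power l j t\<bar>) \<le> neumann_nn t"
    unfolding neumann_nn_def by (intro suminf_le conv_power_le) auto
  then show s: "summable (\<lambda>j. \<bar>conv_power l j t\<bar>)"
    using assms by (intro summable_suminf_not_top) auto
  have "\<bar>neumann t\<bar> \<le> (\<Sum>j. \<bar>conv_power l j t\<bar>)"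
    using summable_norm[of "\<lambda>j. (- 1) ^ j * conv_power l j t"] s by (simp add: neumann_def abs_mult power_abs)
  then have "ennreal \<bar>neumann t\<bar> \<le> (\<Sum>j. ennreal \<bar>conv_power l j t\<bar>)"
    using s by (simp add: suminf_ennreal2 ennreal_leI)
  with le show "ennreal \<bar>neumann t\<bar> \<le> neumann_nn t" by (rule order_trans[rotated])
qed

lemma neumann_L1_loc: "integrable lborel (\<lambda>t. indicator {0<..<S} t * neumann t)"
proof (cases "0 < S")
  case True
  show ?thesis
  proof (rule integrableI_bounded)
    have "(\<integral>\<^sup>+t. ennreal (norm (indicator {0<..<S} t * neumann t)) \<partial>lborel)
        \<le> (\<integral>\<^sup>+t. indicator {..<S} t * (\<Sum>j. conv_power_nn l j t) \<partial>lborel)"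
    proof (rule nn_integral_mono_AE)
      show "AE t in lborel. ennreal (norm (indicator {0<..<S} t * neumann t)) \<le> indicator {..<S} t * (\<Sum>j. conv_power_nn l j t)"
        using neumann_nn_finite
        by eventually_elim (use neumann_summable(2) in \<open>auto simp: indicator_def neumann_nn_def[symmetric]\<close>)
    qed
    also have "\<dots> < \<infinity>" by (rule conv_power_sum_finite[OF True])
    finally show "(\<integral>\<^sup>+t. ennreal (norm (indicator {0<..<S} t * neumann t)) \<partial>lborel) < \<infinity>" .
  qed measurable
qed simp

text \<open>Convolution with \<open>l\<close> shifts the series by one term and changes its sign.\<close>

lemma neumann_equation: "AE t in lborel. neumann t + lconv l neumann t = l t"
  using neumann_nn_finite
proof eventually_elim
  case (elim t)
  have split: "neumann_nn t = ennreal \<bar>l t\<bar> + (\<Sum>j. conv_power_nn l (Suc j) t)"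
    unfolding neumann_nn_def by (subst suminf_offset[where i=1]) (simp_all add: summableI)
  have M: "(\<Sum>j. conv_power_nn l (Suc j) t) = (\<integral>\<^sup>+s. ennreal \<bar>l (t - s)\<bar> * neumann_nn s \<partial>lborel)"
    by (simp add: nn_integral_suminf[symmetric] neumann_nn_def ennreal_suminf_cmult)
  have fin: "(\<Sum>j. conv_power_nn l (Suc j) t) < \<infinity>"
    using elim unfolding split by (auto simp: less_top)
  define F where "F j s = (- 1) ^ j * (l (t - s) * conv_power l j s)" for j s
  have [measurable]: "F j \<in> borel_measurable borel" for j unfolding F_def by measurable
  have normF: "norm (F j s) = \<bar>l (t - s)\<bar> * \<bar>conv_power l j s\<bar>" for j s
    by (simp add: F_def abs_mult power_abs)
  have nnF: "(\<integral>\<^sup>+s. ennreal (norm (F j s)) \<partial>lborel) \<le> conv_power_nn l (Suc j) t" for j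
    unfolding normF using conv_power_le by (auto simp: ennreal_mult intro!: nn_integral_mono mult_left_mono)
  have cpfin: "conv_power_nn l (Suc j) t < \<infinity>" for j
    using fin by (rule ennreal_suminf_lessD)
  have Fint: "integrable lborel (F j)" for j
    using order_le_less_trans[OF nnF[of j] cpfin[of j]] by (intro integrableI_bounded) simp_all
  have AEs: "AE s in lborel. neumann_nn s < \<infinity>" by (rule neumann_nn_finite)
  have sumF: "(\<lambda>j. \<integral>s. F j s \<partial>lborel) sums (LBINT s. (\<Sum>j. F j s))"
  proof (rule sums_integral)
    show "integrable lborel (F j)" for j by (rule Fint)
    show "AE s in lborel. summable (\<lambda>j. norm (F j s))"
      using AEs unfolding normF by eventually_elim (intro summable_mult neumann_summable(1))
    have "(\<Sum>j. ennreal (LBINT s. norm (F j s))) \<le> (\<Sum>j. conv_power_nn l (Suc j) t)"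
    proof (intro suminf_le)
      fix j
      show "ennreal (LBINT s. norm (F j s)) \<le> conv_power_nn l (Suc j) t"
        using nnF[of j] nn_integral_eq_integral[OF integrable_norm[OF Fint[of j]]] by simp
    qed auto
    then show "summable (\<lambda>j. \<integral>s. norm (F j s) \<partial>lborel)"
      using fin by (intro summable_suminf_not_top) (auto intro: order_le_less_trans)
  qed
  have intF: "(LBINT s. F j s) = (- 1) ^ j * conv_power l (Suc j) t" for j
    by (simp add: F_def lconv_def)
  have "(LBINT s. (\<Sum>j. F j s)) = lconv l neumann t"
    unfolding lconv_def
  proof (rule integral_cong_AE)
    show "AE s in lborel. (\<Sum>j. F j s) = l (t - s) *\<^sub>R neumann s"
      using AEs
    proof eventually_elim
      case (elim s)
      have "summable (\<lambda>j. (- 1) ^ j * conv_power l j s)"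
        by (rule summable_norm_cancel) (use neumann_summable(1)[OF elim] in \<open>simp add: abs_mult power_abs\<close>)
      from suminf_mult[OF this, of "l (t - s)"] show ?case
        by (simp add: F_def neumann_def mult_ac)
    qed
  qed measurable
  with sumF intF have 1: "(\<lambda>j. (- 1) ^ j * conv_power l (Suc j) t) sums lconv l neumann t" by simp
  have "summable (\<lambda>j. (- 1) ^ j * conv_power l j t)"
    by (rule summable_norm_cancel) (use neumann_summable(1)[OF elim] in \<open>simp add: abs_mult power_abs\<close>)
  then have "(\<lambda>j. (- 1) ^ j * conv_power l j t) sums neumann t" unfolding neumann_def by (rule summable_sums)
  then have "(\<lambda>j. (- 1) ^ Suc j * conv_power l (Suc j) t) sums (neumann t - l t)"
    by (subst sums_Suc_iff) simp
  moreover have "(\<lambda>j. (- 1) ^ Suc j * conv_power l (Suc j) t) sums (- lconv l neumann t)"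
    using sums_minus[OF 1] by simp
  ultimately have "neumann t - l t = - lconv l neumann t" by (rule sums_unique2)
  then show ?case by simp
qed

lemma neumann_zero: "t \<le> 0 \<Longrightarrow> neumann t = 0"
proof -
  assume t: "t \<le> 0"
  have "conv_power l j t = 0" for j
    using conv_power_le[of j t] conv_power_nn_zero[OF t, of j] by simp
  then show ?thesis by (simp add: neumann_def)
qed

end

text \<open>The Volterra equation that defines \<open>reg_h l 1\<close> has a solution, so the value picked by \<open>reg_h\<close> is
  one.\<close>

lemma reg_h_solves:
  assumes l: "l \<in> L1_loc"
  shows "reg_h l 1 \<in> L1_loc" "AE t in lborel. 0 < t \<longrightarrow> reg_h l 1 t + conv (reg_h l 1) l t = l t"
proof -
  obtain l' where l': "l' \<in> borel_measurable borel" "AE t in lborel. 0 < t \<longrightarrow> l t = l' t" "\<And>t. t \<le> 0 \<Longrightarrow> l' t = 0"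
    "\<And>S. integrable lborel (\<lambda>t. indicator {0<..<S} t * l' t)"
    using L1_loc_representative[OF l] by blast
  note l'_zero = l'(3)
  define h where "h = neumann l'"
  have eq: "AE t in lborel. neumann l' t + lconv l' (neumann l') t = l' t"
    by (rule neumann_equation) (use l' in auto)
  have h0: "h t = 0" if "t \<le> 0" for t
    unfolding h_def by (rule neumann_zero) (use l' that in auto)
  have hm: "h \<in> borel_measurable borel" unfolding h_def by (rule neumann_measurable) (use l' in auto)
  have h: "h \<in> L1_loc"
    unfolding h_def by (intro L1_locI neumann_measurable neumann_L1_loc l')
  have "AE t in lborel. 0 < t \<longrightarrow> h t + conv h l t = l t"
    using eq l'(2)
  proof eventually_elim
    case (elim t)
    have "conv h l t = lconv h l' t"
      by (rule conv_eq_lconv[where S=t]) (use hm l' h0 in \<open>auto elim: eventually_mono\<close>)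
    then show ?case using elim by (simp add: h_def lconv_commute)
  qed
  then have "h \<in> L1_loc \<and> (AE t in lebesgue_on {0<..}. h t + real 1 * conv h l t = real 1 * l t)"
    using h by (simp add: AE_lebesgue_on_iff)
  then have "reg_h l 1 \<in> L1_loc \<and> (AE t in lebesgue_on {0<..}. reg_h l 1 t + real 1 * conv (reg_h l 1) l t = real 1 * l t)"
    unfolding reg_h_def
    by (rule someI[where P="\<lambda>h. h \<in> L1_loc \<and> (AE t in lebesgue_on {0<..}. h t + real 1 * conv h l t = real 1 * l t)"])
  then show "reg_h l 1 \<in> L1_loc" "AE t in lborel. 0 < t \<longrightarrow> reg_h l 1 t + conv (reg_h l 1) l t = l t"
    by (simp_all add: AE_lebesgue_on_iff)
qed


section \<open>Volterra equations in time, smoothed\<close>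

lemma bump_scaled:
  assumes f: "f \<in> bumps" and \<epsilon>: "0 < \<epsilon>"
  shows "causal_L1 (\<lambda>t. f (t / \<epsilon>))" "\<epsilon> \<le> t \<Longrightarrow> f (t / \<epsilon>) = 0"
    "(\<lambda>t. f (t / \<epsilon>)) \<in> borel_measurable borel"
proof -
  obtain C where C: "\<And>x. \<bar>f x\<bar> \<le> C" "0 \<le> C" using bumps_bounded[OF f] by metis
  have [measurable]: "f \<in> borel_measurable borel"
    using bumps_continuous[OF f] by (simp add: borel_measurable_continuous_onI)
  show "\<epsilon> \<le> t \<Longrightarrow> f (t / \<epsilon>) = 0" for t using bumps_support[OF f, of "t / \<epsilon>"] \<epsilon> by simp
  have z: "t \<le> 0 \<or> \<epsilon> \<le> t \<Longrightarrow> f (t / \<epsilon>) = 0" for t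
    using bumps_support[OF f, of "t / \<epsilon>"] \<epsilon> by (auto simp: divide_le_0_iff)
  show "(\<lambda>t. f (t / \<epsilon>)) \<in> borel_measurable borel" by measurable
  have "integrable lborel (\<lambda>t. f (t / \<epsilon>))"
  proof (rule Bochner_Integration.integrable_bound)
    show "integrable lborel (\<lambda>t. C * indicator {0<..<\<epsilon>} t)"
      using causal_L1D(1)[OF causal_L1_indicator[of \<epsilon>]] by simp
    show "AE t in lborel. norm (f (t / \<epsilon>)) \<le> norm (C * indicator {0<..<\<epsilon>} t)"
    proof (rule AE_I2)
      fix t show "norm (f (t / \<epsilon>)) \<le> norm (C * indicator {0<..<\<epsilon>} t)"
        using C z[of t] by (cases "0 < t \<and> t < \<epsilon>") auto
    qed
  qed measurable
  then show "causal_L1 (\<lambda>t. f (t / \<epsilon>))" using z by (auto simp: causal_L1_def)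
qed

text \<open>Bump functions are primitives of bump functions.  Writing a mollifier as \<open>1 * b'\<close> replaces
  differentiation by algebra with convolutions.\<close>

lemma bump_scaled_primitive:
  assumes f: "f \<in> bumps" and f': "f' \<in> bumps" "\<And>x. (f has_real_derivative f' x) (at x)" and \<epsilon>: "0 < \<epsilon>" and t: "t \<le> T"
  shows "lconv (indicator {0<..<T}) (\<lambda>s. f' (s / \<epsilon>) / \<epsilon>) t = f (t / \<epsilon>)"
proof -
  have c: "causal_L1 (\<lambda>s. f' (s / \<epsilon>) / \<epsilon>)"
    using bump_scaled(1)[OF bumps.scale[OF f'(1), of "1 / \<epsilon>"] \<epsilon>] by simp
  have "lconv (indicator {0<..<T}) (\<lambda>s. f' (s / \<epsilon>) / \<epsilon>) t = (LBINT s. indicator {..<t} s * (f' (s / \<epsilon>) / \<epsilon>))"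
    by (rule lconv_indicator[OF c t])
  also have "\<dots> = f (t / \<epsilon>)"
  proof (cases "0 \<le> t")
    case True
    have der: "((\<lambda>s. f (s / \<epsilon>)) has_real_derivative f' (s / \<epsilon>) / \<epsilon>) (at s)" for s
    proof -
      have "((\<lambda>s. f (s / \<epsilon>)) has_real_derivative f' (s / \<epsilon>) * (1 / \<epsilon>)) (at s)"
        by (rule DERIV_chain2[OF f'(2)]) (use \<epsilon> in \<open>auto intro!: derivative_eq_intros\<close>)
      then show ?thesis by simp
    qed
    have "(LBINT s. (f' (s / \<epsilon>) / \<epsilon>) * indicator {0..t} s) = f (t / \<epsilon>) - f (0 / \<epsilon>)"
    proof (rule integral_FTC_Icc_real[OF True der])
      fix s
      have "continuous_on UNIV (\<lambda>s. f' (s / \<epsilon>))"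
        by (rule continuous_on_compose2[OF bumps_continuous[OF f'(1)]]) (use \<epsilon> in \<open>auto intro!: continuous_intros\<close>)
      then have "continuous_on UNIV (\<lambda>s. f' (s / \<epsilon>) / \<epsilon>)"
        using \<epsilon> by (intro continuous_intros) auto
      then show "isCont (\<lambda>s. f' (s / \<epsilon>) / \<epsilon>) s" by (simp add: continuous_on_eq_continuous_at)
    qed
    moreover have "f (0 / \<epsilon>) = 0" using bumps_support[OF f, of 0] by simp
    moreover have "(LBINT s. indicator {..<t} s * (f' (s / \<epsilon>) / \<epsilon>)) = (LBINT s. (f' (s / \<epsilon>) / \<epsilon>) * indicator {0..t} s)"
    proof (rule integral_cong_AE)
      show "AE s in lborel. indicator {..<t} s * (f' (s / \<epsilon>) / \<epsilon>) = (f' (s / \<epsilon>) / \<epsilon>) * indicator {0..t} s"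
        using AE_lborel_singleton[of t]
        by eventually_elim (use causal_L1D(3)[OF c] in \<open>auto simp: indicator_def\<close>)
    qed (use causal_L1D(2)[OF c] in measurable)
    ultimately show ?thesis by simp
  next
    case False
    then have "indicator {..<t} s * (f' (s / \<epsilon>) / \<epsilon>) = 0" for s
      using causal_L1D(3)[OF c, of s] by (auto simp: indicator_def)
    then have "(\<lambda>s. indicator {..<t} s * (f' (s / \<epsilon>) / \<epsilon>)) = (\<lambda>s. 0)" by (rule ext)
    moreover have "f (t / \<epsilon>) = 0" using causal_L1D(3)[OF bump_scaled(1)[OF f \<epsilon>], of t] False by simp
    ultimately show ?thesis by (simp only:) simp
  qed
  finally show ?thesis .
qed

text \<open>As a function of \<open>s\<close>, the mollifier centred at \<open>t\<close> is a test function on \<open>(0, T)\<close>; testing a weak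
  time derivative with it produces a convolution evaluated at \<open>t\<close>.\<close>

lemma bump_test_function:
  assumes f: "f \<in> bumps" and f': "\<And>x. (f has_real_derivative f' x) (at x)" and \<epsilon>: "0 < \<epsilon>" "\<epsilon> < t" "t < T"
  shows "(\<lambda>s. f ((t - s) / \<epsilon>)) \<in> test_functions {0<..<T}"
    and "deriv (\<lambda>s. f ((t - s) / \<epsilon>)) s = - (f' ((t - s) / \<epsilon>) / \<epsilon>)"
proof -
  have aff: "(\<lambda>s. f ((t - s) / \<epsilon>)) = (\<lambda>s. f (- (1 / \<epsilon>) * s + t / \<epsilon>))"
    using \<epsilon> by (simp add: field_simps)
  have "Ck m (\<lambda>s. f ((t - s) / \<epsilon>))" for m unfolding aff by (rule bumps_Ck[OF f])
  moreover have sub: "{s. f ((t - s) / \<epsilon>) \<noteq> 0} \<subseteq> {t - \<epsilon>..t}"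
  proof
    fix s assume s: "s \<in> {s. f ((t - s) / \<epsilon>) \<noteq> 0}"
    then have "\<not> (t - s) / \<epsilon> \<le> 0" "\<not> 1 \<le> (t - s) / \<epsilon>"
      using bumps_support[OF f, of "(t - s) / \<epsilon>"] by auto
    then have "0 < t - s" "t - s < \<epsilon>"
      using \<epsilon>(1) by (simp_all add: divide_le_0_iff)
    then show "s \<in> {t - \<epsilon>..t}" by auto
  qed
  then have cl: "closure {s. f ((t - s) / \<epsilon>) \<noteq> 0} \<subseteq> {t - \<epsilon>..t}"
    by (rule closure_minimal) simp
  moreover have "compact (closure {s. f ((t - s) / \<epsilon>) \<noteq> 0})"
    using bounded_subset[OF bounded_closed_interval sub] by (rule compact_closure[THEN iffD2])
  ultimately show "(\<lambda>s. f ((t - s) / \<epsilon>)) \<in> test_functions {0<..<T}"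
    using \<epsilon> by (auto simp: test_functions_def)
  have "((\<lambda>s. f ((t - s) / \<epsilon>)) has_real_derivative f' ((t - s) / \<epsilon>) * (- (1 / \<epsilon>))) (at s)"
    by (rule DERIV_chain2[OF f']) (use \<epsilon> in \<open>auto intro!: derivative_eq_intros\<close>)
  from DERIV_imp_deriv[OF this] show "deriv (\<lambda>s. f ((t - s) / \<epsilon>)) s = - (f' ((t - s) / \<epsilon>) / \<epsilon>)" by simp
qed

lemma mollification_eq:
  fixes P :: "real \<Rightarrow> real"
  assumes \<rho>: "\<rho> \<in> bumps" "integrable lborel \<rho>" "(LBINT a. \<rho> a) = 1" and \<epsilon>: "0 < \<epsilon>" and P: "integrable lborel P"
  shows "lconv (\<lambda>s. \<rho> (s / \<epsilon>) / \<epsilon>) P t - P t = (LBINT a. \<rho> a * (P (t - \<epsilon> * a) - P t))"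
proof -
  obtain C where C: "\<And>x. \<bar>\<rho> x\<bar> \<le> C" using bumps_bounded[OF \<rho>(1)] by metis
  have [measurable]: "\<rho> \<in> borel_measurable borel" "P \<in> borel_measurable borel"
    using \<rho>(2) P by (auto dest: borel_measurable_integrable)
  have "lconv (\<lambda>s. \<rho> (s / \<epsilon>) / \<epsilon>) P t = (LBINT s. P (t - s) * (\<rho> (s / \<epsilon>) / \<epsilon>))"
    by (subst lconv_commute) (simp add: lconv_def)
  also have "\<dots> = \<epsilon> * (LBINT a. P (t - \<epsilon> * a) * (\<rho> a / \<epsilon>))"
    by (subst lborel_integral_real_affine[where c=\<epsilon> and t=0]) (use \<epsilon> in auto)
  also have "\<dots> = (LBINT a. \<epsilon> * (P (t - \<epsilon> * a) * (\<rho> a / \<epsilon>)))" by simp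
  also have "\<dots> = (LBINT a. \<rho> a * P (t - \<epsilon> * a))"
    using \<epsilon> by (intro Bochner_Integration.integral_cong) auto
  finally have 1: "lconv (\<lambda>s. \<rho> (s / \<epsilon>) / \<epsilon>) P t = (LBINT a. \<rho> a * P (t - \<epsilon> * a))" .
  have "integrable lborel (\<lambda>a. P (t + (- \<epsilon>) * a))"
    using \<epsilon> by (intro lborel_integrable_real_affine P) auto
  then have i: "integrable lborel (\<lambda>a. C * P (t - \<epsilon> * a))" by simp
  have i1: "integrable lborel (\<lambda>a. \<rho> a * P (t - \<epsilon> * a))"
    by (rule Bochner_Integration.integrable_bound[OF i]) (auto simp: abs_mult intro!: mult_right_mono order_trans[OF C])
  have "P t = (LBINT a. \<rho> a * P t)" using \<rho>(3) by simp
  then show ?thesis unfolding 1 right_diff_distrib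
    using Bochner_Integration.integral_diff[OF i1 integrable_mult_left[of "P t" lborel \<rho>]] \<rho>(2) by simp
qed

lemma lconv_small:
  fixes f g :: "real \<Rightarrow> real"
  assumes f: "causal_L1 f" and g: "causal_L1 g"
    and small: "AE s in lborel. 0 < s \<and> s < d \<longrightarrow> \<bar>g s\<bar> \<le> e" and e: "0 \<le> e" and t: "t \<le> d"
  shows "\<bar>lconv f g t\<bar> \<le> e * (LBINT s. \<bar>f s\<bar>)"
proof (cases "integrable lborel (\<lambda>s. f (t - s) *\<^sub>R g s)")
  case False
  then show ?thesis using e by (simp add: lconv_def not_integrable_integral_eq Bochner_Integration.integral_nonneg)
next
  case True
  have i: "integrable lborel (\<lambda>s. f (t - s))"
    using lborel_integrable_real_affine[OF causal_L1D(1)[OF f], of "-1" t] by simp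
  have eq: "(LBINT s. \<bar>f (t - s)\<bar>) = (LBINT s. \<bar>f s\<bar>)"
    using lborel_integral_real_affine[of "-1" "\<lambda>s. \<bar>f s\<bar>" t] by simp
  have "\<bar>lconv f g t\<bar> \<le> (LBINT s. norm (f (t - s) *\<^sub>R g s))"
    unfolding lconv_def using integral_norm_bound[of lborel "\<lambda>s. f (t - s) *\<^sub>R g s"] by simp
  also have "\<dots> \<le> (LBINT s. e * \<bar>f (t - s)\<bar>)"
  proof (rule integral_mono_AE)
    show "AE s in lborel. norm (f (t - s) *\<^sub>R g s) \<le> e * \<bar>f (t - s)\<bar>"
      using small
    proof eventually_elim
      case (elim s)
      show ?case
      proof (cases "0 < s \<and> s < t")
        case True
        then have "\<bar>g s\<bar> \<le> e" using elim t by auto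
        then have "\<bar>f (t - s)\<bar> * \<bar>g s\<bar> \<le> \<bar>f (t - s)\<bar> * e" by (rule mult_left_mono) simp
        then show ?thesis by (simp add: abs_mult mult.commute)
      next
        case False
        then have "f (t - s) = 0 \<or> g s = 0"
          using causal_L1D(3)[OF g, of s] causal_L1D(3)[OF f, of "t - s"] by force
        then show ?thesis using e by auto
      qed
    qed
  qed (use True i in auto)
  also have "\<dots> = e * (LBINT s. \<bar>f s\<bar>)" by (simp add: eq)
  finally show ?thesis .
qed

text \<open>The mollification \<open>b * P = 1 * (b' * P)\<close> is constant on \<open>(\<epsilon>, T)\<close>, because \<open>b' * P\<close> vanishes there.  Near
  \<open>0\<close> it is small because \<open>P\<close> is, so the constant is small; let \<open>\<epsilon>\<close> tend to \<open>0\<close>.\<close>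

proposition vanishing_derivative_and_initial_value:
  assumes \<rho>: "\<rho> \<in> bumps" "\<And>x. 0 \<le> \<rho> x" "integrable lborel \<rho>" "(LBINT a. \<rho> a) = 1"
    and \<rho>': "\<rho>' \<in> bumps" "\<And>x. (\<rho> has_real_derivative \<rho>' x) (at x)"
    and P: "causal_L1 P" and T: "0 < T"
    and deriv0: "\<And>\<epsilon> t. 0 < \<epsilon> \<Longrightarrow> \<epsilon> < t \<Longrightarrow> t < T \<Longrightarrow> lconv (\<lambda>s. \<rho>' (s / \<epsilon>)) P t = 0"
    and init: "\<And>e. 0 < e \<Longrightarrow> \<exists>d>0. AE t in lborel. 0 < t \<and> t < d \<longrightarrow> \<bar>P t\<bar> \<le> e"
  shows "eq_upto T P (\<lambda>_. 0)"
proof -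
  note [measurable] = causal_L1D(2)[OF P]
  define b where "b \<epsilon> s = \<rho> (s / \<epsilon>) / \<epsilon>" for \<epsilon> s
  have b_props: "causal_L1 (b \<epsilon>)" "\<And>s. \<epsilon> \<le> s \<Longrightarrow> b \<epsilon> s = 0" "\<And>s. 0 \<le> b \<epsilon> s"
    "(LBINT s. b \<epsilon> s) = 1" if \<epsilon>: "0 < \<epsilon>" for \<epsilon>
  proof -
    have s: "(\<lambda>x. 1 / \<epsilon> * \<rho> x) \<in> bumps" by (rule bumps.scale[OF \<rho>(1)])
    show "causal_L1 (b \<epsilon>)" using bump_scaled(1)[OF s \<epsilon>] by (simp add: b_def[abs_def])
    show "\<And>s. \<epsilon> \<le> s \<Longrightarrow> b \<epsilon> s = 0" using bump_scaled(2)[OF s \<epsilon>] by (simp add: b_def[abs_def])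
    show "0 \<le> b \<epsilon> s" for s using \<rho>(2) \<epsilon> by (simp add: b_def)
    show "(LBINT s. b \<epsilon> s) = 1"
      unfolding b_def using \<epsilon> \<rho>(4) by (subst lborel_integral_real_affine[where c=\<epsilon> and t=0]) auto
  qed
  have small: "\<bar>lconv (b \<epsilon>) P t\<bar> \<le> e"
    if \<epsilon>: "0 < \<epsilon>" and t: "t \<le> d" and d: "AE t in lborel. 0 < t \<and> t < d \<longrightarrow> \<bar>P t\<bar> \<le> e" and e: "0 < e" for \<epsilon> t d e
    using lconv_small[OF b_props(1)[OF \<epsilon>] P d _ t] e b_props(3,4)[OF \<epsilon>] by simp
  have bound: "\<bar>lconv (b \<epsilon>) P t\<bar> \<le> e"
    if \<epsilon>: "0 < \<epsilon>" "\<epsilon> < d" "\<epsilon> < T" and t: "t < T" and d: "AE t in lborel. 0 < t \<and> t < d \<longrightarrow> \<bar>P t\<bar> \<le> e" and e: "0 < e" for \<epsilon> t d e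
  proof (cases "t \<le> \<epsilon>")
    case True
    then show ?thesis using small[OF \<epsilon>(1) _ d e] \<epsilon>(2) by simp
  next
    case False
    define b' where "b' s = (1 / \<epsilon> * \<rho>' (s / \<epsilon>)) / \<epsilon>" for s
    have s': "(\<lambda>x. 1 / \<epsilon> * (1 / \<epsilon> * \<rho>' x)) \<in> bumps" by (intro bumps.scale \<rho>'(1))
    have b': "causal_L1 b'" using bump_scaled(1)[OF s' \<epsilon>(1)] by (simp add: b'_def[abs_def] mult.commute)
    have prim: "lconv (indicator {0<..<T}) b' r = b \<epsilon> r" if "r \<le> T" for r
      unfolding b'_def[abs_def] b_def
      using bump_scaled_primitive[OF bumps.scale[OF \<rho>(1), of "1 / \<epsilon>"] bumps.scale[OF \<rho>'(1), of "1 / \<epsilon>"] DERIV_cmult[OF \<rho>'(2)] \<epsilon>(1) that]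
      by simp
    have Q: "causal_L1 (lconv b' P)" by (rule causal_L1_lconv[OF b' P])
    have Q0: "lconv b' P r = 0" if "\<epsilon> < r" "r < T" for r
    proof -
      have "lconv b' P r = (1 / \<epsilon> / \<epsilon>) * lconv (\<lambda>s. \<rho>' (s / \<epsilon>)) P r"
        by (simp add: lconv_def b'_def flip: integral_mult_right_zero)
      then show ?thesis using deriv0[OF \<epsilon>(1) that] by simp
    qed
    \<comment> \<open>The right-hand side does not depend on \<open>r\<close>.\<close>
    have rep: "lconv (b \<epsilon>) P r = (LBINT s. indicator {..<\<epsilon>} s * lconv b' P s)" if r: "\<epsilon> < r" "r < T" for r
    proof -
      have "lconv (b \<epsilon>) P r = lconv (lconv (indicator {0<..<T}) b') P r"
        using r prim by (intro lconv_eq_upto_pointwise[of T] b_props(1) \<epsilon> P causal_L1_lconv causal_L1_indicator b')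
         (auto simp: eq_upto_def)
      also have "\<dots> = lconv (indicator {0<..<T}) (lconv b' P) r"
        by (rule lconv_assoc_bounded[where C=1, symmetric]) (use b' P in \<open>auto simp: causal_L1D indicator_def\<close>)
      also have "\<dots> = (LBINT s. indicator {..<r} s * lconv b' P s)"
        using r by (intro lconv_indicator Q) auto
      also have "\<dots> = (LBINT s. indicator {..<\<epsilon>} s * lconv b' P s)"
      proof (rule integral_cong_AE)
        show "AE s in lborel. indicator {..<r} s * lconv b' P s = indicator {..<\<epsilon>} s * lconv b' P s"
          using AE_lborel_singleton[of \<epsilon>] by eventually_elim (use r Q0 in \<open>auto simp: indicator_def\<close>)
      qed (use causal_L1D(2)[OF Q] in measurable)
      finally show ?thesis .
    qed
    obtain r where r: "\<epsilon> < r" "r < d" "r < T" using dense[of \<epsilon> "min d T"] \<epsilon> by auto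
    have "lconv (b \<epsilon>) P t = lconv (b \<epsilon>) P r" using rep r t False by simp
    then show ?thesis using small[OF \<epsilon>(1) _ d e, of r] r by simp
  qed
  define \<epsilon> where "\<epsilon> n = 1 / real (Suc n)" for n
  have \<epsilon>: "\<epsilon> \<longlonglongrightarrow> 0" "0 < \<epsilon> n" for n unfolding \<epsilon>_def using LIMSEQ_inverse_real_of_nat by (auto simp: inverse_eq_divide)
  have lim: "(\<lambda>n. \<integral>\<^sup>+t. ennreal \<bar>lconv (b (\<epsilon> n)) P t - P t\<bar> \<partial>lborel) \<longlonglongrightarrow> 0"
  proof -
    have "(\<lambda>n. \<integral>\<^sup>+z. ennreal (\<bar>\<integral>a. \<rho> a * (P (z - (\<epsilon> n * a) *\<^sub>R 1) - P z) \<partial>lborel\<bar> ^ 1) \<partial>lborel) \<longlonglongrightarrow> 0"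
      using \<rho> P \<epsilon>(1) by (intro mollification_converges) (auto dest: causal_L1D)
    moreover have "lconv (b (\<epsilon> n)) P t - P t = (LBINT a. \<rho> a * (P (t - (\<epsilon> n * a) *\<^sub>R 1) - P t))" for n t
      using mollification_eq[OF \<rho>(1,3,4) \<epsilon>(2) causal_L1D(1)[OF P]] by (simp add: b_def[abs_def])
    ultimately show ?thesis by simp
  qed
  have le: "(\<integral>\<^sup>+t. ennreal (indicator {0<..<T} t * \<bar>P t\<bar>) \<partial>lborel) \<le> ennreal (T * e)" if e: "0 < e" for e
  proof -
    obtain d where d: "0 < d" "AE t in lborel. 0 < t \<and> t < d \<longrightarrow> \<bar>P t\<bar> \<le> e" using init[OF e] by blast
    have ev: "eventually (\<lambda>n. \<epsilon> n < min d T) sequentially"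
      using \<epsilon>(1) d(1) T by (intro order_tendstoD(2)[of _ 0]) auto
    have lim': "(\<lambda>n. (\<integral>\<^sup>+t. ennreal \<bar>lconv (b (\<epsilon> n)) P t - P t\<bar> \<partial>lborel) + ennreal (T * e)) \<longlonglongrightarrow> 0 + ennreal (T * e)"
      by (intro tendsto_add lim tendsto_const)
    have "(\<integral>\<^sup>+t. ennreal (indicator {0<..<T} t * \<bar>P t\<bar>) \<partial>lborel) \<le> 0 + ennreal (T * e)"
    proof (rule tendsto_lowerbound[OF lim' _ sequentially_bot])
      show "\<forall>\<^sub>F n in sequentially. (\<integral>\<^sup>+t. ennreal (indicator {0<..<T} t * \<bar>P t\<bar>) \<partial>lborel)
          \<le> (\<integral>\<^sup>+t. ennreal \<bar>lconv (b (\<epsilon> n)) P t - P t\<bar> \<partial>lborel) + ennreal (T * e)"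
        using ev
      proof eventually_elim
        case (elim n)
        have [measurable]: "lconv (b (\<epsilon> n)) P \<in> borel_measurable borel"
          by (intro lconv_measurable causal_L1D(2)[OF b_props(1)] \<epsilon> causal_L1D(2)[OF P])
        have "(\<integral>\<^sup>+t. ennreal (indicator {0<..<T} t * \<bar>P t\<bar>) \<partial>lborel)
            \<le> (\<integral>\<^sup>+t. ennreal \<bar>lconv (b (\<epsilon> n)) P t - P t\<bar> + ennreal (e * indicator {0<..<T} t) \<partial>lborel)"
        proof (rule nn_integral_mono)
          fix t
          have "indicator {0<..<T} t * \<bar>P t\<bar> \<le> \<bar>lconv (b (\<epsilon> n)) P t - P t\<bar> + e * indicator {0<..<T} t"
            using bound[OF \<epsilon>(2)[of n] _ _ _ d(2) e, of t] elim by (cases "t \<in> {0<..<T}") (auto simp: indicator_def)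
          then have "ennreal (indicator {0<..<T} t * \<bar>P t\<bar>) \<le> ennreal (\<bar>lconv (b (\<epsilon> n)) P t - P t\<bar> + e * indicator {0<..<T} t)"
            by (rule ennreal_leI)
          also have "\<dots> = ennreal \<bar>lconv (b (\<epsilon> n)) P t - P t\<bar> + ennreal (e * indicator {0<..<T} t)"
            using e by (intro ennreal_plus) auto
          finally show "ennreal (indicator {0<..<T} t * \<bar>P t\<bar>) \<le> ennreal \<bar>lconv (b (\<epsilon> n)) P t - P t\<bar> + ennreal (e * indicator {0<..<T} t)" .
        qed
        also have "\<dots> = (\<integral>\<^sup>+t. ennreal \<bar>lconv (b (\<epsilon> n)) P t - P t\<bar> \<partial>lborel) + (\<integral>\<^sup>+t. ennreal (e * indicator {0<..<T} t) \<partial>lborel)"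
          by (rule nn_integral_add) auto
        also have "(\<integral>\<^sup>+t. ennreal (e * indicator {0<..<T} t) \<partial>lborel) = ennreal (T * e)"
          using e T by (simp add: ennreal_mult nn_integral_cmult ennreal_indicator mult.commute)
        finally show ?case .
      qed
    qed
    then show ?thesis by simp
  qed
  have "(\<integral>\<^sup>+t. ennreal (indicator {0<..<T} t * \<bar>P t\<bar>) \<partial>lborel) = 0"
  proof (rule antisym)
    show "(\<integral>\<^sup>+t. ennreal (indicator {0<..<T} t * \<bar>P t\<bar>) \<partial>lborel) \<le> 0"
    proof (rule ennreal_le_epsilon)
      fix e :: real assume "0 < e"
      then show "(\<integral>\<^sup>+t. ennreal (indicator {0<..<T} t * \<bar>P t\<bar>) \<partial>lborel) \<le> 0 + ennreal e"
        using le[of "e / T"] T by simp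
    qed
  qed simp
  then have "AE t in lborel. ennreal (indicator {0<..<T} t * \<bar>P t\<bar>) = 0"
    by (subst (asm) nn_integral_0_iff_AE) auto
  then show ?thesis unfolding eq_upto_def
    by eventually_elim (use causal_L1D(3)[OF P] in \<open>force simp: indicator_def\<close>)
qed

lemma lconv_add_eq_upto:
  assumes "causal_L1 f" "causal_L1 g" "causal_L1 g'"
  shows "eq_upto T (lconv f (\<lambda>t. g t + g' t)) (\<lambda>t. lconv f g t + lconv f g' t)"
  using lconv_AE_integrable[OF causal_L1D(1)[OF assms(1)] causal_L1D(1)[OF assms(2)]]
    lconv_AE_integrable[OF causal_L1D(1)[OF assms(1)] causal_L1D(1)[OF assms(3)]]
  unfolding eq_upto_def by eventually_elim (simp add: lconv_add_right)

lemma eq_upto_add: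
  "eq_upto T f f' \<Longrightarrow> eq_upto T g g' \<Longrightarrow> eq_upto T (\<lambda>t. f t + g t) (\<lambda>t. f' t + g' t)"
  unfolding eq_upto_def by (rule eventually_elim2) auto

lemma causal_L1_zero: "causal_L1 (\<lambda>_. 0)"
  by (simp add: causal_L1_def)

lemma lconv_zero: "lconv f (\<lambda>_. 0) = (\<lambda>_. 0)"
  by (rule ext) (simp add: lconv_def)

text \<open>Put \<open>z = 1 * U + 1 * l * G\<close>.  Convolving the hypothesis with \<open>l\<close> gives \<open>h * z = 0\<close>, since
  \<open>l * k = 1\<close>; then \<open>l * z = h * z + l * h * z = 0\<close>, and \<open>1 * z = k * l * z = 0\<close>.  A bump function is a
  twofold primitive \<open>1 * 1 * b2\<close> of a bounded function \<open>b2\<close>, so convolving \<open>1 * z = 0\<close> with \<open>b2\<close> gives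
  the claim, at every \<open>t < T\<close> because convolution with a bounded function is defined everywhere.\<close>

proposition smoothed_volterra_identity:
  assumes k: "causal_L1 k" and l: "causal_L1 l" and h: "causal_L1 h"
    and kl: "eq_upto T (lconv k l) (indicator {0<..<T})" and hl: "eq_upto T (\<lambda>t. h t + lconv h l t) l"
    and U: "causal_L1 U" and G: "causal_L1 G"
    and P: "eq_upto T (\<lambda>t. lconv h (lconv k U) t + lconv (indicator {0<..<T}) (lconv h G) t) (\<lambda>_. 0)"
    and f: "f \<in> bumps" and \<epsilon>: "0 < \<epsilon>" and t: "t < T"
  shows "lconv (\<lambda>s. f (s / \<epsilon>)) U t + lconv (lconv l (\<lambda>s. f (s / \<epsilon>))) G t = 0"
proof -
  define one :: "real \<Rightarrow> real" where "one = indicator {0<..<T}"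
  have one: "causal_L1 one" unfolding one_def by (rule causal_L1_indicator)
  note kl = kl[folded one_def] and P = P[folded one_def]
  define z where "z t = lconv one U t + lconv one (lconv l G) t" for t
  have z: "causal_L1 z" unfolding z_def[abs_def] by (intro causal_L1_add causal_L1_lconv one l U G)
  note c = causal_L1_lconv causal_L1_add k l h U G one z causal_L1_zero
  have comm: "lconv x y = lconv y x" for x y :: "real \<Rightarrow> real"
    by (rule ext) (rule lconv_commute)
  have hz: "eq_upto T (lconv h z) (\<lambda>_. 0)"
  proof -
    have "eq_upto T (lconv h z) (\<lambda>t. lconv h (lconv one U) t + lconv h (lconv one (lconv l G)) t)"
      unfolding z_def[abs_def] by (intro lconv_add_eq_upto c)
    also have "eq_upto T \<dots> (\<lambda>t. lconv l (lconv h (lconv k U)) t + lconv l (lconv one (lconv h G)) t)"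
    proof (rule eq_upto_add)
      have "eq_upto T (lconv l (lconv h (lconv k U))) (lconv h (lconv l (lconv k U)))"
        by (intro lconv_left_commute_eq_upto c)
      also have "eq_upto T \<dots> (lconv h (lconv k (lconv l U)))"
        by (intro lconv_eq_upto eq_upto_refl lconv_left_commute_eq_upto c)
      also have "eq_upto T \<dots> (lconv h (lconv (lconv k l) U))"
        by (intro lconv_eq_upto eq_upto_refl lconv_assoc_eq_upto c)
      also have "eq_upto T \<dots> (lconv h (lconv one U))"
        by (intro lconv_eq_upto eq_upto_refl kl c)
      finally show "eq_upto T (lconv h (lconv one U)) (lconv l (lconv h (lconv k U)))" by (rule eq_upto_sym)
      have "eq_upto T (lconv l (lconv one (lconv h G))) (lconv one (lconv l (lconv h G)))"
        by (intro lconv_left_commute_eq_upto c)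
      also have "eq_upto T \<dots> (lconv one (lconv h (lconv l G)))"
        by (intro lconv_eq_upto eq_upto_refl lconv_left_commute_eq_upto c)
      also have "eq_upto T \<dots> (lconv h (lconv one (lconv l G)))"
        by (intro lconv_left_commute_eq_upto c)
      finally show "eq_upto T (lconv h (lconv one (lconv l G))) (lconv l (lconv one (lconv h G)))" by (rule eq_upto_sym)
    qed
    also have "eq_upto T \<dots> (lconv l (\<lambda>t. lconv h (lconv k U) t + lconv one (lconv h G) t))"
      by (rule eq_upto_sym) (intro lconv_add_eq_upto c)
    also have "eq_upto T \<dots> (lconv l (\<lambda>_. 0))"
      by (intro lconv_eq_upto eq_upto_refl P c)
    finally show ?thesis by (simp only: lconv_zero)
  qed
  have lz: "eq_upto T (lconv l z) (\<lambda>_. 0)"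
  proof -
    have "eq_upto T (lconv l z) (lconv z (\<lambda>t. h t + lconv h l t))"
      unfolding comm[of l z]
      by (intro lconv_eq_upto eq_upto_refl eq_upto_sym[OF hl] c)
    also have "eq_upto T \<dots> (\<lambda>t. lconv z h t + lconv z (lconv h l) t)"
      by (intro lconv_add_eq_upto c)
    also have "eq_upto T \<dots> (\<lambda>t. lconv h z t + lconv l (lconv h z) t)"
    proof (rule eq_upto_add)
      show "eq_upto T (lconv z h) (lconv h z)" unfolding comm[of z h] by (rule eq_upto_refl)
      have "eq_upto T (lconv z (lconv h l)) (lconv h (lconv z l))"
        by (intro lconv_left_commute_eq_upto c)
      also have "lconv z l = lconv l z" by (rule comm)
      also have "eq_upto T (lconv h (lconv l z)) (lconv l (lconv h z))"
        by (intro lconv_left_commute_eq_upto c)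
      finally show "eq_upto T (lconv z (lconv h l)) (lconv l (lconv h z))" .
    qed
    also have "eq_upto T \<dots> (\<lambda>t. 0 + lconv l (\<lambda>_. 0) t)"
      by (intro eq_upto_add hz lconv_eq_upto eq_upto_refl c)
    finally show ?thesis by (simp add: lconv_zero)
  qed
  have onez: "eq_upto T (lconv one z) (\<lambda>_. 0)"
  proof -
    have "eq_upto T (lconv one z) (lconv (lconv k l) z)"
      by (intro lconv_eq_upto eq_upto_refl eq_upto_sym[OF kl] c)
    also have "eq_upto T \<dots> (lconv k (lconv l z))"
      by (intro eq_upto_sym[OF lconv_assoc_eq_upto] c)
    also have "eq_upto T \<dots> (lconv k (\<lambda>_. 0))"
      by (intro lconv_eq_upto eq_upto_refl lz c)
    finally show ?thesis by (simp only: lconv_zero)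
  qed
  obtain f1 where f1: "f1 \<in> bumps" "\<And>x. (f has_real_derivative f1 x) (at x)"
    using bumps_derivative[OF f] by blast
  obtain f2 where f2: "f2 \<in> bumps" "\<And>x. (f1 has_real_derivative f2 x) (at x)"
    using bumps_derivative[OF f1(1)] by blast
  define b where "b s = f (s / \<epsilon>)" for s
  define b1 where "b1 s = f1 (s / \<epsilon>) / \<epsilon>" for s
  define b2 where "b2 s = (1 / \<epsilon> * f2 (s / \<epsilon>)) / \<epsilon>" for s
  have f1s: "(\<lambda>x. 1 / \<epsilon> * f1 x) \<in> bumps" and f2s: "(\<lambda>x. 1 / \<epsilon> * (1 / \<epsilon> * f2 x)) \<in> bumps"
    by (intro bumps.scale f1 f2)+
  have b: "causal_L1 b" "causal_L1 b1" "causal_L1 b2"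
    using bump_scaled(1)[OF f \<epsilon>] bump_scaled(1)[OF f1s \<epsilon>] bump_scaled(1)[OF f2s \<epsilon>]
    by (simp_all add: b_def[abs_def] b1_def[abs_def] b2_def[abs_def] mult.commute)
  obtain C1 C2 where "\<And>x. \<bar>1 / \<epsilon> * f1 x\<bar> \<le> C1" "\<And>x. \<bar>1 / \<epsilon> * (1 / \<epsilon> * f2 x)\<bar> \<le> C2"
    using bumps_bounded[OF f1s] bumps_bounded[OF f2s] by metis
  then have C: "\<And>s. \<bar>b1 s\<bar> \<le> C1" "\<And>s. \<bar>b2 s\<bar> \<le> C2" by (simp_all add: b1_def b2_def mult.commute)
  have prim1: "eq_upto T (lconv one b1) b"
    using bump_scaled_primitive[OF f f1 \<epsilon>, of _ T] by (simp add: eq_upto_def one_def b_def b1_def[abs_def])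
  have prim2: "eq_upto T (lconv one b2) b1"
    using bump_scaled_primitive[OF bumps.scale[OF f1(1), of "1 / \<epsilon>"] bumps.scale[OF f2(1), of "1 / \<epsilon>"] DERIV_cmult[OF f2(2)] \<epsilon>, of _ T]
    by (simp add: eq_upto_def one_def b1_def[abs_def] b2_def[abs_def])
  note c = c b
  have b1_prim: "lconv b1 (lconv one X) t = lconv b X t" if X: "causal_L1 X" for X
  proof -
    have "lconv b1 (lconv one X) t = lconv (lconv b1 one) X t"
      by (rule lconv_assoc_bounded[OF _ C(1)]) (use X one b in \<open>auto dest: causal_L1D\<close>)
    also have "lconv b1 one = lconv one b1" by (rule comm)
    also have "lconv (lconv one b1) X t = lconv b X t"
      using t by (intro lconv_eq_upto_pointwise[of T] prim1 eq_upto_refl c X) auto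
    finally show ?thesis .
  qed
  have int1: "integrable lborel (\<lambda>s. b1 (t - s) *\<^sub>R Y s)" if "causal_L1 Y" for Y
    by (rule lconv_bounded_integrable[OF _ C(1)]) (use that b in \<open>auto dest: causal_L1D\<close>)
  have "0 = lconv b2 (\<lambda>_. 0) t" by (simp add: lconv_zero)
  also have "\<dots> = lconv b2 (lconv one z) t"
    using t by (intro lconv_eq_upto_pointwise[of T] eq_upto_sym[OF onez] eq_upto_refl c) auto
  also have "\<dots> = lconv (lconv b2 one) z t"
    by (rule lconv_assoc_bounded[OF _ C(2)]) (use z one b in \<open>auto dest: causal_L1D\<close>)
  also have "lconv b2 one = lconv one b2" by (rule comm)
  also have "lconv (lconv one b2) z t = lconv b1 z t"
    using t by (intro lconv_eq_upto_pointwise[of T] prim2 eq_upto_refl c) auto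
  also have "\<dots> = lconv b1 (lconv one U) t + lconv b1 (lconv one (lconv l G)) t"
    unfolding z_def[abs_def] by (intro lconv_add_right int1 c)
  also have "\<dots> = lconv b U t + lconv b (lconv l G) t"
    by (simp add: b1_prim c)
  also have "lconv b (lconv l G) t = lconv (lconv b l) G t"
  proof -
    obtain C0 where "\<And>x. \<bar>f x\<bar> \<le> C0" using bumps_bounded[OF f] by metis
    then have "\<And>s. \<bar>b s\<bar> \<le> C0" by (simp add: b_def)
    then show ?thesis
      by (intro lconv_assoc_bounded) (use l G b in \<open>auto dest: causal_L1D\<close>)
  qed
  also have "lconv b l = lconv l b" by (rule comm)
  finally show ?thesis by (simp add: b_def[abs_def])
qed


section \<open>Square-integrable functions on space-time\<close>

text \<open>The null set need not be measurable as given, so it is first enlarged to a measurable one.\<close>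

lemma AE_pair_commute:
  fixes P :: "'c::euclidean_space \<times> 'd::euclidean_space \<Rightarrow> bool"
  assumes "AE z in lborel2. P z"
  shows "AE y in lborel. AE x in lborel. P (x, y)"
proof -
  obtain N where N: "{z \<in> space lborel2. \<not> P z} \<subseteq> N" "emeasure lborel2 N = 0" "N \<in> sets lborel2"
    using assms by (rule AE_E)
  have "AE z in lborel2. z \<notin> N" using N by (intro AE_not_in) (simp add: null_sets_def)
  from lborel_pair.AE_pair[OF this] have "AE x in lborel. AE y in lborel. (x, y) \<notin> N" .
  moreover have "{z \<in> space lborel2. (fst z, snd z) \<notin> N} \<in> sets lborel2"
  proof -
    have "{z \<in> space lborel2. (fst z, snd z) \<notin> N} = space lborel2 - N" by auto
    then show ?thesis using sets.compl_sets[OF N(3)] by simp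
  qed
  ultimately have "AE y in lborel. AE x in lborel. (x, y) \<notin> N"
    using lborel_pair.AE_commute[of "\<lambda>x y. (x, y) \<notin> N"] by simp
  then show ?thesis
  proof eventually_elim
    case (elim y)
    then show ?case by eventually_elim (use N(1) in \<open>auto simp: space_pair_measure\<close>)
  qed
qed

lemma Cauchy_Schwarz_integral:
  fixes f g :: "'n \<Rightarrow> real"
  assumes [measurable]: "f \<in> borel_measurable M" "g \<in> borel_measurable M"
    and f: "integrable M (\<lambda>x. (f x)\<^sup>2)" and g: "integrable M (\<lambda>x. (g x)\<^sup>2)"
  shows "\<bar>\<integral>x. f x * g x \<partial>M\<bar> \<le> sqrt (\<integral>x. (f x)\<^sup>2 \<partial>M) * sqrt (\<integral>x. (g x)\<^sup>2 \<partial>M)"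
proof (cases "integrable M (\<lambda>x. f x * g x)")
  case True
  have "(ennreal \<bar>\<integral>x. f x * g x \<partial>M\<bar>)\<^sup>2 \<le> (\<integral>\<^sup>+x. ennreal \<bar>f x\<bar> * ennreal \<bar>g x\<bar> \<partial>M)\<^sup>2"
    using integral_norm_bound_ennreal[OF True]
    by (intro power_mono) (simp_all add: abs_mult ennreal_mult)
  also have "\<dots> \<le> (\<integral>\<^sup>+x. (ennreal \<bar>f x\<bar>)\<^sup>2 \<partial>M) * (\<integral>\<^sup>+x. (ennreal \<bar>g x\<bar>)\<^sup>2 \<partial>M)"
    by (rule Cauchy_Schwarz_nn_integral) measurable
  also have "\<dots> = ennreal ((\<integral>x. (f x)\<^sup>2 \<partial>M) * (\<integral>x. (g x)\<^sup>2 \<partial>M))"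
    using nn_integral_eq_integral[OF f] nn_integral_eq_integral[OF g]
    by (simp add: ennreal_power ennreal_mult Bochner_Integration.integral_nonneg)
  finally have "\<bar>\<integral>x. f x * g x \<partial>M\<bar>\<^sup>2 \<le> (\<integral>x. (f x)\<^sup>2 \<partial>M) * (\<integral>x. (g x)\<^sup>2 \<partial>M)"
    by (simp add: ennreal_power Bochner_Integration.integral_nonneg)
  then have "\<bar>\<integral>x. f x * g x \<partial>M\<bar> \<le> sqrt ((\<integral>x. (f x)\<^sup>2 \<partial>M) * (\<integral>x. (g x)\<^sup>2 \<partial>M))"
    by (rule real_le_rsqrt)
  then show ?thesis by (simp add: real_sqrt_mult)
qed (simp add: not_integrable_integral_eq)

text \<open>Borel measurability and the vanishing outside \<open>\<Omega>\<close> are included: such functions represent classes in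
  \<open>L2 \<Omega>\<close> and may be integrated over the whole space.\<close>

definition L2_space :: "'a::euclidean_space set \<Rightarrow> ('a \<Rightarrow> 'b::euclidean_space) \<Rightarrow> bool" where
  "L2_space \<Omega> \<psi> \<longleftrightarrow> \<psi> \<in> borel_measurable borel \<and> (\<forall>x. x \<notin> \<Omega> \<longrightarrow> \<psi> x = 0) \<and>
     integrable lborel (\<lambda>x. (norm (\<psi> x))\<^sup>2)"

definition L2_spacetime :: "real \<Rightarrow> 'a::euclidean_space set \<Rightarrow> (real \<Rightarrow> 'a \<Rightarrow> 'b::euclidean_space) \<Rightarrow> bool" where
  "L2_spacetime T \<Omega> H \<longleftrightarrow> (\<lambda>(t, x). H t x) \<in> borel_measurable lborel2 \<and>
     (\<forall>t x. \<not> (0 < t \<and> t < T \<and> x \<in> \<Omega>) \<longrightarrow> H t x = 0) \<and>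
     integrable lborel2 (\<lambda>(t, x). (norm (H t x))\<^sup>2)"

lemma L2_space_representative:
  assumes w: "w \<in> L2 \<Omega>" and \<Omega>: "\<Omega> \<in> sets borel"
  obtains w' where "L2_space \<Omega> w'" "AE x in lborel. x \<in> \<Omega> \<longrightarrow> w x = w' x"
proof -
  obtain w' where w': "w' \<in> borel_measurable borel" "AE z in lborel. z \<in> \<Omega> \<longrightarrow> w z = w' z" "\<And>z. z \<notin> \<Omega> \<Longrightarrow> w' z = 0"
    using borel_representative[of w \<Omega>] w \<Omega> unfolding L2_def by blast
  have ae: "AE z in lborel. z \<in> \<Omega> \<longrightarrow> (norm (w z))\<^sup>2 = (norm (w' z))\<^sup>2"
    using w'(2) by eventually_elim simp
  have "integrable lborel (\<lambda>z. (norm (w' z))\<^sup>2)"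
    using lebesgue_on_integral_eq_lborel(2)[OF _ \<Omega> ae] w w' by (simp add: L2_def)
  then show thesis using w' by (intro that[of w']) (auto simp: L2_space_def)
qed

lemma L2_spacetime_representative:
  assumes w: "(\<lambda>(t, x). w t x) \<in> L2 ({0<..<T} \<times> \<Omega>)" and \<Omega>: "open \<Omega>"
  obtains H where "L2_spacetime T \<Omega> H" "AE (t, x) in lborel2. 0 < t \<and> t < T \<and> x \<in> \<Omega> \<longrightarrow> w t x = H t x"
proof -
  have S: "{0<..<T} \<times> \<Omega> \<in> sets borel" using \<Omega> by (intro borel_open open_Times) auto
  obtain w' where w': "L2_space ({0<..<T} \<times> \<Omega>) w'" "AE z in lborel. z \<in> {0<..<T} \<times> \<Omega> \<longrightarrow> (\<lambda>(t, x). w t x) z = w' z"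
    using L2_space_representative[OF w S] .
  show thesis
  proof (rule that[of "\<lambda>t x. w' (t, x)"])
    show "L2_spacetime T \<Omega> (\<lambda>t x. w' (t, x))"
      using w'(1) unfolding L2_space_def L2_spacetime_def lborel_prod by (auto simp: case_prod_unfold)
    show "AE (t, x) in lborel2. 0 < t \<and> t < T \<and> x \<in> \<Omega> \<longrightarrow> w t x = w' (t, x)"
      using w'(2) unfolding lborel_prod by eventually_elim auto
  qed
qed

lemma L2_spaceD:
  assumes "L2_space \<Omega> \<psi>"
  shows "\<psi> \<in> borel_measurable borel" "x \<notin> \<Omega> \<Longrightarrow> \<psi> x = 0" "integrable lborel (\<lambda>x. (norm (\<psi> x))\<^sup>2)"
  using assms by (auto simp: L2_space_def)

lemma L2_spacetimeD:
  assumes "L2_spacetime T \<Omega> H"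
  shows "(\<lambda>(t, x). H t x) \<in> borel_measurable lborel2" "\<not> (0 < t \<and> t < T \<and> x \<in> \<Omega>) \<Longrightarrow> H t x = 0"
    "integrable lborel2 (\<lambda>(t, x). (norm (H t x))\<^sup>2)"
  using assms by (auto simp: L2_spacetime_def)

lemma L2_spacetime_slice_measurable:
  assumes "L2_spacetime T \<Omega> H"
  shows "H t \<in> borel_measurable borel" "(\<lambda>t. H t x) \<in> borel_measurable borel"
  using measurable_Pair2[OF L2_spacetimeD(1)[OF assms], of t] measurable_Pair1[OF L2_spacetimeD(1)[OF assms], of x] by simp_all

lemma norm_diff_sq_le: "(norm (a - b))\<^sup>2 \<le> 2 * (norm a)\<^sup>2 + 2 * (norm (b :: 'b::real_normed_vector))\<^sup>2"
proof -
  have "(norm (a - b))\<^sup>2 \<le> (norm a + norm b)\<^sup>2" by (intro power_mono norm_triangle_ineq4) simp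
  also have "\<dots> \<le> 2 * (norm a)\<^sup>2 + 2 * (norm b)\<^sup>2" using sum_squares_bound[of "norm a" "norm b"] by (simp add: power2_sum)
  finally show ?thesis .
qed

lemma abs_inner_le: "\<bar>a \<bullet> b\<bar> \<le> (norm a)\<^sup>2 + (norm (b :: 'b::real_inner))\<^sup>2"
proof -
  have "\<bar>a \<bullet> b\<bar> \<le> norm a * norm b" by (rule Cauchy_Schwarz_ineq2)
  also have "\<dots> \<le> (norm a)\<^sup>2 + (norm b)\<^sup>2"
    using sum_squares_bound[of "norm a" "norm b"] mult_nonneg_nonneg[OF norm_ge_zero norm_ge_zero, of a b] by linarith
  finally show ?thesis .
qed

lemma L2_space_diff: "L2_space \<Omega> \<psi> \<Longrightarrow> L2_space \<Omega> \<psi>' \<Longrightarrow> L2_space \<Omega> (\<lambda>x. \<psi> x - \<psi>' x)"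
proof -
  assume \<psi>: "L2_space \<Omega> \<psi>" "L2_space \<Omega> \<psi>'"
  note [measurable] = L2_spaceD(1)[OF \<psi>(1)] L2_spaceD(1)[OF \<psi>(2)]
  have "integrable lborel (\<lambda>x. (norm (\<psi> x - \<psi>' x))\<^sup>2)"
  proof (rule Bochner_Integration.integrable_bound)
    show "integrable lborel (\<lambda>x. 2 * (norm (\<psi> x))\<^sup>2 + 2 * (norm (\<psi>' x))\<^sup>2)"
      using L2_spaceD(3)[OF \<psi>(1)] L2_spaceD(3)[OF \<psi>(2)] by auto
    show "AE x in lborel. norm ((norm (\<psi> x - \<psi>' x))\<^sup>2) \<le> norm (2 * (norm (\<psi> x))\<^sup>2 + 2 * (norm (\<psi>' x))\<^sup>2)"
      using norm_diff_sq_le by (intro AE_I2) auto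
  qed measurable
  then show ?thesis using \<psi> by (auto simp: L2_space_def)
qed

lemma L2_spacetime_diff:
  assumes H: "L2_spacetime T \<Omega> H" and H': "L2_spacetime T \<Omega> H'"
  shows "L2_spacetime T \<Omega> (\<lambda>t x. H t x - H' t x)"
proof -
  note [measurable] = L2_spacetimeD(1)[OF H] L2_spacetimeD(1)[OF H']
  have "integrable lborel2 (\<lambda>(t, x). (norm (H t x - H' t x))\<^sup>2)"
  proof (rule Bochner_Integration.integrable_bound)
    show "integrable lborel2 (\<lambda>z. 2 * (case z of (t, x) \<Rightarrow> (norm (H t x))\<^sup>2) + 2 * (case z of (t, x) \<Rightarrow> (norm (H' t x))\<^sup>2))"
      using L2_spacetimeD(3)[OF H] L2_spacetimeD(3)[OF H'] by auto
    show "AE z in lborel2. norm (case z of (t, x) \<Rightarrow> (norm (H t x - H' t x))\<^sup>2)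
        \<le> norm (2 * (case z of (t, x) \<Rightarrow> (norm (H t x))\<^sup>2) + 2 * (case z of (t, x) \<Rightarrow> (norm (H' t x))\<^sup>2))"
      using norm_diff_sq_le by (intro AE_I2) (auto simp: order_trans[OF norm_diff_sq_le])
  qed measurable
  moreover have "(\<lambda>(t, x). H t x - H' t x) \<in> borel_measurable lborel2" by measurable
  ultimately show ?thesis using L2_spacetimeD(2)[OF H] L2_spacetimeD(2)[OF H'] by (auto simp: L2_spacetime_def)
qed

lemma integrable_time_constant:
  fixes N :: "'a::euclidean_space \<Rightarrow> real" and T :: real
  assumes N: "integrable lborel N"
  shows "integrable lborel2 (\<lambda>(t, x). indicator {0<..<T} t * N x)"
proof (rule lborel_pair.Fubini_integrable)
  have [measurable]: "N \<in> borel_measurable borel" using borel_measurable_integrable[OF N] by simp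
  show "(\<lambda>(t, x). indicator {0<..<T} t * N x) \<in> borel_measurable lborel2" by measurable
  have "(LBINT x. norm (case (t, x) of (t, x) \<Rightarrow> indicator {0<..<T} t * N x))
      = indicator {0<..<T} t * (LBINT x. \<bar>N x\<bar>)" for t
    by (simp add: abs_mult)
  then show "integrable lborel (\<lambda>t. \<integral>x. norm (case (t, x) of (t, x) \<Rightarrow> indicator {0<..<T} t * N x) \<partial>lborel)"
    using causal_L1D(1)[OF causal_L1_indicator[of T]] by simp
  show "AE t in lborel. integrable lborel (\<lambda>x. case (t, x) of (t, x) \<Rightarrow> indicator {0<..<T} t * N x)"
    using N by simp
qed

lemma L2_spacetime_const:
  assumes \<psi>: "L2_space \<Omega> \<psi>"
  shows "L2_spacetime T \<Omega> (\<lambda>t x. indicator {0<..<T} t *\<^sub>R \<psi> x)"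
proof -
  note [measurable] = L2_spaceD(1)[OF \<psi>]
  have "(norm (indicator {0<..<T} t *\<^sub>R \<psi> x))\<^sup>2 = indicator {0<..<T} t * (norm (\<psi> x))\<^sup>2" for t x
    by (auto simp: indicator_def)
  then have "integrable lborel2 (\<lambda>(t, x). (norm (indicator {0<..<T} t *\<^sub>R \<psi> x))\<^sup>2)"
    using integrable_time_constant[OF L2_spaceD(3)[OF \<psi>], of T] by simp
  moreover have "(\<lambda>(t, x). indicator {0<..<T} t *\<^sub>R \<psi> x) \<in> borel_measurable lborel2" by measurable
  ultimately show ?thesis using L2_spaceD(2)[OF \<psi>] by (auto simp: L2_spacetime_def)
qed

lemma L2_spacetime_inner_integrable:
  assumes H: "L2_spacetime T \<Omega> H" and H': "L2_spacetime T \<Omega> H'"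
  shows "integrable lborel2 (\<lambda>(t, x). H t x \<bullet> H' t x)"
proof (rule Bochner_Integration.integrable_bound)
  note [measurable] = L2_spacetimeD(1)[OF H] L2_spacetimeD(1)[OF H']
  show "(\<lambda>(t, x). H t x \<bullet> H' t x) \<in> borel_measurable lborel2" by measurable
  show "integrable lborel2 (\<lambda>z. (case z of (t, x) \<Rightarrow> (norm (H t x))\<^sup>2) + (case z of (t, x) \<Rightarrow> (norm (H' t x))\<^sup>2))"
    using L2_spacetimeD(3)[OF H] L2_spacetimeD(3)[OF H'] by auto
  show "AE z in lborel2. norm (case z of (t, x) \<Rightarrow> H t x \<bullet> H' t x)
      \<le> norm ((case z of (t, x) \<Rightarrow> (norm (H t x))\<^sup>2) + (case z of (t, x) \<Rightarrow> (norm (H' t x))\<^sup>2))"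
    by (intro AE_I2) (auto simp: order_trans[OF abs_inner_le])
qed

lemma L2_spacetime_pairing_integrable:
  assumes H: "L2_spacetime T \<Omega> H" and \<psi>: "L2_space \<Omega> \<psi>"
  shows "integrable lborel2 (\<lambda>(t, x). H t x \<bullet> \<psi> x)"
proof -
  have e: "H t x \<bullet> (indicator {0<..<T} t *\<^sub>R \<psi> x) = H t x \<bullet> \<psi> x" for t x
    using L2_spacetimeD(2)[OF H, of t x] by (cases "0 < t \<and> t < T") auto
  show ?thesis
    by (rule L2_spacetime_inner_integrable[OF H L2_spacetime_const[OF \<psi>, of T], unfolded e])
qed

text \<open>Here boundedness of \<open>\<Omega>\<close> enters, through \<open>\<bar>x\<bar> \<le> 1 + x\<^sup>2\<close>.\<close>

lemma L2_spacetime_integrable: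
  assumes H: "L2_spacetime T \<Omega> H" and \<Omega>: "open \<Omega>" "bounded \<Omega>"
  shows "integrable lborel2 (\<lambda>(t, x). H t x)"
proof -
  note [measurable] = L2_spacetimeD(1)[OF H]
  have [measurable]: "\<Omega> \<in> sets borel" using \<Omega> by simp
  have "emeasure lborel \<Omega> < \<infinity>" using emeasure_bounded_finite[OF \<Omega>(2)] by simp
  then have "L2_space \<Omega> (indicator \<Omega> :: 'a \<Rightarrow> real)"
  proof -
    have "(norm (indicator \<Omega> x :: real))\<^sup>2 = indicator \<Omega> x" for x by (cases "x \<in> \<Omega>") auto
    with \<open>emeasure lborel \<Omega> < \<infinity>\<close> show ?thesis by (simp add: L2_space_def integrable_indicator_iff)
  qed
  from L2_spacetime_const[OF this, of T]
  have i: "integrable lborel2 (\<lambda>(t, x). (norm (indicator {0<..<T} t *\<^sub>R indicator \<Omega> x :: real))\<^sup>2)"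
    by (rule L2_spacetimeD(3))
  show ?thesis
  proof (rule Bochner_Integration.integrable_bound)
    show "integrable lborel2 (\<lambda>z. (case z of (t, x) \<Rightarrow> (norm (indicator {0<..<T} t *\<^sub>R indicator \<Omega> x :: real))\<^sup>2)
        + (case z of (t, x) \<Rightarrow> (norm (H t x))\<^sup>2))"
      using i L2_spacetimeD(3)[OF H] by (rule Bochner_Integration.integrable_add)
    have e: "a \<le> 1 + a\<^sup>2" for a :: real
      using sum_squares_bound[of a 1] zero_le_power2[of a] unfolding power_one by linarith
    show "AE z in lborel2. norm (case z of (t, x) \<Rightarrow> H t x)
        \<le> norm ((case z of (t, x) \<Rightarrow> (norm (indicator {0<..<T} t *\<^sub>R indicator \<Omega> x :: real))\<^sup>2) + (case z of (t, x) \<Rightarrow> (norm (H t x))\<^sup>2))"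
    proof (rule AE_I2, clarify)
      fix t x
      show "norm (H t x) \<le> norm ((norm (indicator {0<..<T} t *\<^sub>R indicator \<Omega> x :: real))\<^sup>2 + (norm (H t x))\<^sup>2)"
        using e[of "norm (H t x)"] L2_spacetimeD(2)[OF H, of t x] by (cases "0 < t \<and> t < T \<and> x \<in> \<Omega>") auto
    qed
  qed measurable
qed

lemma L2_spacetime_slice:
  assumes H: "L2_spacetime T \<Omega> H"
  shows "AE t in lborel. L2_space \<Omega> (H t)"
  using lborel_pair.AE_integrable_fst[OF L2_spacetimeD(3)[OF H]]
  by eventually_elim (use L2_spacetime_slice_measurable[OF H] L2_spacetimeD(2)[OF H] in \<open>auto simp: L2_space_def\<close>)

definition pairing :: "(real \<Rightarrow> 'a::euclidean_space \<Rightarrow> 'b::euclidean_space) \<Rightarrow> ('a \<Rightarrow> 'b) \<Rightarrow> real \<Rightarrow> real" where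
  "pairing H \<psi> t = (LBINT x. H t x \<bullet> \<psi> x)"

lemma causal_L1_pairing:
  assumes H: "L2_spacetime T \<Omega> H" and \<psi>: "L2_space \<Omega> \<psi>"
  shows "causal_L1 (pairing H \<psi>)"
  unfolding causal_L1_def
proof (intro conjI allI impI)
  show "integrable lborel (pairing H \<psi>)"
    using lborel_pair.integrable_fst[OF L2_spacetime_pairing_integrable[OF assms]] by (simp add: pairing_def[abs_def])
  fix t :: real assume "t \<le> 0"
  then have "(\<lambda>x. H t x \<bullet> \<psi> x) = (\<lambda>x. 0)" using L2_spacetimeD(2)[OF H, of t] by force
  then show "pairing H \<psi> t = 0" unfolding pairing_def by (simp only:) simp
qed

lemma pairing_diff:
  assumes H: "L2_spacetime T \<Omega> H" and H': "L2_spacetime T \<Omega> H'" and \<psi>: "L2_space \<Omega> \<psi>"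
  shows "AE t in lborel. pairing (\<lambda>t x. H t x - H' t x) \<psi> t = pairing H \<psi> t - pairing H' \<psi> t"
  using lborel_pair.AE_integrable_fst[OF L2_spacetime_pairing_integrable[OF H \<psi>]]
    lborel_pair.AE_integrable_fst[OF L2_spacetime_pairing_integrable[OF H' \<psi>]]
  by eventually_elim (simp add: pairing_def inner_diff_left)

text \<open>For an integrable kernel the pairing passes through the convolution at almost every time, for a
  bounded one at every time.\<close>

lemma lconv_pairing_spacetime:
  assumes H: "L2_spacetime T \<Omega> H" and \<psi>: "L2_space \<Omega> \<psi>" and \<Omega>: "open \<Omega>" "bounded \<Omega>"
    and \<kappa>: "integrable lborel \<kappa>"
  shows "AE t in lborel. integrable lborel (\<lambda>x. lconv \<kappa> (\<lambda>s. H s x) t \<bullet> \<psi> x) \<and>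
    (LBINT x. lconv \<kappa> (\<lambda>s. H s x) t \<bullet> \<psi> x) = lconv \<kappa> (pairing H \<psi>) t"
  unfolding pairing_def[abs_def]
  by (rule lconv_pairing_AE[OF \<kappa> L2_spaceD(1)[OF \<psi>] L2_spacetime_integrable[OF H \<Omega>] L2_spacetime_pairing_integrable[OF H \<psi>]])

lemma lconv_pairing_spacetime_bounded:
  assumes H: "L2_spacetime T \<Omega> H" and \<psi>: "L2_space \<Omega> \<psi>" and \<Omega>: "open \<Omega>" "bounded \<Omega>"
    and \<kappa>: "\<kappa> \<in> borel_measurable borel" "\<And>s. \<bar>\<kappa> s\<bar> \<le> C"
  shows "integrable lborel (\<lambda>x. lconv \<kappa> (\<lambda>s. H s x) t \<bullet> \<psi> x)"
    "(LBINT x. lconv \<kappa> (\<lambda>s. H s x) t \<bullet> \<psi> x) = lconv \<kappa> (pairing H \<psi>) t"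
  using lconv_pairing_bounded[OF \<kappa> L2_spaceD(1)[OF \<psi>] L2_spacetime_integrable[OF H \<Omega>] L2_spacetime_pairing_integrable[OF H \<psi>], of t]
  unfolding pairing_def[abs_def] by auto


section \<open>From the weak formulation to scalar equations\<close>

lemma L1_loc_truncation:
  assumes k: "k \<in> L1_loc"
  obtains k' where "causal_L1 k'" "\<And>s. T \<le> s \<Longrightarrow> k' s = 0" "AE s in lborel. 0 < s \<and> s < T \<longrightarrow> k s = k' s"
proof -
  obtain g where g: "g \<in> borel_measurable borel" "AE t in lborel. 0 < t \<longrightarrow> k t = g t" "\<And>t. t \<le> 0 \<Longrightarrow> g t = 0"
    "\<And>S. integrable lborel (\<lambda>t. indicator {0<..<S} t * g t)"
    using L1_loc_representative[OF k] by blast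
  have "causal_L1 (\<lambda>t. indicator {0<..<T} t * g t)" using g(4)[of T] by (auto simp: causal_L1_def)
  moreover have "AE s in lborel. 0 < s \<and> s < T \<longrightarrow> k s = indicator {0<..<T} s * g s"
    using g(2) by eventually_elim auto
  ultimately show thesis by (intro that[of "\<lambda>t. indicator {0<..<T} t * g t"]) auto
qed

text \<open>All properties of the kernels that enter the proof, for representatives cut off at \<open>T\<close>.  As \<open>k\<close> is
  monotone, it is Borel measurable itself, and cutting it off keeps the monotonicity at every point of
  \<open>(0, T)\<close>.\<close>

lemma PC_kernels:
  assumes kl: "(k, l) \<in> PC" and T: "0 < T"
  obtains k' l' h' where "causal_L1 k'" "causal_L1 l'" "causal_L1 h'" "\<forall>s. 0 \<le> k' s" "\<forall>s\<ge>T. k' s = 0"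
    "\<forall>s s'. 0 < s \<longrightarrow> s \<le> s' \<longrightarrow> s' < T \<longrightarrow> k' s' \<le> k' s"
    "eq_upto T (lconv k' l') (indicator {0<..<T})" "eq_upto T (\<lambda>t. h' t + lconv h' l' t) l'"
    "AE s in lborel. 0 < s \<and> s < T \<longrightarrow> k s = k' s"
    "AE s in lborel. 0 < s \<and> s < T \<longrightarrow> reg_h l 1 s = h' s"
    "\<forall>t\<le>T. reg_k k l 1 t = lconv k' h' t"
proof -
  have k: "k \<in> L1_loc" "\<And>t. 0 < t \<Longrightarrow> 0 \<le> k t" "\<And>s s'. 0 < s \<Longrightarrow> s \<le> s' \<Longrightarrow> k s' \<le> k s"
    and l: "l \<in> L1_loc" "AE t in lborel. 0 < t \<longrightarrow> conv k l t = 1"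
    using kl by (auto simp: PC_def monotone_on_def AE_lebesgue_on_iff)
  define k' where "k' s = indicator {0<..<T} s * k s" for s
  obtain k2 where k2: "causal_L1 k2" "\<And>s. T \<le> s \<Longrightarrow> k2 s = 0" "AE s in lborel. 0 < s \<and> s < T \<longrightarrow> k s = k2 s"
    using L1_loc_truncation[OF k(1), of T] by blast
  obtain l' where l': "causal_L1 l'" "\<And>s. T \<le> s \<Longrightarrow> l' s = 0" "AE s in lborel. 0 < s \<and> s < T \<longrightarrow> l s = l' s"
    using L1_loc_truncation[OF l(1), of T] by blast
  obtain h' where h': "causal_L1 h'" "\<And>s. T \<le> s \<Longrightarrow> h' s = 0" "AE s in lborel. 0 < s \<and> s < T \<longrightarrow> reg_h l 1 s = h' s"
    using L1_loc_truncation[OF reg_h_solves(1)[OF l(1)], of T] by blast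
  have "mono_on {0<..<T} (\<lambda>s. - k s)" using k(3) by (auto simp: mono_on_def)
  then have "(\<lambda>s. - k s) \<in> borel_measurable (restrict_space borel {0<..<T})" by (rule borel_measurable_mono_on_fnc)
  then have "(\<lambda>s. - (- k s)) \<in> borel_measurable (restrict_space borel {0<..<T})" by (rule borel_measurable_uminus)
  then have k'm: "k' \<in> borel_measurable borel"
    by (simp add: borel_measurable_restrict_space_iff k'_def[abs_def] mult.commute)
  have k'k2: "AE s in lborel. k' s = k2 s"
    using k2(3) by eventually_elim (use k2(2) causal_L1D(3)[OF k2(1)] in \<open>auto simp: k'_def indicator_def\<close>)
  have k'c: "causal_L1 k'"
  proof -
    have "integrable lborel k'"
      using integrable_cong_AE[of k' lborel k2] k'm k'k2 causal_L1D(1,2)[OF k2(1)] by simp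
    then show ?thesis by (simp add: causal_L1_def k'_def)
  qed
  have conv_k: "conv k v t = lconv k' v' t" if "causal_L1 v'" "AE s in lborel. 0 < s \<and> s < T \<longrightarrow> v s = v' s" "t \<le> T" for v v' :: "real \<Rightarrow> real" and t
    by (rule conv_eq_lconv[where S=T]) (use that causal_L1D(3)[OF k'c] causal_L1D(3)[OF that(1)] k'm causal_L1D(2)[OF that(1)] in \<open>auto simp: k'_def\<close>)
  have "eq_upto T (lconv k' l') (indicator {0<..<T})"
    unfolding eq_upto_def using l(2)
  proof eventually_elim
    case (elim t)
    show ?case
    proof (cases "0 < t")
      case True
      then show ?thesis using elim conv_k[OF l'(1,3), of t] by auto
    qed (use lconv_causal[of k' l' t] causal_L1D(3)[OF k'c] causal_L1D(3)[OF l'(1)] in auto)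
  qed
  moreover have "eq_upto T (\<lambda>t. h' t + lconv h' l' t) l'"
    unfolding eq_upto_def using reg_h_solves(2)[OF l(1)] h'(3) l'(3)
  proof eventually_elim
    case (elim t)
    show ?case
    proof (cases "0 < t \<and> t < T")
      case True
      have "conv (reg_h l 1) l t = lconv h' l' t"
        by (rule conv_eq_lconv[where S=T]) (use True h' l' causal_L1D(2,3)[OF h'(1)] causal_L1D(2,3)[OF l'(1)] in auto)
      then show ?thesis using elim True by auto
    qed (use lconv_causal[of h' l' t] causal_L1D(3)[OF h'(1)] causal_L1D(3)[OF l'(1)] in auto)
  qed
  moreover have "reg_k k l 1 t = lconv k' h' t" if "t \<le> T" for t
    unfolding reg_k_def by (rule conv_k[OF h'(1,3) that])
  moreover have "AE s in lborel. 0 < s \<and> s < T \<longrightarrow> k s = k' s" by (simp add: k'_def)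
  ultimately show thesis
    by (intro that[of k' l' h'] k'c l'(1) h'(1) h'(3)) (use k in \<open>auto simp: k'_def indicator_def\<close>)
qed

lemma AE_spacetime_slices:
  fixes u U :: "real \<Rightarrow> 'a::euclidean_space \<Rightarrow> 'b"
  assumes "AE (t, x) in lborel2. 0 < t \<and> t < T \<and> x \<in> \<Omega> \<longrightarrow> u t x = U t x"
  shows "AE x in lborel. x \<in> \<Omega> \<longrightarrow> (AE t in lborel. 0 < t \<and> t < T \<longrightarrow> u t x = U t x)"
    and "AE t in lborel. 0 < t \<and> t < T \<longrightarrow> (AE x in lborel. x \<in> \<Omega> \<longrightarrow> u t x = U t x)"
proof -
  show "AE x in lborel. x \<in> \<Omega> \<longrightarrow> (AE t in lborel. 0 < t \<and> t < T \<longrightarrow> u t x = U t x)"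
    using AE_pair_commute[OF assms]
  proof eventually_elim
    case (elim x)
    show ?case by (intro impI) (use elim in \<open>auto elim: eventually_mono\<close>)
  qed
  show "AE t in lborel. 0 < t \<and> t < T \<longrightarrow> (AE x in lborel. x \<in> \<Omega> \<longrightarrow> u t x = U t x)"
    using lborel_pair.AE_pair[OF assms]
  proof eventually_elim
    case (elim t)
    show ?case by (intro impI) (use elim in \<open>auto elim: eventually_mono\<close>)
  qed
qed

lemma L2_spacetime_time_slice:
  fixes H :: "real \<Rightarrow> 'a::euclidean_space \<Rightarrow> real"
  assumes H: "L2_spacetime T \<Omega> H" and \<Omega>: "open \<Omega>" "bounded \<Omega>"
  shows "AE x in lborel. causal_L1 (\<lambda>t. H t x)"
  using lborel_pair.AE_integrable_snd[OF L2_spacetime_integrable[OF H \<Omega>]]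
  by eventually_elim (use L2_spacetimeD(2)[OF H] in \<open>auto simp: causal_L1_def\<close>)

text \<open>The weak time derivative is tested with \<open>s \<mapsto> f ((r - s) / \<epsilon>)\<close>.  For almost every \<open>x\<close> this is an
  identity between convolutions at \<open>r\<close>, which is then paired with \<open>\<psi>\<close>.\<close>

lemma weak_dt_pairing:
  fixes u D U D' :: "real \<Rightarrow> 'a::euclidean_space \<Rightarrow> real"
  assumes \<Omega>: "open \<Omega>" "bounded \<Omega>"
    and K: "causal_L1 K" "\<And>t. t \<le> T \<Longrightarrow> \<kappa> t = K t"
    and U: "L2_spacetime T \<Omega> U" "AE (t, x) in lborel2. 0 < t \<and> t < T \<and> x \<in> \<Omega> \<longrightarrow> u t x = U t x"
    and u0: "L2_space \<Omega> u0'" "AE x in lborel. x \<in> \<Omega> \<longrightarrow> u0 x = u0' x"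
    and D: "L2_spacetime T \<Omega> D'" "AE (t, x) in lborel2. 0 < t \<and> t < T \<and> x \<in> \<Omega> \<longrightarrow> D t x = D' t x"
    and dt: "has_weak_dt T \<Omega> (\<lambda>t x. conv \<kappa> (\<lambda>\<tau>. u \<tau> x - u0 x) t) D"
    and \<psi>: "L2_space \<Omega> \<psi>"
    and f: "f \<in> bumps" "f' \<in> bumps" "\<And>x. (f has_real_derivative f' x) (at x)" and \<epsilon>: "0 < \<epsilon>" "\<epsilon> < r" "r < T"
  shows "lconv (lconv (\<lambda>s. f' (s / \<epsilon>) / \<epsilon>) K) (pairing (\<lambda>s x. U s x - indicator {0<..<T} s *\<^sub>R u0' x) \<psi>) r
    = lconv (\<lambda>s. f (s / \<epsilon>)) (pairing D' \<psi>) r"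
proof -
  define b where "b s = f (s / \<epsilon>)" for s
  define b1 where "b1 s = f' (s / \<epsilon>) / \<epsilon>" for s
  define X where "X s x = U s x - indicator {0<..<T} s *\<^sub>R u0' x" for s x
  have X: "L2_spacetime T \<Omega> X"
    unfolding X_def[abs_def] by (intro L2_spacetime_diff U L2_spacetime_const u0)
  have f's: "(\<lambda>x. 1 / \<epsilon> * f' x) \<in> bumps" by (rule bumps.scale[OF f(2)])
  have b: "causal_L1 b" and b1: "causal_L1 b1"
    using bump_scaled(1)[OF f(1) \<epsilon>(1)] bump_scaled(1)[OF f's \<epsilon>(1)] by (simp_all add: b_def[abs_def] b1_def[abs_def])
  have b0: "b s = 0" "b1 s = 0" if "\<epsilon> \<le> s" for s
    using bump_scaled(2)[OF f(1) \<epsilon>(1) that] bump_scaled(2)[OF f(2) \<epsilon>(1) that] by (simp_all add: b_def b1_def)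
  obtain C C1 where "\<And>x. \<bar>f x\<bar> \<le> C" "\<And>x. \<bar>1 / \<epsilon> * f' x\<bar> \<le> C1"
    using bumps_bounded[OF f(1)] bumps_bounded[OF f's] by metis
  then have C: "\<And>s. \<bar>b s\<bar> \<le> C" "\<And>s. \<bar>b1 s\<bar> \<le> C1" by (simp_all add: b_def b1_def)
  note test = bump_test_function[OF f(1,3) \<epsilon>]
  have outside: "b (r - s) = 0" "b1 (r - s) = 0" if "s \<notin> {0<..<T}" for s
    using that b0[of "r - s"] causal_L1D(3)[OF b, of "r - s"] causal_L1D(3)[OF b1, of "r - s"] \<epsilon>
    by (cases "s \<le> 0"; force)+
  have "AE x in lebesgue_on \<Omega>. (LINT t|lebesgue_on {0<..<T}. deriv (\<lambda>s. f ((r - s) / \<epsilon>)) t * conv \<kappa> (\<lambda>\<tau>. u \<tau> x - u0 x) t)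
      = - (LINT t|lebesgue_on {0<..<T}. f ((r - t) / \<epsilon>) * D t x)"
    using dt test(1) unfolding has_weak_dt_def by blast
  then have "AE x in lborel. x \<in> \<Omega> \<longrightarrow> (LINT t|lebesgue_on {0<..<T}. deriv (\<lambda>s. f ((r - s) / \<epsilon>)) t * conv \<kappa> (\<lambda>\<tau>. u \<tau> x - u0 x) t)
      = - (LINT t|lebesgue_on {0<..<T}. f ((r - t) / \<epsilon>) * D t x)"
    using \<Omega> by (simp add: AE_lebesgue_on_iff)
  then have eq: "AE x in lborel. lconv (lconv b1 K) (\<lambda>s. X s x) r = lconv b (\<lambda>s. D' s x) r"
    using AE_spacetime_slices(1)[OF U(2)] u0(2) AE_spacetime_slices(1)[OF D(2)] L2_spacetime_time_slice[OF X \<Omega>] L2_spacetime_time_slice[OF D(1) \<Omega>]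
  proof eventually_elim
    case (elim x)
    show ?case
    proof (cases "x \<in> \<Omega>")
      case False
      then have "(\<lambda>s. X s x) = (\<lambda>_. 0)" "(\<lambda>s. D' s x) = (\<lambda>_. 0)"
        using L2_spacetimeD(2)[OF X] L2_spacetimeD(2)[OF D(1)] by auto
      then show ?thesis by (simp add: lconv_zero)
    next
      case True
      note Xx = elim(5) and D'x = elim(6)
      have LX: "conv \<kappa> (\<lambda>\<tau>. u \<tau> x - u0 x) t = lconv K (\<lambda>s. X s x) t" if "t \<le> T" for t
      proof (rule conv_eq_lconv[where S=T])
        show "AE s in lborel. 0 < s \<and> s < T \<longrightarrow> \<kappa> s = K s" using K(2) by auto
        show "AE s in lborel. 0 < s \<and> s < T \<longrightarrow> u s x - u0 x = X s x"
          using elim(2)[rule_format, OF True] by eventually_elim (use elim(3) True in \<open>auto simp: X_def\<close>)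
      qed (use that causal_L1D(2,3)[OF K(1)] causal_L1D(2,3)[OF Xx] in auto)
      have m: "(\<lambda>s. lconv K (\<lambda>s. X s x) s) \<in> borel_measurable borel"
        by (rule lconv_measurable) (use K(1) Xx in \<open>auto simp: causal_L1D\<close>)
      note [measurable] = m causal_L1D(2)[OF b] causal_L1D(2)[OF b1] causal_L1D(2)[OF D'x]
      have "(LINT t|lebesgue_on {0<..<T}. deriv (\<lambda>s. f ((r - s) / \<epsilon>)) t * conv \<kappa> (\<lambda>\<tau>. u \<tau> x - u0 x) t)
          = (LBINT s. - (b1 (r - s) * lconv K (\<lambda>s. X s x) s))"
        by (rule lebesgue_on_integral_eq_lborel(1)) (auto simp: test(2) LX outside b1_def[symmetric])
      also have "\<dots> = - lconv b1 (lconv K (\<lambda>s. X s x)) r" by (simp add: lconv_def[of b1])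
      also have "lconv b1 (lconv K (\<lambda>s. X s x)) r = lconv (lconv b1 K) (\<lambda>s. X s x) r"
        by (rule lconv_assoc_bounded[OF _ C(2)]) (use b1 K(1) Xx in \<open>auto dest: causal_L1D\<close>)
      finally have 1: "(LINT t|lebesgue_on {0<..<T}. deriv (\<lambda>s. f ((r - s) / \<epsilon>)) t * conv \<kappa> (\<lambda>\<tau>. u \<tau> x - u0 x) t)
          = - lconv (lconv b1 K) (\<lambda>s. X s x) r" .
      have "(LINT t|lebesgue_on {0<..<T}. f ((r - t) / \<epsilon>) * D t x) = (LBINT s. b (r - s) * D' s x)"
      proof (rule lebesgue_on_integral_eq_lborel(1))
        show "AE s in lborel. s \<in> {0<..<T} \<longrightarrow> f ((r - s) / \<epsilon>) * D s x = b (r - s) * D' s x"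
          using elim(4)[rule_format, OF True] by eventually_elim (auto simp: b_def)
      qed (auto simp: outside)
      also have "\<dots> = lconv b (\<lambda>s. D' s x) r" by (simp add: lconv_def)
      finally show ?thesis using 1 elim(1) True by simp
    qed
  qed
  have \<kappa>1: "lconv b1 K \<in> borel_measurable borel" "\<bar>lconv b1 K s\<bar> \<le> C1 * (LBINT s. norm (K s))" for s
    using lconv_bounded[OF _ C(2), where g=K and t=s] b1 K(1) by (auto simp: causal_L1D intro!: lconv_measurable)
  have mb: "b \<in> borel_measurable borel" using b by (rule causal_L1D)
  have "lconv (lconv b1 K) (pairing X \<psi>) r = (LBINT x. lconv (lconv b1 K) (\<lambda>s. X s x) r \<bullet> \<psi> x)"
    using lconv_pairing_spacetime_bounded(2)[OF X \<psi> \<Omega> \<kappa>1] by simp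
  also have "\<dots> = (LBINT x. lconv b (\<lambda>s. D' s x) r \<bullet> \<psi> x)"
    using eq lconv_pairing_spacetime_bounded(1)[OF X \<psi> \<Omega> \<kappa>1, of r] lconv_pairing_spacetime_bounded(1)[OF D(1) \<psi> \<Omega> mb C(1), of r]
    by (intro integral_cong_AE) (auto dest: borel_measurable_integrable elim: eventually_mono)
  also have "\<dots> = lconv b (pairing D' \<psi>) r"
    using lconv_pairing_spacetime_bounded(2)[OF D(1) \<psi> \<Omega> mb C(1)] by simp
  finally show ?thesis by (simp add: X_def[abs_def] b_def[abs_def] b1_def[abs_def])
qed

lemma weak_equation_pairing:
  fixes D D' :: "real \<Rightarrow> 'a::euclidean_space \<Rightarrow> real" and G G' :: "real \<Rightarrow> 'a \<Rightarrow> 'a"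
  assumes \<Omega>: "open \<Omega>" "bounded \<Omega>"
    and h: "causal_L1 h'" "AE s in lborel. 0 < s \<and> s < T \<longrightarrow> h s = h' s"
    and D: "L2_spacetime T \<Omega> D'" "AE (t, x) in lborel2. 0 < t \<and> t < T \<and> x \<in> \<Omega> \<longrightarrow> D t x = D' t x"
    and G: "L2_spacetime T \<Omega> G'" "AE (t, x) in lborel2. 0 < t \<and> t < T \<and> x \<in> \<Omega> \<longrightarrow> G t x = G' t x"
    and \<psi>: "L2_space \<Omega> \<psi>'" "AE x in lborel. x \<in> \<Omega> \<longrightarrow> \<psi> x = \<psi>' x"
    and g: "L2_space \<Omega> g'" "AE x in lborel. x \<in> \<Omega> \<longrightarrow> g x = g' x"
    and eq: "AE t in lebesgue_on {0<..<T}. (LINT x|lebesgue_on \<Omega>. \<psi> x * D t x + conv h (\<lambda>\<tau>. G \<tau> x) t \<bullet> g x) = R t"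
  shows "AE t in lborel. 0 < t \<and> t < T \<longrightarrow> pairing D' \<psi>' t + lconv h' (pairing G' g') t = R t"
proof -
  have "AE t in lborel. 0 < t \<and> t < T \<longrightarrow> (LINT x|lebesgue_on \<Omega>. \<psi> x * D t x + conv h (\<lambda>\<tau>. G \<tau> x) t \<bullet> g x) = R t"
    using eq by (simp add: AE_lebesgue_on_iff)
  then show ?thesis
    using AE_spacetime_slices(2)[OF D(2)] lconv_pairing_spacetime[OF G(1) g(1) \<Omega> causal_L1D(1)[OF h(1)]]
      lborel_pair.AE_integrable_fst[OF L2_spacetime_pairing_integrable[OF D(1) \<psi>(1)]]
  proof eventually_elim
    case (elim t)
    show ?case
    proof
      assume t: "0 < t \<and> t < T"
      note i1 = elim(4) and i2 = conjunct1[OF elim(3)] and e2 = conjunct2[OF elim(3)]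
      have "(LINT x|lebesgue_on \<Omega>. \<psi> x * D t x + conv h (\<lambda>\<tau>. G \<tau> x) t \<bullet> g x)
          = (LBINT x. D' t x \<bullet> \<psi>' x + lconv h' (\<lambda>\<tau>. G' \<tau> x) t \<bullet> g' x)"
      proof (rule lebesgue_on_integral_eq_lborel(1))
        show "(\<lambda>x. D' t x \<bullet> \<psi>' x + lconv h' (\<lambda>\<tau>. G' \<tau> x) t \<bullet> g' x) \<in> borel_measurable borel"
          using borel_measurable_integrable[OF i1] borel_measurable_integrable[OF i2] by simp
        show "AE x in lborel. x \<in> \<Omega> \<longrightarrow> \<psi> x * D t x + conv h (\<lambda>\<tau>. G \<tau> x) t \<bullet> g x
            = D' t x \<bullet> \<psi>' x + lconv h' (\<lambda>\<tau>. G' \<tau> x) t \<bullet> g' x"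
          using \<psi>(2) g(2) elim(2)[rule_format, OF t] AE_spacetime_slices(1)[OF G(2)]
        proof eventually_elim
          case (elim x)
          show ?case
          proof
            assume x: "x \<in> \<Omega>"
            have "conv h (\<lambda>\<tau>. G \<tau> x) t = lconv h' (\<lambda>\<tau>. G' \<tau> x) t"
              by (rule conv_eq_lconv[where S=T])
                (use elim(4) x h t causal_L1D(2,3)[OF h(1)] L2_spacetimeD(2)[OF G(1)] L2_spacetime_slice_measurable(2)[OF G(1)] in auto)
            then show "\<psi> x * D t x + conv h (\<lambda>\<tau>. G \<tau> x) t \<bullet> g x
                = D' t x \<bullet> \<psi>' x + lconv h' (\<lambda>\<tau>. G' \<tau> x) t \<bullet> g' x"
              using elim x by simp
          qed
        qed
        show "\<And>x. x \<notin> \<Omega> \<Longrightarrow> D' t x \<bullet> \<psi>' x + lconv h' (\<lambda>\<tau>. G' \<tau> x) t \<bullet> g' x = 0"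
          using L2_spaceD(2)[OF \<psi>(1)] L2_spaceD(2)[OF g(1)] by simp
      qed (use \<Omega> in simp)
      also have "\<dots> = pairing D' \<psi>' t + lconv h' (pairing G' g') t"
        using i1 i2 e2 by (simp add: pairing_def)
      finally show "pairing D' \<psi>' t + lconv h' (pairing G' g') t = R t" using elim(1) t by simp
    qed
  qed
qed

text \<open>The continuous representative of \<open>k * u\<close> vanishes at \<open>0\<close>, so its pairings with \<open>\<psi>\<close> are small near
  \<open>0\<close> by the Cauchy--Schwarz inequality.\<close>

lemma initial_value_pairing:
  fixes u U :: "real \<Rightarrow> 'a::euclidean_space \<Rightarrow> real"
  assumes \<Omega>: "open \<Omega>" "bounded \<Omega>" and T: "0 < T"
    and k: "causal_L1 k'" "AE s in lborel. 0 < s \<and> s < T \<longrightarrow> k s = k' s"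
    and U: "L2_spacetime T \<Omega> U" "AE (t, x) in lborel2. 0 < t \<and> t < T \<and> x \<in> \<Omega> \<longrightarrow> u t x = U t x"
    and init: "C_L2_zero T \<Omega> (\<lambda>t x. conv k (\<lambda>\<tau>. u \<tau> x) t)"
    and \<psi>: "L2_space \<Omega> \<psi>" and e: "0 < e"
  shows "\<exists>d>0. AE t in lborel. 0 < t \<and> t < d \<longrightarrow> \<bar>lconv k' (pairing U \<psi>) t\<bar> \<le> e"
proof -
  obtain F where F: "\<And>t. t \<in> {0..T} \<Longrightarrow> F t \<in> L2 \<Omega>"
    "\<And>t. t \<in> {0..T} \<Longrightarrow> ((\<lambda>s. sqrt (LINT x|lebesgue_on \<Omega>. (F s x - F t x)\<^sup>2)) \<longlongrightarrow> 0) (at t within {0..T})"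
    "AE t in lebesgue_on {0<..<T}. AE x in lebesgue_on \<Omega>. F t x = conv k (\<lambda>\<tau>. u \<tau> x) t"
    "AE x in lebesgue_on \<Omega>. F 0 x = 0"
    using init unfolding C_L2_zero_def by blast
  have [measurable]: "\<Omega> \<in> sets borel" using \<Omega> by simp
  define M where "M = sqrt (\<integral>x. (\<psi> x)\<^sup>2 \<partial>lebesgue_on \<Omega>)"
  have M0: "0 \<le> M" by (simp add: M_def Bochner_Integration.integral_nonneg)
  have \<psi>int: "integrable (lebesgue_on \<Omega>) (\<lambda>x. (\<psi> x)\<^sup>2)"
    using lebesgue_on_integral_eq_lborel(2)[of "\<lambda>x. (\<psi> x)\<^sup>2" \<Omega> "\<lambda>x. (\<psi> x)\<^sup>2"] L2_spaceD[OF \<psi>] by simp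
  have \<psi>m: "\<psi> \<in> borel_measurable (lebesgue_on \<Omega>)"
    using L2_spaceD(1)[OF \<psi>] by (simp add: measurable_completion measurable_restrict_space1)
  have "\<forall>\<^sub>F s in at 0 within {0..T}. sqrt (LINT x|lebesgue_on \<Omega>. (F s x - F 0 x)\<^sup>2) < e / (M + 1)"
    using F(2)[of 0] T e M0 by (intro order_tendstoD(2)[of _ 0]) auto
  then obtain d0 where d0: "0 < d0" "\<And>s. s \<in> {0..T} \<Longrightarrow> s \<noteq> 0 \<Longrightarrow> dist s 0 < d0 \<Longrightarrow> sqrt (LINT x|lebesgue_on \<Omega>. (F s x - F 0 x)\<^sup>2) < e / (M + 1)"
    unfolding eventually_at by auto
  have "AE t in lborel. 0 < t \<and> t < T \<longrightarrow> (AE x in lborel. x \<in> \<Omega> \<longrightarrow> F t x = conv k (\<lambda>\<tau>. u \<tau> x) t)"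
    using F(3) by (simp add: AE_lebesgue_on_iff)
  then have "AE t in lborel. 0 < t \<and> t < min d0 T \<longrightarrow> \<bar>lconv k' (pairing U \<psi>) t\<bar> \<le> e"
    using lconv_pairing_spacetime[OF U(1) \<psi> \<Omega> causal_L1D(1)[OF k(1)]]
  proof eventually_elim
    case (elim t)
    show ?case
    proof
      assume t: "0 < t \<and> t < min d0 T"
      have tT: "t \<in> {0..T}" "t \<noteq> 0" "dist t 0 < d0" using t by auto
      have Ft: "F t \<in> borel_measurable (lebesgue_on \<Omega>)" "integrable (lebesgue_on \<Omega>) (\<lambda>x. (F t x)\<^sup>2)"
        and F0: "F 0 \<in> borel_measurable (lebesgue_on \<Omega>)"
        using F(1)[OF tT(1)] F(1)[of 0] T by (auto simp: L2_def)
      have Fconv: "AE x in lborel. x \<in> \<Omega> \<longrightarrow> F t x = conv k (\<lambda>\<tau>. u \<tau> x) t" using elim(1) t by auto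
      have "(LINT x|lebesgue_on \<Omega>. F t x * \<psi> x) = (LBINT x. lconv k' (\<lambda>s. U s x) t \<bullet> \<psi> x)"
      proof (rule lebesgue_on_integral_eq_lborel(1))
        show "AE x in lborel. x \<in> \<Omega> \<longrightarrow> F t x * \<psi> x = lconv k' (\<lambda>s. U s x) t \<bullet> \<psi> x"
          using Fconv AE_spacetime_slices(1)[OF U(2)]
        proof eventually_elim
          case (elim x)
          show ?case
          proof
            assume x: "x \<in> \<Omega>"
            have "conv k (\<lambda>\<tau>. u \<tau> x) t = lconv k' (\<lambda>s. U s x) t"
              by (rule conv_eq_lconv[where S=T])
                (use elim(2) x k t causal_L1D(2,3)[OF k(1)] L2_spacetimeD(2)[OF U(1)] L2_spacetime_slice_measurable(2)[OF U(1)] in auto)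
            then show "F t x * \<psi> x = lconv k' (\<lambda>s. U s x) t \<bullet> \<psi> x" using elim(1) x t by simp
          qed
        qed
        show "(\<lambda>x. lconv k' (\<lambda>s. U s x) t \<bullet> \<psi> x) \<in> borel_measurable borel"
          using elim(2) by (auto dest: borel_measurable_integrable)
        show "\<And>x. x \<notin> \<Omega> \<Longrightarrow> lconv k' (\<lambda>s. U s x) t \<bullet> \<psi> x = 0" using L2_spaceD(2)[OF \<psi>] by simp
      qed simp
      then have "\<bar>lconv k' (pairing U \<psi>) t\<bar> = \<bar>LINT x|lebesgue_on \<Omega>. F t x * \<psi> x\<bar>" using elim(2) by simp
      also have "\<dots> \<le> sqrt (LINT x|lebesgue_on \<Omega>. (F t x)\<^sup>2) * M"
        unfolding M_def by (rule Cauchy_Schwarz_integral[OF Ft(1) \<psi>m Ft(2) \<psi>int])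
      also have "(LINT x|lebesgue_on \<Omega>. (F t x)\<^sup>2) = (LINT x|lebesgue_on \<Omega>. (F t x - F 0 x)\<^sup>2)"
        using F(4) Ft F0 by (intro integral_cong_AE) (auto elim: eventually_mono)
      also have "sqrt \<dots> * M \<le> e / (M + 1) * M"
        using d0(2)[OF tT] M0 by (intro mult_right_mono) auto
      also have "\<dots> \<le> e" using M0 e by (simp add: field_simps)
      finally show "\<bar>lconv k' (pairing U \<psi>) t\<bar> \<le> e" .
    qed
  qed
  then show ?thesis using d0(1) T by (intro exI[of _ "min d0 T"]) auto
qed


section \<open>The equation for the difference of two solutions\<close>

lemma primitive_small:
  assumes q: "causal_L1 q" and T: "0 < T" and e: "0 < e"
  shows "\<exists>d>0. \<forall>t<d. \<bar>lconv (indicator {0<..<T}) q t\<bar> \<le> e"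
proof -
  note [measurable] = causal_L1D(2)[OF q]
  have "(\<lambda>n. \<integral>s. indicator {..<1 / real (Suc n)} s * \<bar>q s\<bar> \<partial>lborel) \<longlonglongrightarrow> (\<integral>s. (0::real) \<partial>(lborel :: real measure))"
  proof (rule integral_dominated_convergence[where w="\<lambda>s. \<bar>q s\<bar>"])
    show "AE s in lborel. (\<lambda>n. indicator {..<1 / real (Suc n)} s * \<bar>q s\<bar>) \<longlonglongrightarrow> 0"
    proof (rule AE_I2)
      fix s :: real
      show "(\<lambda>n. indicator {..<1 / real (Suc n)} s * \<bar>q s\<bar>) \<longlonglongrightarrow> 0"
      proof (cases "0 < s")
        case True
        have "(\<lambda>n. 1 / real (Suc n)) \<longlonglongrightarrow> 0" using LIMSEQ_inverse_real_of_nat by (simp add: inverse_eq_divide)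
        then have "\<forall>\<^sub>F n in sequentially. 1 / real (Suc n) < s" using True by (rule order_tendstoD(2))
        then have "\<forall>\<^sub>F n in sequentially. indicator {..<1 / real (Suc n)} s * \<bar>q s\<bar> = 0"
          by (rule eventually_mono) (auto simp: indicator_def)
        then show ?thesis by (rule tendsto_eventually)
      qed (use causal_L1D(3)[OF q, of s] in simp)
    qed
    show "AE s in lborel. norm (indicator {..<1 / real (Suc n)} s * \<bar>q s\<bar>) \<le> \<bar>q s\<bar>" for n
      by (auto simp: indicator_def)
  qed (use causal_L1D(1)[OF q] in auto)
  then have "(\<lambda>n. \<integral>s. indicator {..<1 / real (Suc n)} s * \<bar>q s\<bar> \<partial>lborel) \<longlonglongrightarrow> 0" by simp
  from LIMSEQ_D[OF this e] obtain n where n: "(LBINT s. indicator {..<1 / real (Suc n)} s * \<bar>q s\<bar>) < e"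
    by fastforce
  define d where "d = min (1 / real (Suc n)) T"
  have "\<bar>lconv (indicator {0<..<T}) q t\<bar> \<le> e" if t: "t < d" for t
  proof -
    have "\<bar>lconv (indicator {0<..<T}) q t\<bar> = \<bar>\<integral>s. indicator {..<t} s * q s \<partial>lborel\<bar>"
      using lconv_indicator[OF q, of t T] t by (simp add: d_def)
    also have "\<dots> \<le> (LBINT s. \<bar>indicator {..<t} s * q s\<bar>)" by (rule integral_abs_bound)
    also have "\<dots> \<le> (LBINT s. indicator {..<1 / real (Suc n)} s * \<bar>q s\<bar>)"
      using causal_L1D(1)[OF q] t
      by (intro integral_mono integrable_abs integrable_indicator_times) (auto simp: indicator_def d_def abs_mult)
    finally show ?thesis using n by linarith
  qed
  moreover have "0 < d" using T by (simp add: d_def)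
  ultimately show ?thesis by blast
qed

lemma lconv_eq_AE:
  fixes f g g' :: "real \<Rightarrow> real"
  assumes "AE s in lborel. g s = g' s" and [measurable]: "f \<in> borel_measurable borel" "g \<in> borel_measurable borel" "g' \<in> borel_measurable borel"
  shows "lconv f g t = lconv f g' t"
  unfolding lconv_def by (rule integral_cong_AE) (use assms(1) in \<open>auto elim: eventually_mono\<close>)

text \<open>The data \<open>u0\<close> and \<open>R\<close> are common to both solutions and cancel.  What remains is the statement that
  \<open>P = h * k * (U, \<psi>) + 1 * h * (G, g)\<close> has derivative \<open>0\<close> and initial value \<open>0\<close>, where \<open>U\<close> and \<open>G\<close> are
  the differences.\<close>

proposition difference_identity:
  fixes U\<^sub>1 U\<^sub>2 D\<^sub>1 D\<^sub>2 :: "real \<Rightarrow> 'a::euclidean_space \<Rightarrow> real" and G\<^sub>1 G\<^sub>2 :: "real \<Rightarrow> 'a \<Rightarrow> 'a"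
  assumes T: "0 < T"
    and k: "causal_L1 k" and l: "causal_L1 l" and h: "causal_L1 h"
    and kl: "eq_upto T (lconv k l) (indicator {0<..<T})" and hl: "eq_upto T (\<lambda>t. h t + lconv h l t) l"
    and sp: "L2_spacetime T \<Omega> U\<^sub>1" "L2_spacetime T \<Omega> U\<^sub>2" "L2_spacetime T \<Omega> D\<^sub>1" "L2_spacetime T \<Omega> D\<^sub>2"
      "L2_spacetime T \<Omega> G\<^sub>1" "L2_spacetime T \<Omega> G\<^sub>2"
    and \<psi>: "L2_space \<Omega> \<psi>" and g: "L2_space \<Omega> g" and u0: "L2_space \<Omega> u0"
    and eq: "AE t in lborel. 0 < t \<and> t < T \<longrightarrow> pairing D\<^sub>1 \<psi> t + lconv h (pairing G\<^sub>1 g) t = R t"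
      "AE t in lborel. 0 < t \<and> t < T \<longrightarrow> pairing D\<^sub>2 \<psi> t + lconv h (pairing G\<^sub>2 g) t = R t"
    and dt: "\<And>f f' \<epsilon> r. f \<in> bumps \<Longrightarrow> f' \<in> bumps \<Longrightarrow> (\<And>x. (f has_real_derivative f' x) (at x)) \<Longrightarrow> 0 < \<epsilon> \<Longrightarrow> \<epsilon> < r \<Longrightarrow> r < T \<Longrightarrow>
        lconv (lconv (\<lambda>s. f' (s / \<epsilon>) / \<epsilon>) (lconv k h)) (pairing (\<lambda>s x. U\<^sub>1 s x - indicator {0<..<T} s *\<^sub>R u0 x) \<psi>) r
          = lconv (\<lambda>s. f (s / \<epsilon>)) (pairing D\<^sub>1 \<psi>) r"
      "\<And>f f' \<epsilon> r. f \<in> bumps \<Longrightarrow> f' \<in> bumps \<Longrightarrow> (\<And>x. (f has_real_derivative f' x) (at x)) \<Longrightarrow> 0 < \<epsilon> \<Longrightarrow> \<epsilon> < r \<Longrightarrow> r < T \<Longrightarrow>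
        lconv (lconv (\<lambda>s. f' (s / \<epsilon>) / \<epsilon>) (lconv k h)) (pairing (\<lambda>s x. U\<^sub>2 s x - indicator {0<..<T} s *\<^sub>R u0 x) \<psi>) r
          = lconv (\<lambda>s. f (s / \<epsilon>)) (pairing D\<^sub>2 \<psi>) r"
    and init: "\<And>e. 0 < e \<Longrightarrow> \<exists>d>0. AE t in lborel. 0 < t \<and> t < d \<longrightarrow> \<bar>lconv k (pairing U\<^sub>1 \<psi>) t\<bar> \<le> e"
      "\<And>e. 0 < e \<Longrightarrow> \<exists>d>0. AE t in lborel. 0 < t \<and> t < d \<longrightarrow> \<bar>lconv k (pairing U\<^sub>2 \<psi>) t\<bar> \<le> e"
    and f: "f \<in> bumps" and \<epsilon>: "0 < \<epsilon>" and t: "t < T"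
  shows "lconv (\<lambda>s. f (s / \<epsilon>)) (pairing (\<lambda>s x. U\<^sub>1 s x - U\<^sub>2 s x) \<psi>) t
    + lconv (lconv l (\<lambda>s. f (s / \<epsilon>))) (pairing (\<lambda>s x. G\<^sub>1 s x - G\<^sub>2 s x) g) t = 0"
proof -
  define W where "W = pairing (\<lambda>s x. U\<^sub>1 s x - U\<^sub>2 s x) \<psi>"
  define Y where "Y = pairing (\<lambda>s x. G\<^sub>1 s x - G\<^sub>2 s x) g"
  define X\<^sub>1 where "X\<^sub>1 = pairing (\<lambda>s x. U\<^sub>1 s x - indicator {0<..<T} s *\<^sub>R u0 x) \<psi>"
  define X\<^sub>2 where "X\<^sub>2 = pairing (\<lambda>s x. U\<^sub>2 s x - indicator {0<..<T} s *\<^sub>R u0 x) \<psi>"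
  define one :: "real \<Rightarrow> real" where "one = indicator {0<..<T}"
  have one: "causal_L1 one" unfolding one_def by (rule causal_L1_indicator)
  have W: "causal_L1 W" and Y: "causal_L1 Y" and X: "causal_L1 X\<^sub>1" "causal_L1 X\<^sub>2"
    unfolding W_def Y_def X\<^sub>1_def X\<^sub>2_def
    by (intro causal_L1_pairing[of T \<Omega>] L2_spacetime_diff L2_spacetime_const sp \<psi> g u0)+
  have ui: "causal_L1 (pairing U\<^sub>1 \<psi>)" "causal_L1 (pairing U\<^sub>2 \<psi>)" "causal_L1 (pairing D\<^sub>1 \<psi>)" "causal_L1 (pairing D\<^sub>2 \<psi>)"
    "causal_L1 (pairing G\<^sub>1 g)" "causal_L1 (pairing G\<^sub>2 g)"
    by (intro causal_L1_pairing[of T \<Omega>] sp \<psi> g)+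
  have W_eq: "AE s in lborel. W s = pairing U\<^sub>1 \<psi> s - pairing U\<^sub>2 \<psi> s"
    unfolding W_def by (rule pairing_diff[OF sp(1,2) \<psi>])
  have W_X: "AE s in lborel. W s = X\<^sub>1 s - X\<^sub>2 s"
    using W_eq pairing_diff[OF sp(1) L2_spacetime_const[OF u0] \<psi>] pairing_diff[OF sp(2) L2_spacetime_const[OF u0] \<psi>]
    unfolding X\<^sub>1_def X\<^sub>2_def by eventually_elim simp
  have Y_eq: "AE s in lborel. Y s = pairing G\<^sub>1 g s - pairing G\<^sub>2 g s"
    unfolding Y_def by (rule pairing_diff[OF sp(5,6) g])
  note c = causal_L1_lconv causal_L1_add causal_L1_diff k l h one W Y X ui
  note [measurable] = c[THEN causal_L1D(2)]
  define P where "P t = lconv h (lconv k W) t + lconv one (lconv h Y) t" for t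
  have P: "causal_L1 P" unfolding P_def[abs_def] by (intro c)
  obtain \<rho> where \<rho>: "\<rho> \<in> bumps" "\<And>x. 0 \<le> \<rho> x" "(LBINT x. \<rho> x) = 1" "integrable lborel \<rho>"
    using unit_mollifier by blast
  obtain \<rho>' where \<rho>': "\<rho>' \<in> bumps" "\<And>x. (\<rho> has_real_derivative \<rho>' x) (at x)"
    using bumps_derivative[OF \<rho>(1)] by blast
  have "eq_upto T P (\<lambda>_. 0)"
  proof (rule vanishing_derivative_and_initial_value[OF \<rho>(1,2) \<rho>(4,3) \<rho>' P T])
    fix \<epsilon> t :: real assume \<epsilon>: "0 < \<epsilon>" "\<epsilon> < t" "t < T"
    define b where "b s = \<rho> (s / \<epsilon>)" for s
    define b1 where "b1 s = \<rho>' (s / \<epsilon>) / \<epsilon>" for s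
    have \<rho>'s: "(\<lambda>x. 1 / \<epsilon> * \<rho>' x) \<in> bumps" by (rule bumps.scale[OF \<rho>'(1)])
    have b: "causal_L1 b" "causal_L1 b1"
      using bump_scaled(1)[OF \<rho>(1) \<epsilon>(1)] bump_scaled(1)[OF \<rho>'s \<epsilon>(1)] by (simp_all add: b_def[abs_def] b1_def[abs_def])
    obtain C C1 where "\<And>x. \<bar>\<rho> x\<bar> \<le> C" "\<And>x. \<bar>1 / \<epsilon> * \<rho>' x\<bar> \<le> C1"
      using bumps_bounded[OF \<rho>(1)] bumps_bounded[OF \<rho>'s] by metis
    then have C: "\<And>s. \<bar>b s\<bar> \<le> C" "\<And>s. \<bar>b1 s\<bar> \<le> C1" by (simp_all add: b_def b1_def)
    note c = c b
    note [measurable] = b[THEN causal_L1D(2)]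
    have int: "integrable lborel (\<lambda>s. b (t - s) *\<^sub>R Z s)" "integrable lborel (\<lambda>s. b1 (t - s) *\<^sub>R Z s)" if "causal_L1 Z" for Z
      using lconv_bounded_integrable[of b C Z t, OF _ C(1)] lconv_bounded_integrable[of b1 C1 Z t, OF _ C(2)] b that
      by (auto simp: causal_L1D)
    define \<kappa> where "\<kappa> = lconv b1 (lconv k h)"
    have \<kappa>: "causal_L1 \<kappa>" unfolding \<kappa>_def by (intro c)
    have \<kappa>C: "\<bar>\<kappa> s\<bar> \<le> C1 * (LBINT s. norm (lconv k h s))" for s
      unfolding \<kappa>_def using lconv_bounded[of b1 C1 "lconv k h" s, OF _ C(2)] b(2) causal_L1_lconv[OF k h] by (simp add: causal_L1D)
    have int\<kappa>: "integrable lborel (\<lambda>s. \<kappa> (t - s) *\<^sub>R Z s)" if "causal_L1 Z" for Z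
      using lconv_bounded_integrable[of \<kappa> _ Z t, OF _ \<kappa>C] \<kappa> that by (auto simp: causal_L1D)
    \<comment> \<open>The first part of \<open>b1 * P\<close> is computed from the weak time derivative, the second from the
        equation; they cancel.\<close>
    have "lconv b1 (lconv h (lconv k W)) t = lconv b1 (lconv (lconv k h) W) t"
    proof (rule lconv_eq_upto_pointwise[of T])
      have "eq_upto T (lconv h (lconv k W)) (lconv k (lconv h W))" by (intro lconv_left_commute_eq_upto c)
      also have "eq_upto T \<dots> (lconv (lconv k h) W)" by (intro lconv_assoc_eq_upto c)
      finally show "eq_upto T (lconv h (lconv k W)) (lconv (lconv k h) W)" .
    qed (use \<epsilon> in \<open>auto intro!: c eq_upto_refl\<close>)
    also have "\<dots> = lconv \<kappa> W t"
      unfolding \<kappa>_def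
      by (rule lconv_assoc_bounded[OF _ C(2)]) (use b causal_L1_lconv[OF k h] W in \<open>auto simp: causal_L1D\<close>)
    also have "\<dots> = lconv \<kappa> (\<lambda>s. X\<^sub>1 s - X\<^sub>2 s) t"
      by (rule lconv_eq_AE[OF W_X]) (use \<kappa> W X in \<open>auto simp: causal_L1D\<close>)
    also have "\<dots> = lconv \<kappa> X\<^sub>1 t - lconv \<kappa> X\<^sub>2 t"
      by (intro lconv_diff_right int\<kappa> X)
    also have "\<dots> = lconv b (pairing D\<^sub>1 \<psi>) t - lconv b (pairing D\<^sub>2 \<psi>) t"
      using dt[OF \<rho>(1) \<rho>' \<epsilon>] by (simp add: \<kappa>_def X\<^sub>1_def X\<^sub>2_def b_def[abs_def] b1_def[abs_def])
    finally have 1: "lconv b1 (lconv h (lconv k W)) t = lconv b (pairing D\<^sub>1 \<psi>) t - lconv b (pairing D\<^sub>2 \<psi>) t" .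
    have hY: "eq_upto T (lconv h Y) (\<lambda>s. pairing D\<^sub>2 \<psi> s - pairing D\<^sub>1 \<psi> s)"
    proof -
      have h_lin: "AE s in lborel. lconv h (\<lambda>s. pairing G\<^sub>1 g s - pairing G\<^sub>2 g s) s = lconv h (pairing G\<^sub>1 g) s - lconv h (pairing G\<^sub>2 g) s"
        using lconv_AE_integrable[OF causal_L1D(1)[OF h] causal_L1D(1)[OF ui(5)]] lconv_AE_integrable[OF causal_L1D(1)[OF h] causal_L1D(1)[OF ui(6)]]
        by eventually_elim (rule lconv_diff_right)
      have h_Y: "lconv h Y s = lconv h (\<lambda>s. pairing G\<^sub>1 g s - pairing G\<^sub>2 g s) s" for s
        by (rule lconv_eq_AE[OF Y_eq]) (use h Y ui in \<open>auto simp: causal_L1D\<close>)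
      show ?thesis
        unfolding eq_upto_def using h_lin eq
      proof eventually_elim
        case (elim s)
        show ?case
        proof (cases "0 < s")
          case True
          then show ?thesis using elim h_Y[of s] by auto
        next
          case False
          then show ?thesis
            using causal_L1D(3)[OF causal_L1_lconv[OF h Y], of s] causal_L1D(3)[OF ui(3), of s] causal_L1D(3)[OF ui(4), of s] by simp
        qed
      qed
    qed
    have "lconv b1 (lconv one (lconv h Y)) t = lconv (lconv b1 one) (lconv h Y) t"
      by (rule lconv_assoc_bounded[OF _ C(2)]) (use b one causal_L1_lconv[OF h Y] in \<open>auto simp: causal_L1D\<close>)
    also have "lconv b1 one = lconv one b1" by (rule ext) (rule lconv_commute)
    also have "lconv (lconv one b1) (lconv h Y) t = lconv b (\<lambda>s. pairing D\<^sub>2 \<psi> s - pairing D\<^sub>1 \<psi> s) t"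
    proof (rule lconv_eq_upto_pointwise[of T])
      show "eq_upto T (lconv one b1) b"
        using bump_scaled_primitive[OF \<rho>(1) \<rho>' \<epsilon>(1), of _ T] by (simp add: eq_upto_def one_def b_def b1_def[abs_def])
    qed (use \<epsilon> in \<open>auto intro!: c hY\<close>)
    also have "\<dots> = lconv b (pairing D\<^sub>2 \<psi>) t - lconv b (pairing D\<^sub>1 \<psi>) t"
      by (intro lconv_diff_right int ui)
    finally have 2: "lconv b1 (lconv one (lconv h Y)) t = lconv b (pairing D\<^sub>2 \<psi>) t - lconv b (pairing D\<^sub>1 \<psi>) t" .
    have "lconv b1 P t = lconv b1 (lconv h (lconv k W)) t + lconv b1 (lconv one (lconv h Y)) t"
      unfolding P_def[abs_def] by (intro lconv_add_right int c)
    then have "lconv b1 P t = 0" using 1 2 by simp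
    moreover have "lconv (\<lambda>s. \<rho>' (s / \<epsilon>)) P t = \<epsilon> * lconv b1 P t"
      using \<epsilon>(1) by (simp add: lconv_def b1_def)
    ultimately show "lconv (\<lambda>s. \<rho>' (s / \<epsilon>)) P t = 0" by simp
  next
    fix e :: real assume e: "0 < e"
    define H where "H = (LBINT s. \<bar>h s\<bar>)"
    have H0: "0 \<le> H" by (simp add: H_def Bochner_Integration.integral_nonneg)
    \<comment> \<open>The difference doubles the bound, and convolution with \<open>h\<close> multiplies it by \<open>H\<close>.\<close>
    define e1 where "e1 = e / (4 * (H + 1))"
    have e1: "0 < e1" using e H0 by (simp add: e1_def)
    obtain d1 where d1: "0 < d1" "AE t in lborel. 0 < t \<and> t < d1 \<longrightarrow> \<bar>lconv k (pairing U\<^sub>1 \<psi>) t\<bar> \<le> e1"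
      using init(1)[OF e1] by blast
    obtain d2 where d2: "0 < d2" "AE t in lborel. 0 < t \<and> t < d2 \<longrightarrow> \<bar>lconv k (pairing U\<^sub>2 \<psi>) t\<bar> \<le> e1"
      using init(2)[OF e1] by blast
    obtain d3 where d3: "0 < d3" "\<And>t. t < d3 \<Longrightarrow> \<bar>lconv one (lconv h Y) t\<bar> \<le> e / 2"
      using primitive_small[OF causal_L1_lconv[OF h Y] T, of "e / 2"] e unfolding one_def by auto
    define d where "d = min d1 (min d2 d3)"
    have k_lin: "AE s in lborel. lconv k (\<lambda>s. pairing U\<^sub>1 \<psi> s - pairing U\<^sub>2 \<psi> s) s = lconv k (pairing U\<^sub>1 \<psi>) s - lconv k (pairing U\<^sub>2 \<psi>) s"
      using lconv_AE_integrable[OF causal_L1D(1)[OF k] causal_L1D(1)[OF ui(1)]] lconv_AE_integrable[OF causal_L1D(1)[OF k] causal_L1D(1)[OF ui(2)]]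
      by eventually_elim (rule lconv_diff_right)
    have k_W: "lconv k W s = lconv k (\<lambda>s. pairing U\<^sub>1 \<psi> s - pairing U\<^sub>2 \<psi> s) s" for s
      by (rule lconv_eq_AE[OF W_eq]) (use k W ui in \<open>auto simp: causal_L1D\<close>)
    have kW: "AE s in lborel. 0 < s \<and> s < d \<longrightarrow> \<bar>lconv k W s\<bar> \<le> 2 * e1"
      using k_lin d1(2) d2(2) by eventually_elim (use k_W in \<open>auto simp: d_def\<close>)
    have "\<bar>P t\<bar> \<le> e" if "t < d" for t
    proof -
      have "\<bar>lconv h (lconv k W) t\<bar> \<le> 2 * e1 * H"
        unfolding H_def using that e1 by (intro lconv_small[OF h causal_L1_lconv[OF k W] kW]) auto
      also have "\<dots> \<le> e / 2" using H0 e by (simp add: e1_def field_simps)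
      finally show ?thesis using d3(2)[of t] that by (auto simp: P_def d_def)
    qed
    moreover have "0 < d" using d1 d2 d3 by (simp add: d_def)
    ultimately show "\<exists>d>0. AE t in lborel. 0 < t \<and> t < d \<longrightarrow> \<bar>P t\<bar> \<le> e" by auto
  qed
  then show ?thesis
    using smoothed_volterra_identity[OF k l h kl hl W Y _ f \<epsilon> t] unfolding P_def[abs_def] one_def W_def Y_def by simp
qed


text \<open>By the Cauchy--Schwarz inequality on \<open>(0, T)\<close>; the bound does not depend on \<open>t\<close>, hence a smoothed
  function is square integrable in \<open>x\<close> at every time as well as in \<open>(t, x)\<close> on \<open>(0, T)\<close>.\<close>

lemma lconv_square_bound:
  fixes H :: "real \<Rightarrow> 'a::euclidean_space \<Rightarrow> 'b::euclidean_space"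
  assumes T: "0 < T" and \<Omega>: "open \<Omega>" "bounded \<Omega>" and H: "L2_spacetime T \<Omega> H"
    and \<kappa>: "\<kappa> \<in> borel_measurable borel" "\<And>s. \<bar>\<kappa> s\<bar> \<le> C"
  shows "AE x in lborel. \<forall>t. (norm (lconv \<kappa> (\<lambda>s. H s x) t))\<^sup>2 \<le> C\<^sup>2 * T * (LBINT s. (norm (H s x))\<^sup>2)"
  using lborel_pair.AE_integrable_snd[OF L2_spacetime_integrable[OF H \<Omega>]] lborel_pair.AE_integrable_snd[OF L2_spacetimeD(3)[OF H]]
proof eventually_elim
  case (elim x)
  note [measurable] = L2_spacetime_slice_measurable(2)[OF H]
  have C0: "0 \<le> C" using \<kappa>(2)[of 0] by linarith
  define I where "I = (LBINT s. norm (H s x))"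
  have ind: "integrable lborel (\<lambda>s. (indicator {0<..<T} s :: real)\<^sup>2)"
    using causal_L1D(1)[OF causal_L1_indicator[of T]] by (simp add: power2_eq_square flip: indicator_inter_arith)
  have ind1: "(LBINT s. (indicator {0<..<T} s :: real)\<^sup>2) = T"
    using T by (simp add: power2_eq_square flip: indicator_inter_arith)
  have "I = (LBINT s. indicator {0<..<T} s * norm (H s x))"
    unfolding I_def using L2_spacetimeD(2)[OF H, of _ x] by (intro Bochner_Integration.integral_cong) (auto simp: indicator_def)
  then have "\<bar>I\<bar> \<le> sqrt T * sqrt (LBINT s. (norm (H s x))\<^sup>2)"
    using Cauchy_Schwarz_integral[of "indicator {0<..<T}" lborel "\<lambda>s. norm (H s x)", OF _ _ ind elim(2)] ind1 by simp
  then have "\<bar>I\<bar>\<^sup>2 \<le> (sqrt T * sqrt (LBINT s. (norm (H s x))\<^sup>2))\<^sup>2" by (intro power_mono) auto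
  then have I2: "I\<^sup>2 \<le> T * (LBINT s. (norm (H s x))\<^sup>2)"
    using T by (simp add: power_mult_distrib Bochner_Integration.integral_nonneg)
  show ?case
  proof
    fix t
    have "(norm (lconv \<kappa> (\<lambda>s. H s x) t))\<^sup>2 \<le> (C * I)\<^sup>2"
      unfolding I_def by (intro power_mono lconv_bounded \<kappa> elim) auto
    also have "\<dots> \<le> C\<^sup>2 * (T * (LBINT s. (norm (H s x))\<^sup>2))"
      unfolding power_mult_distrib by (intro mult_left_mono I2) auto
    finally show "(norm (lconv \<kappa> (\<lambda>s. H s x) t))\<^sup>2 \<le> C\<^sup>2 * T * (LBINT s. (norm (H s x))\<^sup>2)" by (simp add: mult.assoc)
  qed
qed

lemma lconv_measurable_pair:
  fixes H :: "real \<Rightarrow> 'a::euclidean_space \<Rightarrow> 'b::euclidean_space"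
  assumes [measurable]: "(\<lambda>(t, x). H t x) \<in> borel_measurable lborel2" "\<kappa> \<in> borel_measurable borel"
  shows "(\<lambda>(t, x). lconv \<kappa> (\<lambda>s. H s x) t) \<in> borel_measurable lborel2"
    "(\<lambda>x. lconv \<kappa> (\<lambda>s. H s x) t) \<in> borel_measurable borel"
  unfolding lconv_def by measurable

lemma lconv_outside:
  assumes "L2_spacetime T \<Omega> H" "x \<notin> \<Omega>"
  shows "lconv \<kappa> (\<lambda>s. H s x) t = 0"
proof -
  have "(\<lambda>s. H s x) = (\<lambda>_. 0)" using L2_spacetimeD(2)[OF assms(1)] assms(2) by auto
  then show ?thesis by (simp add: lconv_def)
qed

lemma L2_space_lconv:
  fixes H :: "real \<Rightarrow> 'a::euclidean_space \<Rightarrow> 'b::euclidean_space"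
  assumes T: "0 < T" and \<Omega>: "open \<Omega>" "bounded \<Omega>" and H: "L2_spacetime T \<Omega> H"
    and \<kappa>: "\<kappa> \<in> borel_measurable borel" "\<And>s. \<bar>\<kappa> s\<bar> \<le> C"
  shows "L2_space \<Omega> (\<lambda>x. lconv \<kappa> (\<lambda>s. H s x) t)"
  unfolding L2_space_def
proof (intro conjI allI impI)
  note [measurable] = lconv_measurable_pair(2)[OF L2_spacetimeD(1)[OF H] \<kappa>(1)]
  show "(\<lambda>x. lconv \<kappa> (\<lambda>s. H s x) t) \<in> borel_measurable borel" by measurable
  show "integrable lborel (\<lambda>x. (norm (lconv \<kappa> (\<lambda>s. H s x) t))\<^sup>2)"
  proof (rule Bochner_Integration.integrable_bound)
    show "integrable lborel (\<lambda>x. C\<^sup>2 * T * (LBINT s. (norm (H s x))\<^sup>2))"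
      using lborel_pair.integrable_snd[OF L2_spacetimeD(3)[OF H]] by simp
    show "AE x in lborel. norm ((norm (lconv \<kappa> (\<lambda>s. H s x) t))\<^sup>2) \<le> norm (C\<^sup>2 * T * (LBINT s. (norm (H s x))\<^sup>2))"
      using lconv_square_bound[OF T \<Omega> H \<kappa>] by eventually_elim (auto intro: order_trans[OF _ abs_ge_self])
  qed measurable
qed (rule lconv_outside[OF H])

lemma L2_spacetime_lconv:
  fixes H :: "real \<Rightarrow> 'a::euclidean_space \<Rightarrow> 'b::euclidean_space"
  assumes T: "0 < T" and \<Omega>: "open \<Omega>" "bounded \<Omega>" and H: "L2_spacetime T \<Omega> H"
    and \<kappa>: "\<kappa> \<in> borel_measurable borel" "\<And>s. \<bar>\<kappa> s\<bar> \<le> C"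
  shows "L2_spacetime T \<Omega> (\<lambda>t x. indicator {0<..<T} t *\<^sub>R lconv \<kappa> (\<lambda>s. H s x) t)"
  unfolding L2_spacetime_def
proof (intro conjI allI impI)
  note [measurable] = lconv_measurable_pair(1)[OF L2_spacetimeD(1)[OF H] \<kappa>(1)]
  show m: "(\<lambda>(t, x). indicator {0<..<T} t *\<^sub>R lconv \<kappa> (\<lambda>s. H s x) t) \<in> borel_measurable lborel2" by measurable
  let ?N = "\<lambda>x. C\<^sup>2 * T * (LBINT s. (norm (H s x))\<^sup>2)"
  have N: "integrable lborel ?N"
    using lborel_pair.integrable_snd[OF L2_spacetimeD(3)[OF H]] by simp
  show "integrable lborel2 (\<lambda>(t, x). (norm (indicator {0<..<T} t *\<^sub>R lconv \<kappa> (\<lambda>s. H s x) t))\<^sup>2)"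
  proof (rule Bochner_Integration.integrable_bound[OF integrable_time_constant[OF N, of T]])
    have "AE x in lborel. AE t in lborel. norm ((norm (indicator {0<..<T} t *\<^sub>R lconv \<kappa> (\<lambda>s. H s x) t))\<^sup>2)
        \<le> norm (indicator {0<..<T} t * ?N x)"
      using lconv_square_bound[OF T \<Omega> H \<kappa>]
      by eventually_elim (intro AE_I2, auto simp: indicator_def intro: order_trans[OF _ abs_ge_self])
    moreover have "{z \<in> space lborel2. norm ((norm (indicator {0<..<T} (fst z) *\<^sub>R lconv \<kappa> (\<lambda>s. H s (snd z)) (fst z)))\<^sup>2)
        \<le> norm (indicator {0<..<T} (fst z) * ?N (snd z))} \<in> sets lborel2"
    proof -
      have [measurable]: "?N \<in> borel_measurable borel" using borel_measurable_integrable[OF N] by simp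
      have "(\<lambda>z. lconv \<kappa> (\<lambda>s. H s (snd z)) (fst z)) \<in> borel_measurable lborel2"
        using lconv_measurable_pair(1)[OF L2_spacetimeD(1)[OF H] \<kappa>(1)] by (simp add: case_prod_unfold)
      note [measurable] = this
      show ?thesis by measurable
    qed
    ultimately have "AE z in lborel2. norm ((norm (indicator {0<..<T} (fst z) *\<^sub>R lconv \<kappa> (\<lambda>s. H s (snd z)) (fst z)))\<^sup>2)
        \<le> norm (indicator {0<..<T} (fst z) * ?N (snd z))"
      using lborel_pair.AE_commute[of "\<lambda>t x. norm ((norm (indicator {0<..<T} t *\<^sub>R lconv \<kappa> (\<lambda>s. H s x) t))\<^sup>2) \<le> norm (indicator {0<..<T} t * ?N x)"]
        lborel_pair.AE_pair_iff[of "\<lambda>t x. norm ((norm (indicator {0<..<T} t *\<^sub>R lconv \<kappa> (\<lambda>s. H s x) t))\<^sup>2) \<le> norm (indicator {0<..<T} t * ?N x)"]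
      by blast
    then show "AE z in lborel2. norm (case z of (t, x) \<Rightarrow> (norm (indicator {0<..<T} t *\<^sub>R lconv \<kappa> (\<lambda>s. H s x) t))\<^sup>2)
        \<le> norm (case z of (t, x) \<Rightarrow> indicator {0<..<T} t * ?N x)"
      by eventually_elim (simp add: case_prod_unfold)
  qed (use m in measurable)
qed (use lconv_outside[OF H] in \<open>auto simp: indicator_def\<close>)

lemma pairing_diff_right:
  assumes H: "L2_spacetime T \<Omega> H" and \<psi>: "L2_space \<Omega> \<psi>" "L2_space \<Omega> \<psi>'"
  shows "AE t in lborel. pairing H (\<lambda>x. \<psi> x - \<psi>' x) t = pairing H \<psi> t - pairing H \<psi>' t"
  using lborel_pair.AE_integrable_fst[OF L2_spacetime_pairing_integrable[OF H \<psi>(1)]]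
    lborel_pair.AE_integrable_fst[OF L2_spacetime_pairing_integrable[OF H \<psi>(2)]]
  by eventually_elim (simp add: pairing_def inner_diff_right)

lemma lconv_pairing_diff_right:
  assumes H: "L2_spacetime T \<Omega> H" and \<psi>: "L2_space \<Omega> \<psi>" "L2_space \<Omega> \<psi>'"
    and \<kappa>: "\<kappa> \<in> borel_measurable borel" "\<And>s. \<bar>\<kappa> s\<bar> \<le> C"
  shows "lconv \<kappa> (pairing H (\<lambda>x. \<psi> x - \<psi>' x)) t = lconv \<kappa> (pairing H \<psi>) t - lconv \<kappa> (pairing H \<psi>') t"
proof -
  have p: "causal_L1 (pairing H (\<lambda>x. \<psi> x - \<psi>' x))" "causal_L1 (pairing H \<psi>)" "causal_L1 (pairing H \<psi>')"
    by (intro causal_L1_pairing[OF H] L2_space_diff \<psi>)+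
  have "lconv \<kappa> (pairing H (\<lambda>x. \<psi> x - \<psi>' x)) t = lconv \<kappa> (\<lambda>t. pairing H \<psi> t - pairing H \<psi>' t) t"
    by (rule lconv_eq_AE[OF pairing_diff_right[OF H \<psi>] \<kappa>(1)]) (use p in \<open>auto simp: causal_L1D intro!: borel_measurable_diff\<close>)
  also have "\<dots> = lconv \<kappa> (pairing H \<psi>) t - lconv \<kappa> (pairing H \<psi>') t"
    by (intro lconv_diff_right lconv_bounded_integrable[OF \<kappa>] p[THEN causal_L1D(1)])
  finally show ?thesis .
qed

text \<open>The pairing of \<open>b * U\<close> at time \<open>t\<close> with \<open>V s\<close> can be read as a pairing of \<open>V\<close> at time \<open>s\<close> with a
  fixed function of \<open>x\<close>.  So the identity between the two times can be convolved with \<open>b\<close> in \<open>s\<close>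
  and evaluated at \<open>s = t\<close>.\<close>

proposition diagonal_identity:
  fixes U V :: "real \<Rightarrow> 'a::euclidean_space \<Rightarrow> real" and G :: "real \<Rightarrow> 'a \<Rightarrow> 'a"
  assumes T: "0 < T" and \<Omega>: "open \<Omega>" "bounded \<Omega>"
    and sp: "L2_spacetime T \<Omega> U" "L2_spacetime T \<Omega> V" "L2_spacetime T \<Omega> G"
    and b: "b \<in> borel_measurable borel" "\<And>s. \<bar>b s\<bar> \<le> C" and \<beta>: "\<beta> \<in> borel_measurable borel" "\<And>s. \<bar>\<beta> s\<bar> \<le> C'"
    and id: "AE s in lborel. 0 < s \<and> s < T \<longrightarrow> lconv b (pairing U (V s)) t + lconv \<beta> (pairing G (G s)) t = 0"
  shows "(LBINT x. lconv b (\<lambda>s. U s x) t * lconv b (\<lambda>s. V s x) t)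
    + (LBINT x. lconv \<beta> (\<lambda>s. G s x) t \<bullet> lconv b (\<lambda>s. G s x) t) = 0"
proof -
  define p where "p x = lconv b (\<lambda>s. U s x) t" for x
  define q where "q x = lconv \<beta> (\<lambda>s. G s x) t" for x
  have p: "L2_space \<Omega> p" unfolding p_def[abs_def] by (rule L2_space_lconv[OF T \<Omega> sp(1) b])
  have q: "L2_space \<Omega> q" unfolding q_def[abs_def] by (rule L2_space_lconv[OF T \<Omega> sp(3) \<beta>])
  have pV: "causal_L1 (pairing V p)" and qG: "causal_L1 (pairing G q)"
    by (rule causal_L1_pairing[OF sp(2) p], rule causal_L1_pairing[OF sp(3) q])
  have ae: "AE s in lborel. pairing V p s + pairing G q s = 0"
    using id L2_spacetime_slice[OF sp(2)] L2_spacetime_slice[OF sp(3)]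
  proof eventually_elim
    case (elim s)
    show ?case
    proof (cases "0 < s \<and> s < T")
      case True
      have "lconv b (pairing U (V s)) t = pairing V p s"
        using lconv_pairing_spacetime_bounded(2)[OF sp(1) elim(2) \<Omega> b, of t]
        by (simp add: pairing_def[of V] p_def mult.commute)
      moreover have "lconv \<beta> (pairing G (G s)) t = pairing G q s"
        using lconv_pairing_spacetime_bounded(2)[OF sp(3) elim(3) \<Omega> \<beta>, of t]
        by (simp add: pairing_def[of _ q] q_def inner_commute)
      ultimately show ?thesis using elim(1) True by simp
    next
      case False
      then have "V s = (\<lambda>_. 0)" "G s = (\<lambda>_. 0)"
        using L2_spacetimeD(2)[OF sp(2), of s] L2_spacetimeD(2)[OF sp(3), of s] by auto
      then show ?thesis by (simp add: pairing_def)
    qed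
  qed
  have "0 = lconv b (\<lambda>_. 0) t" by (simp add: lconv_def)
  also have "\<dots> = lconv b (\<lambda>s. pairing V p s + pairing G q s) t"
    by (rule lconv_eq_AE[symmetric, OF ae b(1)]) (use pV qG in \<open>auto simp: causal_L1D intro!: borel_measurable_add\<close>)
  also have "\<dots> = lconv b (pairing V p) t + lconv b (pairing G q) t"
    by (intro lconv_add_right lconv_bounded_integrable[OF b] pV[THEN causal_L1D(1)] qG[THEN causal_L1D(1)])
  also have "lconv b (pairing V p) t = (LBINT x. lconv b (\<lambda>s. U s x) t * lconv b (\<lambda>s. V s x) t)"
    using lconv_pairing_spacetime_bounded(2)[OF sp(2) p \<Omega> b, of t] by (simp add: p_def mult.commute)
  also have "lconv b (pairing G q) t = (LBINT x. lconv \<beta> (\<lambda>s. G s x) t \<bullet> lconv b (\<lambda>s. G s x) t)"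
    using lconv_pairing_spacetime_bounded(2)[OF sp(3) q \<Omega> b, of t] by (simp add: q_def inner_commute)
  finally show ?thesis by simp
qed

lemma lconv_inner:
  fixes H :: "real \<Rightarrow> 'b::euclidean_space"
  assumes "\<kappa> \<in> borel_measurable borel" "\<And>s. \<bar>\<kappa> s\<bar> \<le> C" "integrable lborel H"
  shows "lconv \<kappa> H t \<bullet> i = lconv \<kappa> (\<lambda>s. H s \<bullet> i) t"
  unfolding lconv_def using lconv_bounded_integrable[OF assms, of t] by (simp flip: integral_inner_left)

text \<open>For almost every \<open>x\<close>, and for each coordinate of \<open>G\<close>, this is \<open>smoothed_resolvent_positive\<close>.\<close>

proposition spacetime_positive:
  fixes G :: "real \<Rightarrow> 'a::euclidean_space \<Rightarrow> 'b::euclidean_space"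
  assumes T: "0 < T" and \<Omega>: "open \<Omega>" "bounded \<Omega>" and G: "L2_spacetime T \<Omega> G"
    and k: "causal_L1 k" and k0: "\<And>s. 0 \<le> k s" and supp: "\<And>s. T \<le> s \<Longrightarrow> k s = 0"
    and mono: "\<And>s s'. 0 < s \<Longrightarrow> s \<le> s' \<Longrightarrow> s' < T \<Longrightarrow> k s' \<le> k s"
    and l: "causal_L1 l" and kl: "eq_upto T (lconv k l) (indicator {0<..<T})"
    and b: "causal_L1 b" "\<And>s. \<bar>b s\<bar> \<le> C" and b': "causal_L1 b'" and prim: "eq_upto T (lconv (indicator {0<..<T}) b') b"
    and \<beta>: "\<And>s. \<bar>lconv l b s\<bar> \<le> C'"
  shows "0 \<le> (\<integral>z. (case z of (t, x) \<Rightarrow> (indicator {0<..<T} t *\<^sub>R lconv (lconv l b) (\<lambda>s. G s x) t) \<bullet>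
      (indicator {0<..<T} t *\<^sub>R lconv b (\<lambda>s. G s x) t)) \<partial>lborel2)"
proof -
  have mb: "b \<in> borel_measurable borel" "lconv l b \<in> borel_measurable borel"
    using causal_L1D(2)[OF b(1)] causal_L1D(2)[OF causal_L1_lconv[OF l b(1)]] by auto
  have i: "integrable lborel2 (\<lambda>(t, x). (indicator {0<..<T} t *\<^sub>R lconv (lconv l b) (\<lambda>s. G s x) t) \<bullet>
      (indicator {0<..<T} t *\<^sub>R lconv b (\<lambda>s. G s x) t))"
    by (rule L2_spacetime_inner_integrable[OF L2_spacetime_lconv[OF T \<Omega> G mb(2) \<beta>] L2_spacetime_lconv[OF T \<Omega> G mb(1) b(2)]])
  have "AE x in lborel. 0 \<le> (LBINT t. (indicator {0<..<T} t *\<^sub>R lconv (lconv l b) (\<lambda>s. G s x) t) \<bullet>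
      (indicator {0<..<T} t *\<^sub>R lconv b (\<lambda>s. G s x) t))"
    using lborel_pair.AE_integrable_snd[OF L2_spacetime_integrable[OF G \<Omega>]]
  proof eventually_elim
    case (elim x)
    define g where "g i s = G s x \<bullet> i" for i s
    have g: "causal_L1 (g i)" for i
      using elim L2_spacetimeD(2)[OF G, of _ x] by (auto simp: causal_L1_def g_def[abs_def])
    have gm: "lconv b (g i) \<in> borel_measurable borel" "lconv (lconv l b) (g i) \<in> borel_measurable borel" for i
      by (intro lconv_measurable mb causal_L1D(2)[OF g])+
    have int: "integrable lborel (\<lambda>t. indicator {0<..<T} t * (lconv (lconv l b) (g i) t * lconv b (g i) t))" for i
    proof (rule Bochner_Integration.integrable_bound)
      let ?I = "\<integral>s. norm (g i s) \<partial>lborel"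
      show "integrable lborel (\<lambda>t. indicator {0<..<T} t * ((C' * ?I) * (C * ?I)))"
        using causal_L1D(1)[OF causal_L1_indicator[of T]] by simp
      show "AE t in lborel. norm (indicator {0<..<T} t * (lconv (lconv l b) (g i) t * lconv b (g i) t)) \<le> norm (indicator {0<..<T} t * ((C' * ?I) * (C * ?I)))"
      proof (rule AE_I2)
        fix t
        have "\<bar>lconv (lconv l b) (g i) t\<bar> \<le> C' * ?I" "\<bar>lconv b (g i) t\<bar> \<le> C * ?I"
          using lconv_bounded[OF mb(2) \<beta> causal_L1D(1)[OF g[of i]], of t] lconv_bounded[OF mb(1) b(2) causal_L1D(1)[OF g[of i]], of t] by auto
        then have "\<bar>lconv (lconv l b) (g i) t\<bar> * \<bar>lconv b (g i) t\<bar> \<le> (C' * ?I) * (C * ?I)"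
          by (intro mult_mono) auto
        then show "norm (indicator {0<..<T} t * (lconv (lconv l b) (g i) t * lconv b (g i) t)) \<le> norm (indicator {0<..<T} t * ((C' * ?I) * (C * ?I)))"
          by (auto simp: indicator_def abs_mult[symmetric] intro: order_trans[OF _ abs_ge_self])
      qed
    qed (use gm in measurable)
    have "0 \<le> (\<Sum>i\<in>Basis. \<integral>t. indicator {0<..<T} t * (lconv (lconv l b) (g i) t * lconv b (g i) t) \<partial>lborel)"
    proof (rule sum_nonneg)
      fix i :: 'b
      have eq: "indicator {0<..<T} t * (lconv (lconv l b) (g i) t * lconv b (g i) t) = indicator {..<T} t * (lconv (lconv l b) (g i) t * lconv b (g i) t)" for t
        using causal_L1D(3)[OF causal_L1_lconv[OF b(1) g[of i]], of t] by (auto simp: indicator_def)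
      show "0 \<le> (LBINT t. indicator {0<..<T} t * (lconv (lconv l b) (g i) t * lconv b (g i) t))"
        unfolding eq by (rule smoothed_resolvent_positive[OF k k0 supp mono l kl b(1) b' prim g[of i]])
    qed
    also have "\<dots> = (LBINT t. (\<Sum>i\<in>Basis. indicator {0<..<T} t * (lconv (lconv l b) (g i) t * lconv b (g i) t)))"
      by (rule Bochner_Integration.integral_sum[symmetric]) (rule int)
    also have "\<dots> = (LBINT t. (indicator {0<..<T} t *\<^sub>R lconv (lconv l b) (\<lambda>s. G s x) t) \<bullet>
      (indicator {0<..<T} t *\<^sub>R lconv b (\<lambda>s. G s x) t))"
    proof (rule Bochner_Integration.integral_cong[OF refl])
      fix t
      have "(indicator {0<..<T} t *\<^sub>R lconv (lconv l b) (\<lambda>s. G s x) t) \<bullet> (indicator {0<..<T} t *\<^sub>R lconv b (\<lambda>s. G s x) t)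
          = indicator {0<..<T} t * (\<Sum>i\<in>Basis. (lconv (lconv l b) (\<lambda>s. G s x) t \<bullet> i) * (lconv b (\<lambda>s. G s x) t \<bullet> i))"
        unfolding euclidean_inner[of "lconv (lconv l b) (\<lambda>s. G s x) t", symmetric] by (cases "t \<in> {0<..<T}") auto
      also have "\<dots> = (\<Sum>i\<in>Basis. indicator {0<..<T} t * (lconv (lconv l b) (g i) t * lconv b (g i) t))"
        unfolding g_def[abs_def] lconv_inner[OF mb(2) \<beta> elim] lconv_inner[OF mb(1) b(2) elim] by (rule sum_distrib_left)
      finally show "(\<Sum>i\<in>Basis. indicator {0<..<T} t * (lconv (lconv l b) (g i) t * lconv b (g i) t))
          = (indicator {0<..<T} t *\<^sub>R lconv (lconv l b) (\<lambda>s. G s x) t) \<bullet> (indicator {0<..<T} t *\<^sub>R lconv b (\<lambda>s. G s x) t)" by simp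
    qed
    finally show ?case .
  qed
  then have "0 \<le> (LBINT x. (LBINT t. (indicator {0<..<T} t *\<^sub>R lconv (lconv l b) (\<lambda>s. G s x) t) \<bullet>
      (indicator {0<..<T} t *\<^sub>R lconv b (\<lambda>s. G s x) t)))"
    by (rule integral_nonneg_AE)
  then show ?thesis by (simp only: lborel_pair.integral_snd[OF i])
qed

lemma L2_inner_limit:
  fixes f g :: "'n \<Rightarrow> real" and fn gn :: "nat \<Rightarrow> 'n \<Rightarrow> real"
  assumes [measurable]: "f \<in> borel_measurable M" "g \<in> borel_measurable M" "\<And>n. fn n \<in> borel_measurable M" "\<And>n. gn n \<in> borel_measurable M"
    and int: "integrable M (\<lambda>x. (f x)\<^sup>2)" "integrable M (\<lambda>x. (g x)\<^sup>2)"
      "\<And>n. integrable M (\<lambda>x. (fn n x - f x)\<^sup>2)" "\<And>n. integrable M (\<lambda>x. (gn n x - g x)\<^sup>2)"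
    and lim: "(\<lambda>n. \<integral>x. (fn n x - f x)\<^sup>2 \<partial>M) \<longlonglongrightarrow> 0" "(\<lambda>n. \<integral>x. (gn n x - g x)\<^sup>2 \<partial>M) \<longlonglongrightarrow> 0"
  shows "(\<lambda>n. \<integral>x. fn n x * gn n x \<partial>M) \<longlonglongrightarrow> (\<integral>x. f x * g x \<partial>M)"
proof -
  let ?a = "\<lambda>n. sqrt (\<integral>x. (fn n x - f x)\<^sup>2 \<partial>M)" and ?b = "\<lambda>n. sqrt (\<integral>x. (gn n x - g x)\<^sup>2 \<partial>M)"
  let ?F = "sqrt (\<integral>x. (f x)\<^sup>2 \<partial>M)" and ?G = "sqrt (\<integral>x. (g x)\<^sup>2 \<partial>M)"
  have prod: "integrable M (\<lambda>x. u x * v x)" if "u \<in> borel_measurable M" "v \<in> borel_measurable M" "integrable M (\<lambda>x. (u x)\<^sup>2)" "integrable M (\<lambda>x. (v x)\<^sup>2)" for u v :: "'n \<Rightarrow> real"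
    by (rule Bochner_Integration.integrable_bound[of M "\<lambda>x. (u x)\<^sup>2 + (v x)\<^sup>2"])
      (use that abs_inner_le[of "u _" "v _"] in auto)
  have lim0: "?a \<longlonglongrightarrow> 0" "?b \<longlonglongrightarrow> 0"
    using tendsto_real_sqrt[OF lim(1)] tendsto_real_sqrt[OF lim(2)] by simp_all
  have "(\<lambda>n. ?a n * ?b n + ?F * ?b n + ?a n * ?G) \<longlonglongrightarrow> 0 * 0 + ?F * 0 + 0 * ?G"
    by (intro tendsto_intros lim0)
  then have up: "(\<lambda>n. ?a n * ?b n + ?F * ?b n + ?a n * ?G) \<longlonglongrightarrow> 0" by simp
  have bound: "norm ((\<integral>x. fn n x * gn n x \<partial>M) - (\<integral>x. f x * g x \<partial>M)) \<le> ?a n * ?b n + ?F * ?b n + ?a n * ?G" for n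
  proof -
    have i: "integrable M (\<lambda>x. (fn n x - f x) * (gn n x - g x))" "integrable M (\<lambda>x. f x * (gn n x - g x))"
      "integrable M (\<lambda>x. (fn n x - f x) * g x)" "integrable M (\<lambda>x. f x * g x)"
      by (intro prod int borel_measurable_diff assms(1-4))+
    have "(\<integral>x. fn n x * gn n x \<partial>M) = (\<integral>x. (fn n x - f x) * (gn n x - g x) + f x * (gn n x - g x) + (fn n x - f x) * g x + f x * g x \<partial>M)"
      by (intro Bochner_Integration.integral_cong) (auto simp: algebra_simps)
    also have "\<dots> = (\<integral>x. (fn n x - f x) * (gn n x - g x) \<partial>M) + (\<integral>x. f x * (gn n x - g x) \<partial>M) + (\<integral>x. (fn n x - f x) * g x \<partial>M) + (\<integral>x. f x * g x \<partial>M)"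
      by (simp only: Bochner_Integration.integral_add Bochner_Integration.integrable_add i)
    finally have "(\<integral>x. fn n x * gn n x \<partial>M) - (\<integral>x. f x * g x \<partial>M)
        = (\<integral>x. (fn n x - f x) * (gn n x - g x) \<partial>M) + (\<integral>x. f x * (gn n x - g x) \<partial>M) + (\<integral>x. (fn n x - f x) * g x \<partial>M)" by simp
    moreover have "\<bar>\<integral>x. (fn n x - f x) * (gn n x - g x) \<partial>M\<bar> \<le> ?a n * ?b n"
      "\<bar>\<integral>x. f x * (gn n x - g x) \<partial>M\<bar> \<le> ?F * ?b n" "\<bar>\<integral>x. (fn n x - f x) * g x \<partial>M\<bar> \<le> ?a n * ?G"
      by (intro Cauchy_Schwarz_integral int borel_measurable_diff assms(1-4))+
    ultimately show ?thesis by simp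
  qed
  have "(\<lambda>n. (\<integral>x. fn n x * gn n x \<partial>M) - (\<integral>x. f x * g x \<partial>M)) \<longlonglongrightarrow> 0"
    by (rule Lim_null_comparison[OF _ up]) (use bound in simp)
  then show ?thesis by (rule LIM_zero_cancel)
qed


section \<open>Uniqueness\<close>

definition gradient_representative :: "'a::euclidean_space set \<Rightarrow> ('a \<Rightarrow> real) \<Rightarrow> ('a \<Rightarrow> 'a) \<Rightarrow> ('a \<Rightarrow> real) \<Rightarrow> ('a \<Rightarrow> 'a) \<Rightarrow> bool" where
  "gradient_representative \<Omega> \<psi> g \<psi>' g' \<longleftrightarrow> \<psi> \<in> H12_0 \<Omega> \<and> has_weak_gradient \<Omega> \<psi> g \<and> L2_space \<Omega> \<psi>' \<and> L2_space \<Omega> g' \<and>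
     (AE x in lborel. x \<in> \<Omega> \<longrightarrow> \<psi> x = \<psi>' x) \<and> (AE x in lborel. x \<in> \<Omega> \<longrightarrow> g x = g' x)"

text \<open>What a weak solution says about its pairings with functions of \<open>x\<close>: the equation, with
  \<open>D\<close> representing the weak time derivative and \<open>R\<close> the right-hand side; the relation between \<open>D\<close> and
  \<open>U\<close>; and the initial condition.  \<open>R\<close> is kept abstract, since only its being the same for both
  solutions matters.\<close>

definition scalar_equations :: "real \<Rightarrow> 'a::euclidean_space set \<Rightarrow> (real \<Rightarrow> real) \<Rightarrow> (real \<Rightarrow> real) \<Rightarrow> ('a \<Rightarrow> real) \<Rightarrow>
    (('a \<Rightarrow> real) \<Rightarrow> real \<Rightarrow> real) \<Rightarrow> (real \<Rightarrow> 'a \<Rightarrow> real) \<Rightarrow> (real \<Rightarrow> 'a \<Rightarrow> real) \<Rightarrow> (real \<Rightarrow> 'a \<Rightarrow> 'a) \<Rightarrow> bool" where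
  "scalar_equations T \<Omega> k h u0 R U D G \<longleftrightarrow>
     (\<forall>\<psi> g \<psi>' g'. gradient_representative \<Omega> \<psi> g \<psi>' g' \<longrightarrow>
        (AE t in lborel. 0 < t \<and> t < T \<longrightarrow> pairing D \<psi>' t + lconv h (pairing G g') t = R \<psi> t)) \<and>
     (\<forall>\<psi> f f' \<epsilon> r. L2_space \<Omega> \<psi> \<longrightarrow> f \<in> bumps \<longrightarrow> f' \<in> bumps \<longrightarrow> (\<forall>x. (f has_real_derivative f' x) (at x)) \<longrightarrow>
        0 < \<epsilon> \<longrightarrow> \<epsilon> < r \<longrightarrow> r < T \<longrightarrow>
        lconv (lconv (\<lambda>s. f' (s / \<epsilon>) / \<epsilon>) (lconv k h)) (pairing (\<lambda>s x. U s x - indicator {0<..<T} s *\<^sub>R u0 x) \<psi>) r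
          = lconv (\<lambda>s. f (s / \<epsilon>)) (pairing D \<psi>) r) \<and>
     (\<forall>\<psi> e. L2_space \<Omega> \<psi> \<longrightarrow> 0 < e \<longrightarrow>
        (\<exists>d>0. AE t in lborel. 0 < t \<and> t < d \<longrightarrow> \<bar>lconv k (pairing U \<psi>) t\<bar> \<le> e))"

lemma scalar_equationsD:
  assumes "scalar_equations T \<Omega> k h u0 R U D G"
  shows "gradient_representative \<Omega> \<psi> g \<psi>' g' \<Longrightarrow>
      AE t in lborel. 0 < t \<and> t < T \<longrightarrow> pairing D \<psi>' t + lconv h (pairing G g') t = R \<psi> t"
    and "L2_space \<Omega> \<psi> \<Longrightarrow> f \<in> bumps \<Longrightarrow> f' \<in> bumps \<Longrightarrow> (\<And>x. (f has_real_derivative f' x) (at x)) \<Longrightarrow>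
      0 < \<epsilon> \<Longrightarrow> \<epsilon> < r \<Longrightarrow> r < T \<Longrightarrow>
      lconv (lconv (\<lambda>s. f' (s / \<epsilon>) / \<epsilon>) (lconv k h)) (pairing (\<lambda>s x. U s x - indicator {0<..<T} s *\<^sub>R u0 x) \<psi>) r
        = lconv (\<lambda>s. f (s / \<epsilon>)) (pairing D \<psi>) r"
    and "L2_space \<Omega> \<psi> \<Longrightarrow> 0 < e \<Longrightarrow> \<exists>d>0. AE t in lborel. 0 < t \<and> t < d \<longrightarrow> \<bar>lconv k (pairing U \<psi>) t\<bar> \<le> e"
  using assms unfolding scalar_equations_def by blast+

text \<open>At almost every time \<open>s\<close> the slice \<open>V s\<close> represents a member of \<open>H12_0\<close> whose gradient \<open>G s\<close>
  represents; this is what makes it available as a test function.\<close>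

lemma weak_solution_representatives:
  fixes u f a :: "real \<Rightarrow> 'a::euclidean_space \<Rightarrow> real" and u0 u0' :: "'a \<Rightarrow> real"
  assumes T: "0 < T" and \<Omega>: "open \<Omega>" "bounded \<Omega>"
    and k: "causal_L1 k'" "AE s in lborel. 0 < s \<and> s < T \<longrightarrow> k s = k' s"
    and h: "causal_L1 h'" "AE s in lborel. 0 < s \<and> s < T \<longrightarrow> reg_h l 1 s = h' s"
    and K: "\<And>t. t \<le> T \<Longrightarrow> reg_k k l 1 t = lconv k' h' t"
    and u0: "L2_space \<Omega> u0'" "AE x in lborel. x \<in> \<Omega> \<longrightarrow> u0 x = u0' x"
    and u: "weak_solution k l T \<Omega> \<Phi> a u0 f u"
  obtains U V D :: "real \<Rightarrow> 'a \<Rightarrow> real" and G :: "real \<Rightarrow> 'a \<Rightarrow> 'a" where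
    "L2_spacetime T \<Omega> U" "L2_spacetime T \<Omega> V" "L2_spacetime T \<Omega> D" "L2_spacetime T \<Omega> G"
    "AE (t, x) in lborel2. 0 < t \<and> t < T \<and> x \<in> \<Omega> \<longrightarrow> u t x = U t x"
    "AE (t, x) in lborel2. 0 < t \<and> t < T \<and> x \<in> \<Omega> \<longrightarrow> a t x * \<Phi> (u t x) = V t x"
    "AE s in lborel. 0 < s \<and> s < T \<longrightarrow> (\<exists>\<psi> g. gradient_representative \<Omega> \<psi> g (V s) (G s))"
    "scalar_equations T \<Omega> k' h' u0' (\<lambda>\<psi> t. LINT x|lebesgue_on \<Omega>. conv (reg_h l 1) (\<lambda>\<tau>. f \<tau> x) t * \<psi> x) U D G"
proof -
  have uL2: "(\<lambda>(t, x). u t x) \<in> L2 ({0<..<T} \<times> \<Omega>)" and uC: "C_L2_zero T \<Omega> (\<lambda>t x. conv k (\<lambda>\<tau>. u \<tau> x) t)"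
    using u unfolding weak_solution_def by blast+
  obtain G0 where G0: "L2_H12_0_grad T \<Omega> (\<lambda>t x. a t x * \<Phi> (u t x)) G0"
    "\<forall>n\<ge>1. \<exists>D. has_weak_dt T \<Omega> (\<lambda>t x. conv (reg_k k l n) (\<lambda>\<tau>. u \<tau> x - u0 x) t) D \<and>
           (\<forall>\<psi>\<in>H12_0 \<Omega>. \<forall>g. has_weak_gradient \<Omega> \<psi> g \<longrightarrow>
              (AE t in lebesgue_on {0<..<T}.
                 (LINT x|lebesgue_on \<Omega>.
                    \<psi> x * D t x + conv (reg_h l n) (\<lambda>\<tau>. G0 \<tau> x) t \<bullet> g x)
                 = (LINT x|lebesgue_on \<Omega>. conv (reg_h l n) (\<lambda>\<tau>. f \<tau> x) t * \<psi> x)))"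
    using u unfolding weak_solution_def by blast
  obtain D0 where D0: "has_weak_dt T \<Omega> (\<lambda>t x. conv (reg_k k l 1) (\<lambda>\<tau>. u \<tau> x - u0 x) t) D0"
    "\<And>\<psi> g. \<psi> \<in> H12_0 \<Omega> \<Longrightarrow> has_weak_gradient \<Omega> \<psi> g \<Longrightarrow> AE t in lebesgue_on {0<..<T}.
       (LINT x|lebesgue_on \<Omega>. \<psi> x * D0 t x + conv (reg_h l 1) (\<lambda>\<tau>. G0 \<tau> x) t \<bullet> g x)
         = (LINT x|lebesgue_on \<Omega>. conv (reg_h l 1) (\<lambda>\<tau>. f \<tau> x) t * \<psi> x)"
    using G0(2)[rule_format, of 1] by auto
  obtain U where U: "L2_spacetime T \<Omega> U" "AE (t, x) in lborel2. 0 < t \<and> t < T \<and> x \<in> \<Omega> \<longrightarrow> u t x = U t x"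
    using L2_spacetime_representative[OF uL2 \<Omega>(1)] by blast
  obtain V where V: "L2_spacetime T \<Omega> V" "AE (t, x) in lborel2. 0 < t \<and> t < T \<and> x \<in> \<Omega> \<longrightarrow> a t x * \<Phi> (u t x) = V t x"
    using L2_spacetime_representative[of "\<lambda>t x. a t x * \<Phi> (u t x)" T \<Omega>] G0(1) \<Omega>(1) unfolding L2_H12_0_grad_def by blast
  obtain G where G: "L2_spacetime T \<Omega> G" "AE (t, x) in lborel2. 0 < t \<and> t < T \<and> x \<in> \<Omega> \<longrightarrow> G0 t x = G t x"
    using L2_spacetime_representative[of G0 T \<Omega>] G0(1) \<Omega>(1) unfolding L2_H12_0_grad_def by blast
  obtain D where D: "L2_spacetime T \<Omega> D" "AE (t, x) in lborel2. 0 < t \<and> t < T \<and> x \<in> \<Omega> \<longrightarrow> D0 t x = D t x"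
    using L2_spacetime_representative[of D0 T \<Omega>] D0(1) \<Omega>(1) unfolding has_weak_dt_def by blast
  have "AE t in lebesgue_on {0<..<T}. (\<lambda>x. a t x * \<Phi> (u t x)) \<in> H12_0 \<Omega> \<and> has_weak_gradient \<Omega> (\<lambda>x. a t x * \<Phi> (u t x)) (G0 t)"
    using G0(1) unfolding L2_H12_0_grad_def by blast
  from AE_lebesgue_on_iff[THEN iffD1, OF _ this]
  have "AE s in lborel. 0 < s \<and> s < T \<longrightarrow> (\<lambda>x. a s x * \<Phi> (u s x)) \<in> H12_0 \<Omega> \<and> has_weak_gradient \<Omega> (\<lambda>x. a s x * \<Phi> (u s x)) (G0 s)"
    by (simp only: greaterThanLessThan_iff borel_open open_greaterThanLessThan)
  then have VG: "AE s in lborel. 0 < s \<and> s < T \<longrightarrow> (\<exists>\<psi> g. gradient_representative \<Omega> \<psi> g (V s) (G s))"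
    using AE_spacetime_slices(2)[OF V(2)] AE_spacetime_slices(2)[OF G(2)] L2_spacetime_slice[OF V(1)] L2_spacetime_slice[OF G(1)]
    unfolding gradient_representative_def by eventually_elim blast
  show thesis
  proof (rule that[OF U(1) V(1) D(1) G(1) U(2) V(2) VG], unfold scalar_equations_def, intro conjI allI impI)
    fix \<psi> g \<psi>' g' assume "gradient_representative \<Omega> \<psi> g \<psi>' g'"
    then have \<psi>: "\<psi> \<in> H12_0 \<Omega>" "has_weak_gradient \<Omega> \<psi> g" "L2_space \<Omega> \<psi>'" "AE x in lborel. x \<in> \<Omega> \<longrightarrow> \<psi> x = \<psi>' x"
      "L2_space \<Omega> g'" "AE x in lborel. x \<in> \<Omega> \<longrightarrow> g x = g' x"
      unfolding gradient_representative_def by blast+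
    show "AE t in lborel. 0 < t \<and> t < T \<longrightarrow>
        pairing D \<psi>' t + lconv h' (pairing G g') t = (LINT x|lebesgue_on \<Omega>. conv (reg_h l 1) (\<lambda>\<tau>. f \<tau> x) t * \<psi> x)"
      by (rule weak_equation_pairing[OF \<Omega> h D G \<psi>(3-6) D0(2)[OF \<psi>(1,2)]])
  next
    show "lconv (lconv (\<lambda>s. f' (s / \<epsilon>) / \<epsilon>) (lconv k' h')) (pairing (\<lambda>s x. U s x - indicator {0<..<T} s *\<^sub>R u0' x) \<psi>) r
          = lconv (\<lambda>s. f (s / \<epsilon>)) (pairing D \<psi>) r"
      if "L2_space \<Omega> \<psi>" "f \<in> bumps" "f' \<in> bumps" "\<forall>x. (f has_real_derivative f' x) (at x)" "0 < \<epsilon>" "\<epsilon> < r" "r < T" for \<psi> f f' \<epsilon> r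
      by (rule weak_dt_pairing[OF \<Omega> causal_L1_lconv[OF k(1) h(1)] K U u0 D D0(1) that(1-3) that(4)[rule_format] that(5-7)])
    show "\<exists>d>0. AE t in lborel. 0 < t \<and> t < d \<longrightarrow> \<bar>lconv k' (pairing U \<psi>) t\<bar> \<le> e" if "L2_space \<Omega> \<psi>" "0 < e" for \<psi> e
      by (rule initial_value_pairing[OF \<Omega> T k U uC that])
  qed
qed

text \<open>Cutting off the mollified function at \<open>0\<close> and \<open>T\<close> only decreases its distance to \<open>U\<close>, which
  vanishes outside \<open>(0, T)\<close>.\<close>

lemma mollification_L2_spacetime:
  fixes U :: "real \<Rightarrow> 'a::euclidean_space \<Rightarrow> real"
  assumes T: "0 < T" and \<Omega>: "open \<Omega>" "bounded \<Omega>" and U: "L2_spacetime T \<Omega> U"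
    and \<rho>: "\<rho> \<in> bumps" "\<And>x. 0 \<le> \<rho> x" "integrable lborel \<rho>" "(LBINT a. \<rho> a) = 1"
    and \<epsilon>: "\<epsilon> \<longlonglongrightarrow> 0" "\<And>n. 0 < \<epsilon> n"
  shows "(\<lambda>n::nat. \<integral>z. (case z of (t, x) \<Rightarrow> (indicator {0<..<T} t *\<^sub>R lconv (\<lambda>s. \<rho> (s / \<epsilon> n) / \<epsilon> n) (\<lambda>s. U s x) t - U t x)\<^sup>2) \<partial>lborel2) \<longlonglongrightarrow> 0"
proof -
  define b where "b n s = \<rho> (s / \<epsilon> n) / \<epsilon> n" for n s
  have \<rho>m: "\<rho> \<in> borel_measurable borel" using \<rho>(3) by (auto dest: borel_measurable_integrable)
  have b: "b n \<in> borel_measurable borel" for n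
    using \<rho>m unfolding b_def by measurable
  have bC: "\<exists>C. \<forall>s. \<bar>b n s\<bar> \<le> C" for n
  proof -
    obtain C where "\<And>x. \<bar>1 / \<epsilon> n * \<rho> x\<bar> \<le> C" using bumps_bounded[OF bumps.scale[OF \<rho>(1)]] by metis
    then show ?thesis by (auto simp: b_def)
  qed
  let ?d = "\<lambda>n t x. indicator {0<..<T} t *\<^sub>R lconv (b n) (\<lambda>s. U s x) t - U t x"
  have d: "L2_spacetime T \<Omega> (?d n)" for n
  proof -
    obtain C where "\<And>s. \<bar>b n s\<bar> \<le> C" using bC by blast
    then show ?thesis by (intro L2_spacetime_diff L2_spacetime_lconv[OF T \<Omega> U b] U)
  qed
  have eq: "ennreal (\<integral>z. (case z of (t, x) \<Rightarrow> (?d n t x)\<^sup>2) \<partial>lborel2) = (\<integral>\<^sup>+z. ennreal (case z of (t, x) \<Rightarrow> (?d n t x)\<^sup>2) \<partial>lborel2)" for n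
    using L2_spacetimeD(3)[OF d[of n]] by (intro nn_integral_eq_integral[symmetric]) auto
  have Um: "(\<lambda>z. case z of (t, x) \<Rightarrow> U t x) \<in> borel_measurable borel"
    using L2_spacetimeD(1)[OF U] by (simp add: lborel_prod)
  have lim: "(\<lambda>n. \<integral>\<^sup>+z. ennreal (\<bar>\<integral>a. \<rho> a * ((case z - (\<epsilon> n * a) *\<^sub>R (1, 0) of (t, x) \<Rightarrow> U t x) - (case z of (t, x) \<Rightarrow> U t x)) \<partial>lborel\<bar>\<^sup>2) \<partial>lborel) \<longlonglongrightarrow> 0"
  proof (rule mollification_converges[OF \<rho>m Um \<rho>(2,3,4) _ _ \<epsilon>(1)])
    show "integrable lborel (\<lambda>z. \<bar>case z of (t, x) \<Rightarrow> U t x\<bar>\<^sup>2)"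
      using L2_spacetimeD(3)[OF U] unfolding lborel_prod by (simp add: case_prod_unfold)
  qed simp
  have le: "(\<integral>\<^sup>+z. ennreal (case z of (t, x) \<Rightarrow> (?d n t x)\<^sup>2) \<partial>lborel2)
      \<le> (\<integral>\<^sup>+z. ennreal (\<bar>\<integral>a. \<rho> a * ((case z - (\<epsilon> n * a) *\<^sub>R (1, 0) of (t, x) \<Rightarrow> U t x) - (case z of (t, x) \<Rightarrow> U t x)) \<partial>lborel\<bar>\<^sup>2) \<partial>lborel)" for n
    unfolding lborel_prod
  proof (rule nn_integral_mono_AE)
    have ae: "AE x in lborel. AE t in lborel. (?d n t x)\<^sup>2 \<le> (LBINT a. \<rho> a * (U (t - \<epsilon> n * a) x - U t x))\<^sup>2"
      using L2_spacetime_time_slice[OF U \<Omega>]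
    proof eventually_elim
      case (elim x)
      have "lconv (b n) (\<lambda>s. U s x) t - U t x = (LBINT a. \<rho> a * (U (t - \<epsilon> n * a) x - U t x))" for t
        unfolding b_def[abs_def] by (rule mollification_eq[OF \<rho>(1,3,4) \<epsilon>(2) causal_L1D(1)[OF elim]])
      then show ?case
        using L2_spacetimeD(2)[OF U, of _ x] by (intro AE_I2) (auto simp: indicator_def)
    qed
    have m1: "(\<lambda>z. ?d n (fst z) (snd z)) \<in> borel_measurable lborel2"
      using L2_spacetimeD(1)[OF d[of n]] by (simp add: case_prod_unfold)
    have m2: "(\<lambda>z. \<integral>a. \<rho> a * (U (fst z - \<epsilon> n * a) (snd z) - U (fst z) (snd z)) \<partial>lborel) \<in> borel_measurable lborel2"
    proof -
      note [measurable] = \<rho>m L2_spacetimeD(1)[OF U]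
      show ?thesis by measurable
    qed
    note [measurable] = m1 m2
    have "{z \<in> space lborel2. (?d n (fst z) (snd z))\<^sup>2 \<le> (LBINT a. \<rho> a * (U (fst z - \<epsilon> n * a) (snd z) - U (fst z) (snd z)))\<^sup>2} \<in> sets lborel2"
      by measurable
    then have "AE z in lborel2. (?d n (fst z) (snd z))\<^sup>2 \<le> (LBINT a. \<rho> a * (U (fst z - \<epsilon> n * a) (snd z) - U (fst z) (snd z)))\<^sup>2"
      using ae lborel_pair.AE_commute[of "\<lambda>t x. (?d n t x)\<^sup>2 \<le> (LBINT a. \<rho> a * (U (t - \<epsilon> n * a) x - U t x))\<^sup>2"]
        lborel_pair.AE_pair_iff[of "\<lambda>t x. (?d n t x)\<^sup>2 \<le> (LBINT a. \<rho> a * (U (t - \<epsilon> n * a) x - U t x))\<^sup>2"]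
      by blast
    then show "AE z in lborel. ennreal (case z of (t, x) \<Rightarrow> (?d n t x)\<^sup>2)
        \<le> ennreal (\<bar>\<integral>a. \<rho> a * ((case z - (\<epsilon> n * a) *\<^sub>R (1, 0) of (t, x) \<Rightarrow> U t x) - (case z of (t, x) \<Rightarrow> U t x)) \<partial>lborel\<bar>\<^sup>2)"
      unfolding lborel_prod by eventually_elim (auto simp: case_prod_unfold intro!: ennreal_leI)
  qed
  have "(\<lambda>n. ennreal (\<integral>z. (case z of (t, x) \<Rightarrow> (?d n t x)\<^sup>2) \<partial>lborel2)) \<longlonglongrightarrow> ennreal 0"
    unfolding eq ennreal_0
    by (rule tendsto_sandwich[OF _ always_eventually[OF allI[OF le]] tendsto_const lim]) simp
  then have "(\<lambda>n. \<integral>z. (case z of (t, x) \<Rightarrow> (?d n t x)\<^sup>2) \<partial>lborel2) \<longlonglongrightarrow> 0"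
    by (subst (asm) tendsto_ennreal_iff) (auto intro!: always_eventually Bochner_Integration.integral_nonneg)
  then show ?thesis by (simp add: b_def[abs_def])
qed

theorem theorem5p1:
  fixes T a1 a2 :: real
    and \<Omega> :: "'a::euclidean_space set"
    and k l \<Phi> :: "real \<Rightarrow> real"
    and a f u\<^sub>1 u\<^sub>2 :: "real \<Rightarrow> 'a \<Rightarrow> real"
    and u0 :: "'a \<Rightarrow> real"
  assumes "T > 0"
    and "open \<Omega>" "connected \<Omega>" "bounded \<Omega>" "\<Omega> \<noteq> {}"
    and "(k, l) \<in> PC"
    and "continuous_on UNIV \<Phi>" "strict_mono \<Phi>" "\<Phi> 0 = 0"
    and "(\<lambda>(t, x). a t x) \<in> borel_measurable (lebesgue_on ({0<..<T} \<times> \<Omega>))"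
    and "a1 > 0" "a2 > 0"
    and "AE (t, x) in lebesgue_on ({0<..<T} \<times> \<Omega>). a1 \<le> a t x \<and> a t x \<le> a2"
    and "u0 \<in> L2 \<Omega>"
    and "(\<lambda>(t, x). f t x) \<in> L2 ({0<..<T} \<times> \<Omega>)"
    and "weak_solution k l T \<Omega> \<Phi> a u0 f u\<^sub>1"
    and "weak_solution k l T \<Omega> \<Phi> a u0 f u\<^sub>2"
  shows "AE (t, x) in lebesgue_on ({0<..<T} \<times> \<Omega>). u\<^sub>1 t x = u\<^sub>2 t x"
proof -
  note T = \<open>T > 0\<close> and \<Omega> = \<open>open \<Omega>\<close> \<open>bounded \<Omega>\<close>
  obtain k' l' h' where ker: "causal_L1 k'" "causal_L1 l'" "causal_L1 h'" "\<forall>s. 0 \<le> k' s" "\<forall>s\<ge>T. k' s = 0"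
    "\<forall>s s'. 0 < s \<longrightarrow> s \<le> s' \<longrightarrow> s' < T \<longrightarrow> k' s' \<le> k' s"
    "eq_upto T (lconv k' l') (indicator {0<..<T})" "eq_upto T (\<lambda>t. h' t + lconv h' l' t) l'"
    "AE s in lborel. 0 < s \<and> s < T \<longrightarrow> k s = k' s"
    "AE s in lborel. 0 < s \<and> s < T \<longrightarrow> reg_h l 1 s = h' s"
    "\<forall>t\<le>T. reg_k k l 1 t = lconv k' h' t"
    by (rule PC_kernels[OF \<open>(k, l) \<in> PC\<close> T])
  note k = ker(1) ker(4-6)[rule_format] ker(9) and l = ker(2) and h = ker(3,10) and kl = ker(7) and hl = ker(8)
    and K = ker(11)[rule_format]
  obtain u0' where u0': "L2_space \<Omega> u0'" "AE x in lborel. x \<in> \<Omega> \<longrightarrow> u0 x = u0' x"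
    by (rule L2_space_representative[OF \<open>u0 \<in> L2 \<Omega>\<close> borel_open[OF \<Omega>(1)]])
  obtain U\<^sub>1 V\<^sub>1 D\<^sub>1 :: "real \<Rightarrow> 'a \<Rightarrow> real" and G\<^sub>1 :: "real \<Rightarrow> 'a \<Rightarrow> 'a" where s1:
    "L2_spacetime T \<Omega> U\<^sub>1" "L2_spacetime T \<Omega> V\<^sub>1" "L2_spacetime T \<Omega> D\<^sub>1" "L2_spacetime T \<Omega> G\<^sub>1"
    "AE (t, x) in lborel2. 0 < t \<and> t < T \<and> x \<in> \<Omega> \<longrightarrow> u\<^sub>1 t x = U\<^sub>1 t x"
    "AE (t, x) in lborel2. 0 < t \<and> t < T \<and> x \<in> \<Omega> \<longrightarrow> a t x * \<Phi> (u\<^sub>1 t x) = V\<^sub>1 t x"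
    "AE s in lborel. 0 < s \<and> s < T \<longrightarrow> (\<exists>\<psi> g. gradient_representative \<Omega> \<psi> g (V\<^sub>1 s) (G\<^sub>1 s))"
    "scalar_equations T \<Omega> k' h' u0' (\<lambda>\<psi> t. LINT x|lebesgue_on \<Omega>. conv (reg_h l 1) (\<lambda>\<tau>. f \<tau> x) t * \<psi> x) U\<^sub>1 D\<^sub>1 G\<^sub>1"
    by (rule weak_solution_representatives[OF T \<Omega> k(1,5) h K u0' \<open>weak_solution k l T \<Omega> \<Phi> a u0 f u\<^sub>1\<close>])
  note eqs1 = scalar_equationsD[OF s1(8)]
  obtain U\<^sub>2 V\<^sub>2 D\<^sub>2 :: "real \<Rightarrow> 'a \<Rightarrow> real" and G\<^sub>2 :: "real \<Rightarrow> 'a \<Rightarrow> 'a" where s2: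
    "L2_spacetime T \<Omega> U\<^sub>2" "L2_spacetime T \<Omega> V\<^sub>2" "L2_spacetime T \<Omega> D\<^sub>2" "L2_spacetime T \<Omega> G\<^sub>2"
    "AE (t, x) in lborel2. 0 < t \<and> t < T \<and> x \<in> \<Omega> \<longrightarrow> u\<^sub>2 t x = U\<^sub>2 t x"
    "AE (t, x) in lborel2. 0 < t \<and> t < T \<and> x \<in> \<Omega> \<longrightarrow> a t x * \<Phi> (u\<^sub>2 t x) = V\<^sub>2 t x"
    "AE s in lborel. 0 < s \<and> s < T \<longrightarrow> (\<exists>\<psi> g. gradient_representative \<Omega> \<psi> g (V\<^sub>2 s) (G\<^sub>2 s))"
    "scalar_equations T \<Omega> k' h' u0' (\<lambda>\<psi> t. LINT x|lebesgue_on \<Omega>. conv (reg_h l 1) (\<lambda>\<tau>. f \<tau> x) t * \<psi> x) U\<^sub>2 D\<^sub>2 G\<^sub>2"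
    by (rule weak_solution_representatives[OF T \<Omega> k(1,5) h K u0' \<open>weak_solution k l T \<Omega> \<Phi> a u0 f u\<^sub>2\<close>])
  note eqs2 = scalar_equationsD[OF s2(8)]
  define U where "U t x = U\<^sub>1 t x - U\<^sub>2 t x" for t x
  define V where "V t x = V\<^sub>1 t x - V\<^sub>2 t x" for t x
  define G where "G t x = G\<^sub>1 t x - G\<^sub>2 t x" for t x
  have U: "L2_spacetime T \<Omega> U" and V: "L2_spacetime T \<Omega> V" and G: "L2_spacetime T \<Omega> G"
    unfolding U_def[abs_def] V_def[abs_def] G_def[abs_def] by (intro L2_spacetime_diff s1(1-4) s2(1-4))+
  have identity: "lconv (\<lambda>s. p (s / \<epsilon>)) (pairing U \<psi>') t + lconv (lconv l' (\<lambda>s. p (s / \<epsilon>))) (pairing G g') t = 0"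
    if rep: "gradient_representative \<Omega> \<psi> g \<psi>' g'" and p: "p \<in> bumps" "0 < \<epsilon>" "t < T" for \<psi> g \<psi>' g' p \<epsilon> t
  proof -
    have \<psi>: "L2_space \<Omega> \<psi>'" and g: "L2_space \<Omega> g'" using rep by (auto simp: gradient_representative_def)
    show ?thesis
      unfolding U_def[abs_def] G_def[abs_def]
      by (rule difference_identity[OF T k(1) l h(1) kl hl s1(1) s2(1) s1(3) s2(3) s1(4) s2(4) \<psi> g u0'(1)
            eqs1(1)[OF rep] eqs2(1)[OF rep] eqs1(2)[OF \<psi>] eqs2(2)[OF \<psi>] eqs1(3)[OF \<psi>] eqs2(3)[OF \<psi>] p])
  qed
  obtain \<rho> where \<rho>: "\<rho> \<in> bumps" "\<And>x. 0 \<le> \<rho> x" "(LBINT x. \<rho> x) = 1" "integrable lborel \<rho>"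
    using unit_mollifier by blast
  obtain \<rho>' where \<rho>': "\<rho>' \<in> bumps" "\<And>x. (\<rho> has_real_derivative \<rho>' x) (at x)"
    using bumps_derivative[OF \<rho>(1)] by blast
  define \<epsilon> where "\<epsilon> n = 1 / real (Suc n)" for n
  have \<epsilon>: "\<epsilon> \<longlonglongrightarrow> 0" "\<And>n. 0 < \<epsilon> n" unfolding \<epsilon>_def using LIMSEQ_inverse_real_of_nat by (auto simp: inverse_eq_divide)
  define b where "b n s = \<rho> (s / \<epsilon> n) / \<epsilon> n" for n s
  define P where "P n t x = indicator {0<..<T} t *\<^sub>R lconv (b n) (\<lambda>s. U s x) t" for n t x
  define Q where "Q n t x = indicator {0<..<T} t *\<^sub>R lconv (b n) (\<lambda>s. V s x) t" for n t x
  have bn: "causal_L1 (b n)" "\<exists>C. \<forall>s. \<bar>b n s\<bar> \<le> C" "L2_spacetime T \<Omega> (P n)" "L2_spacetime T \<Omega> (Q n)"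
    "(\<integral>z. (case z of (t, x) \<Rightarrow> P n t x * Q n t x) \<partial>lborel2) \<le> 0" for n
  proof -
    have \<rho>s: "(\<lambda>x. 1 / \<epsilon> n * \<rho> x) \<in> bumps" "(\<lambda>x. 1 / \<epsilon> n * \<rho>' x) \<in> bumps" "(\<lambda>x. 1 / \<epsilon> n * (1 / \<epsilon> n * \<rho>' x)) \<in> bumps"
      by (intro bumps.scale \<rho>(1) \<rho>'(1))+
    have b_eq: "b n = (\<lambda>s. (\<lambda>x. 1 / \<epsilon> n * \<rho> x) (s / \<epsilon> n))" by (simp add: b_def[abs_def])
    show b: "causal_L1 (b n)" using bump_scaled(1)[OF \<rho>s(1) \<epsilon>(2)] by (simp add: b_eq)
    define b' where "b' s = (1 / \<epsilon> n * \<rho>' (s / \<epsilon> n)) / \<epsilon> n" for s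
    have b': "causal_L1 b'" using bump_scaled(1)[OF \<rho>s(3) \<epsilon>(2)] by (simp add: b'_def[abs_def] mult.commute)
    have prim: "eq_upto T (lconv (indicator {0<..<T}) b') (b n)"
      using bump_scaled_primitive[OF \<rho>s(1,2) DERIV_cmult[OF \<rho>'(2)] \<epsilon>(2)[of n], of _ T] by (simp add: eq_upto_def b_eq b'_def[abs_def])
    obtain C where "\<And>x. \<bar>1 / \<epsilon> n * \<rho> x\<bar> \<le> C" using bumps_bounded[OF \<rho>s(1)] by metis
    then have C: "\<bar>b n s\<bar> \<le> C" for s by (simp add: b_eq)
    then show "\<exists>C. \<forall>s. \<bar>b n s\<bar> \<le> C" by blast
    define \<beta> where "\<beta> = lconv l' (b n)"
    have \<beta>: "causal_L1 \<beta>" unfolding \<beta>_def by (rule causal_L1_lconv[OF l b])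
    have \<beta>C: "\<bar>\<beta> s\<bar> \<le> C * (LBINT s. norm (l' s))" for s
      using lconv_bounded[of "b n" C l' s, OF _ C] b l by (simp add: \<beta>_def lconv_commute[of l'] causal_L1D)
    note mb = causal_L1D(2)[OF b] and m\<beta> = causal_L1D(2)[OF \<beta>]
    show P: "L2_spacetime T \<Omega> (P n)" and Q: "L2_spacetime T \<Omega> (Q n)"
      unfolding P_def[abs_def] Q_def[abs_def] by (rule L2_spacetime_lconv[OF T \<Omega> U mb C] L2_spacetime_lconv[OF T \<Omega> V mb C])+
    define X where "X t x = indicator {0<..<T} t *\<^sub>R lconv \<beta> (\<lambda>s. G s x) t" for t x
    define Y where "Y t x = indicator {0<..<T} t *\<^sub>R lconv (b n) (\<lambda>s. G s x) t" for t x
    have X: "L2_spacetime T \<Omega> X" and Y: "L2_spacetime T \<Omega> Y"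
      unfolding X_def[abs_def] Y_def[abs_def] by (rule L2_spacetime_lconv[OF T \<Omega> G m\<beta> \<beta>C] L2_spacetime_lconv[OF T \<Omega> G mb C])+
    \<comment> \<open>Testing is with the slices of the two solutions separately, followed by subtraction.\<close>
    have diag: "(LBINT x. lconv (b n) (\<lambda>s. U s x) t * lconv (b n) (\<lambda>s. V s x) t)
        + (LBINT x. lconv \<beta> (\<lambda>s. G s x) t \<bullet> lconv (b n) (\<lambda>s. G s x) t) = 0" if t: "t < T" for t
    proof (rule diagonal_identity[OF T \<Omega> U V G mb C m\<beta> \<beta>C])
      show "AE s in lborel. 0 < s \<and> s < T \<longrightarrow> lconv (b n) (pairing U (V s)) t + lconv \<beta> (pairing G (G s)) t = 0"
        using s1(7) s2(7)
      proof eventually_elim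
        case (elim s)
        show ?case
        proof
          assume s: "0 < s \<and> s < T"
          obtain \<psi>1 g1 where r1: "gradient_representative \<Omega> \<psi>1 g1 (V\<^sub>1 s) (G\<^sub>1 s)" using elim(1) s by blast
          obtain \<psi>2 g2 where r2: "gradient_representative \<Omega> \<psi>2 g2 (V\<^sub>2 s) (G\<^sub>2 s)" using elim(2) s by blast
          have sp: "L2_space \<Omega> (V\<^sub>1 s)" "L2_space \<Omega> (V\<^sub>2 s)" "L2_space \<Omega> (G\<^sub>1 s)" "L2_space \<Omega> (G\<^sub>2 s)"
            using r1 r2 by (auto simp: gradient_representative_def)
          have "lconv (b n) (pairing U (V\<^sub>1 s)) t + lconv \<beta> (pairing G (G\<^sub>1 s)) t = 0"
            using identity[OF r1 \<rho>s(1) \<epsilon>(2)[of n] t] by (simp add: b_eq \<beta>_def)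
          moreover have "lconv (b n) (pairing U (V\<^sub>2 s)) t + lconv \<beta> (pairing G (G\<^sub>2 s)) t = 0"
            using identity[OF r2 \<rho>s(1) \<epsilon>(2)[of n] t] by (simp add: b_eq \<beta>_def)
          moreover have "lconv (b n) (pairing U (V s)) t = lconv (b n) (pairing U (V\<^sub>1 s)) t - lconv (b n) (pairing U (V\<^sub>2 s)) t"
            unfolding V_def[abs_def] by (rule lconv_pairing_diff_right[OF U sp(1,2) mb C])
          moreover have "lconv \<beta> (pairing G (G s)) t = lconv \<beta> (pairing G (G\<^sub>1 s)) t - lconv \<beta> (pairing G (G\<^sub>2 s)) t"
            using lconv_pairing_diff_right[OF G sp(3,4) m\<beta> \<beta>C, of t] by (simp add: G_def[abs_def])
          ultimately show "lconv (b n) (pairing U (V s)) t + lconv \<beta> (pairing G (G s)) t = 0" by simp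
        qed
      qed
    qed
    have iPQ: "integrable lborel2 (\<lambda>(t, x). P n t x \<bullet> Q n t x)"
      and iXY: "integrable lborel2 (\<lambda>(t, x). X t x \<bullet> Y t x)"
      by (rule L2_spacetime_inner_integrable[OF P Q] L2_spacetime_inner_integrable[OF X Y])+
    have "(\<integral>z. (case z of (t, x) \<Rightarrow> P n t x \<bullet> Q n t x) \<partial>lborel2) = (LBINT t. (LBINT x. P n t x \<bullet> Q n t x))"
      using lborel_pair.integral_fst[OF iPQ] by simp
    also have "\<dots> = (LBINT t. - (LBINT x. X t x \<bullet> Y t x))"
    proof (rule Bochner_Integration.integral_cong[OF refl])
      fix t
      show "(LBINT x. P n t x \<bullet> Q n t x) = - (LBINT x. X t x \<bullet> Y t x)"
      proof (cases "0 < t \<and> t < T")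
        case True
        then show ?thesis using diag[of t] by (simp add: P_def Q_def X_def Y_def)
      next
        case False
        then have "indicator {0<..<T} t = (0::real)" by auto
        then show ?thesis by (simp add: P_def Q_def X_def Y_def)
      qed
    qed
    also have "\<dots> = - (\<integral>z. (case z of (t, x) \<Rightarrow> X t x \<bullet> Y t x) \<partial>lborel2)"
      using lborel_pair.integral_fst[OF iXY] by simp
    also have "\<dots> \<le> 0"
      using spacetime_positive[OF T \<Omega> G k(1-4) l kl b C b' prim \<beta>C[unfolded \<beta>_def]] by (simp add: X_def Y_def \<beta>_def)
    finally show "(\<integral>z. (case z of (t, x) \<Rightarrow> P n t x * Q n t x) \<partial>lborel2) \<le> 0" by simp
  qed
  have sq: "(case z of (t, x) \<Rightarrow> F t x)\<^sup>2 = (case z of (t, x) \<Rightarrow> (norm (F t x))\<^sup>2)" for F :: "real \<Rightarrow> 'a \<Rightarrow> real" and z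
    by (simp add: case_prod_unfold)
  have "(\<lambda>n. \<integral>z. (case z of (t, x) \<Rightarrow> P n t x) * (case z of (t, x) \<Rightarrow> Q n t x) \<partial>lborel2)
      \<longlonglongrightarrow> (\<integral>z. (case z of (t, x) \<Rightarrow> U t x) * (case z of (t, x) \<Rightarrow> V t x) \<partial>lborel2)"
  proof (rule L2_inner_limit)
    show "integrable lborel2 (\<lambda>z. (case z of (t, x) \<Rightarrow> U t x)\<^sup>2)" "integrable lborel2 (\<lambda>z. (case z of (t, x) \<Rightarrow> V t x)\<^sup>2)"
      unfolding sq by (rule L2_spacetimeD(3)[OF U] L2_spacetimeD(3)[OF V])+
    have d: "((case z of (t, x) \<Rightarrow> F t x) - (case z of (t, x) \<Rightarrow> F' t x))\<^sup>2 = (case z of (t, x) \<Rightarrow> (norm (F t x - F' t x))\<^sup>2)" for F F' :: "real \<Rightarrow> 'a \<Rightarrow> real" and z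
      by (simp add: case_prod_unfold)
    show "integrable lborel2 (\<lambda>z. ((case z of (t, x) \<Rightarrow> P n t x) - (case z of (t, x) \<Rightarrow> U t x))\<^sup>2)"
      "integrable lborel2 (\<lambda>z. ((case z of (t, x) \<Rightarrow> Q n t x) - (case z of (t, x) \<Rightarrow> V t x))\<^sup>2)" for n
      unfolding d by (rule L2_spacetimeD(3)[OF L2_spacetime_diff[OF bn(3) U]] L2_spacetimeD(3)[OF L2_spacetime_diff[OF bn(4) V]])+
    show "(\<lambda>n. \<integral>z. ((case z of (t, x) \<Rightarrow> P n t x) - (case z of (t, x) \<Rightarrow> U t x))\<^sup>2 \<partial>lborel2) \<longlonglongrightarrow> 0"
      using mollification_L2_spacetime[OF T \<Omega> U \<rho>(1,2,4,3) \<epsilon>] by (simp add: case_prod_unfold P_def b_def[abs_def])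
    show "(\<lambda>n. \<integral>z. ((case z of (t, x) \<Rightarrow> Q n t x) - (case z of (t, x) \<Rightarrow> V t x))\<^sup>2 \<partial>lborel2) \<longlonglongrightarrow> 0"
      using mollification_L2_spacetime[OF T \<Omega> V \<rho>(1,2,4,3) \<epsilon>] by (simp add: case_prod_unfold Q_def b_def[abs_def])
  qed (rule L2_spacetimeD(1)[OF U] L2_spacetimeD(1)[OF V] L2_spacetimeD(1)[OF bn(3)] L2_spacetimeD(1)[OF bn(4)])+
  then have nonpos: "(\<integral>z. (case z of (t, x) \<Rightarrow> U t x) * (case z of (t, x) \<Rightarrow> V t x) \<partial>lborel2) \<le> 0"
    by (rule LIMSEQ_le_const2) (use bn(5) in \<open>auto simp: case_prod_unfold\<close>)
  have S: "{0<..<T} \<times> \<Omega> \<in> sets borel" using \<Omega> by (intro borel_open open_Times) auto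
  have "AE z in lborel. z \<in> {0<..<T} \<times> \<Omega> \<longrightarrow> (case z of (t, x) \<Rightarrow> a1 \<le> a t x \<and> a t x \<le> a2)"
    using \<open>AE (t, x) in lebesgue_on ({0<..<T} \<times> \<Omega>). a1 \<le> a t x \<and> a t x \<le> a2\<close> S by (simp add: AE_lebesgue_on_iff)
  then have a: "AE z in lborel2. z \<in> {0<..<T} \<times> \<Omega> \<longrightarrow> (case z of (t, x) \<Rightarrow> a1 \<le> a t x \<and> a t x \<le> a2)"
    unfolding lborel_prod .
  have sign: "0 \<le> (r - s) * (c * \<Phi> r - c * \<Phi> s) \<and> ((r - s) * (c * \<Phi> r - c * \<Phi> s) = 0 \<longrightarrow> r = s)" if "0 < c" for r s c
  proof -
    consider "r < s" | "r = s" | "s < r" by linarith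
    then show ?thesis
    proof cases
      case 1
      then have "\<Phi> r < \<Phi> s" using \<open>strict_mono \<Phi>\<close> by (simp add: strict_mono_def)
      then have "c * \<Phi> r < c * \<Phi> s" using that by simp
      then have "0 < (r - s) * (c * \<Phi> r - c * \<Phi> s)" using 1 by (intro mult_neg_neg) auto
      then show ?thesis by (intro conjI impI) linarith+
    next
      case 3
      then have "\<Phi> s < \<Phi> r" using \<open>strict_mono \<Phi>\<close> by (simp add: strict_mono_def)
      then have "c * \<Phi> s < c * \<Phi> r" using that by simp
      then have "0 < (r - s) * (c * \<Phi> r - c * \<Phi> s)" using 3 by (intro mult_pos_pos) auto
      then show ?thesis by (intro conjI impI) linarith+
    qed simp
  qed
  \<comment> \<open>On \<open>(0, T) \<times> \<Omega>\<close> the product is \<open>a (u\<^sub>1 - u\<^sub>2) (\<Phi> u\<^sub>1 - \<Phi> u\<^sub>2)\<close>.\<close>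
  have pointwise: "AE z in lborel2. 0 \<le> (case z of (t, x) \<Rightarrow> U t x) * (case z of (t, x) \<Rightarrow> V t x) \<and>
      ((case z of (t, x) \<Rightarrow> U t x) * (case z of (t, x) \<Rightarrow> V t x) = 0 \<longrightarrow> z \<in> {0<..<T} \<times> \<Omega> \<longrightarrow> (case z of (t, x) \<Rightarrow> u\<^sub>1 t x = u\<^sub>2 t x))"
    using a s1(5,6) s2(5,6)
  proof eventually_elim
    case (elim z)
    obtain t x where z: "z = (t, x)" by (cases z)
    show ?case
    proof (cases "0 < t \<and> t < T \<and> x \<in> \<Omega>")
      case True
      then have "U t x = u\<^sub>1 t x - u\<^sub>2 t x" "V t x = a t x * \<Phi> (u\<^sub>1 t x) - a t x * \<Phi> (u\<^sub>2 t x)" "0 < a t x"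
        using elim \<open>a1 > 0\<close> by (auto simp: z U_def V_def)
      then show ?thesis using sign[of "a t x" "u\<^sub>1 t x" "u\<^sub>2 t x"] by (simp add: z)
    next
      case False
      then show ?thesis using L2_spacetimeD(2)[OF U, of t x] by (auto simp: z)
    qed
  qed
  have iUV: "integrable lborel2 (\<lambda>z. (case z of (t, x) \<Rightarrow> U t x) * (case z of (t, x) \<Rightarrow> V t x))"
    using L2_spacetime_inner_integrable[OF U V] by (simp add: case_prod_unfold)
  have nn: "AE z in lborel2. 0 \<le> (case z of (t, x) \<Rightarrow> U t x) * (case z of (t, x) \<Rightarrow> V t x)"
    using pointwise by eventually_elim simp
  have "(\<integral>z. (case z of (t, x) \<Rightarrow> U t x) * (case z of (t, x) \<Rightarrow> V t x) \<partial>lborel2) = 0"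
    using nonpos integral_nonneg_AE[OF nn] by linarith
  then have "AE z in lborel2. (case z of (t, x) \<Rightarrow> U t x) * (case z of (t, x) \<Rightarrow> V t x) = 0"
    using integral_nonneg_eq_0_iff_AE[OF iUV nn] by simp
  then have "AE z in lborel2. z \<in> {0<..<T} \<times> \<Omega> \<longrightarrow> (case z of (t, x) \<Rightarrow> u\<^sub>1 t x = u\<^sub>2 t x)"
    using pointwise by eventually_elim blast
  then show ?thesis unfolding AE_lebesgue_on_iff[OF S] lborel_prod .
qed


end
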